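(* Given a tree $T$, the algorithm described below returns, in time linear in the order of $T$, a set of pairs of vertices of $T$ which are exactly the pairs of end-vertices of the maximal geodesics of some geodesic packing of $T$ of maximum cardinality ${\rm gpack}(T)$. The algorithm: set $\Psi=\emptyset$ and replace $T$ by ${\rm SM}(T)$. While $T$ has at least $3$ vertices: choose an end support vertex $p$ of $T$ and two leaf neighbours $u_1,u_2$ of $p$; add the pair $(u_1,u_2)$ to $\Psi$; replace $T$ by $T-\{p,u_1,\ldots,u_t\}$, where $u_1,\ldots,u_t$ are all leaf neighbours of $p$; replace $T$ by ${\rm SM}(T)$. After the loop, if $T$ has exactly $2$ vertices, add the pair consisting of these two vertices to $\Psi$. Output $\Psi$.
   Context: A geodesic in a graph is a shortest path; it is maximal if it is not contained as a subpath in any other geodesic. A geodesic packing of a graph $G$ is a set of pairwise vertex-disjoint maximal geodesics of $G$, and ${\rm gpack}(G)$ is the maximum cardinality of a geodesic packing. In a tree, a path is determined by its two end-vertices. Smoothing a vertex $u$ of degree $2$ with neighbours $x,y$ means deleting $u$ and adding the edge $xy$; ${\rm SM}(G)$ denotes the graph obtained from $G$ by smoothing all vertices of degree $2$ (well defined up to isomorphism). A support vertex of a tree is a vertex adjacent to a leaf; an end support vertex is a support vertex with at most one non-leaf neighbour.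
   Formalization: Geodesics are required to have two distinct end-vertices; this changes only the one-vertex tree, where with one-vertex geodesics gpack would be 1 while the algorithm outputs the empty set, so the claim would be false there. *)

theory Defs
  imports "Graph_Theory.Graph_Theory" "HOL-Library.Sublist"
begin

section \<open>Trees\<close>

text \<open>
  Finite simple undirected graphs are the symmetric loop-free digraphs of the locale
  \<^locale>\<open>pair_graph\<close>. The library predicate \<^const>\<open>tree\<close> is of no use for them: it counts
  \<open>u, v, u\<close> along an edge as a directed cycle. Here a cycle is a path on at least three
  vertices whose ends are adjacent.
\<close>

definition utree :: "'a pair_pre_digraph \<Rightarrow> bool" where
  "utree G \<longleftrightarrow> pair_graph G \<and> connected (with_proj G) \<and>
     \<not> (\<exists>p. vpath p (with_proj G) \<and> 3 \<le> length p \<and> (last p, hd p) \<in> parcs G)"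

definition nbrs :: "'a pair_pre_digraph \<Rightarrow> 'a \<Rightarrow> 'a set" where
  "nbrs G v = {w. (v, w) \<in> parcs G}"

definition leaf :: "'a pair_pre_digraph \<Rightarrow> 'a \<Rightarrow> bool" where
  "leaf G v \<longleftrightarrow> v \<in> pverts G \<and> out_degree (with_proj G) v = 1"

definition leaf_nbrs :: "'a pair_pre_digraph \<Rightarrow> 'a \<Rightarrow> 'a set" where
  "leaf_nbrs G v = {w \<in> nbrs G v. leaf G w}"

definition support_vertex :: "'a pair_pre_digraph \<Rightarrow> 'a \<Rightarrow> bool" where
  "support_vertex G v \<longleftrightarrow> v \<in> pverts G \<and> leaf_nbrs G v \<noteq> {}"

definition end_support_vertex :: "'a pair_pre_digraph \<Rightarrow> 'a \<Rightarrow> bool" where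
  "end_support_vertex G v \<longleftrightarrow>
     support_vertex G v \<and> card {w \<in> nbrs G v. \<not> leaf G w} \<le> 1"


section \<open>Geodesic packings\<close>

text \<open>
  Paths are vertex lists, so an undirected path with two ends occurs as a list and as its
  reversal. This is harmless: maximality is invariant under reversal, and a list and its
  reversal are not disjoint, so a packing contains at most one of them.

  A geodesic joins two distinct end-vertices. A one-vertex path could be maximal only if it is
  an isolated vertex, so among trees this convention matters for the one-vertex tree alone,
  where it gives \<open>gpack = 0\<close>, in agreement with the algorithm, which outputs no pair there.
\<close>

definition geodesic :: "'a pair_pre_digraph \<Rightarrow> 'a list \<Rightarrow> bool" where
  "geodesic G p \<longleftrightarrow> vpath p (with_proj G) \<and> hd p \<noteq> last p \<and>
     (\<forall>q. vpath q (with_proj G) \<and> hd q = hd p \<and> last q = last p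
        \<longrightarrow> vwalk_length p \<le> vwalk_length q)"

definition maximal_geodesic :: "'a pair_pre_digraph \<Rightarrow> 'a list \<Rightarrow> bool" where
  "maximal_geodesic G p \<longleftrightarrow> geodesic G p \<and> \<not> (\<exists>q. geodesic G q \<and> strict_sublist p q)"

definition geodesic_packing :: "'a pair_pre_digraph \<Rightarrow> 'a list set \<Rightarrow> bool" where
  "geodesic_packing G S \<longleftrightarrow>
     (\<forall>p\<in>S. maximal_geodesic G p) \<and> pairwise (\<lambda>p q. disjnt (set p) (set q)) S"

definition gpack :: "'a pair_pre_digraph \<Rightarrow> nat" where
  "gpack G = Max {card S | S. geodesic_packing G S}"


section \<open>Smoothing\<close>

definition remove_verts :: "'a pair_pre_digraph \<Rightarrow> 'a set \<Rightarrow> 'a pair_pre_digraph" where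
  "remove_verts G A =
     \<lparr> pverts = pverts G - A, parcs = {(v, w) \<in> parcs G. v \<notin> A \<and> w \<notin> A} \<rparr>"

definition smooth_step :: "'a pair_pre_digraph \<Rightarrow> 'a pair_pre_digraph \<Rightarrow> bool" where
  "smooth_step G G' \<longleftrightarrow> (\<exists>u x y. u \<in> pverts G \<and> x \<noteq> y \<and> nbrs G u = {x, y} \<and>
     G' = \<lparr> pverts = pverts (remove_verts G {u}),
            parcs = parcs (remove_verts G {u}) \<union> {(x, y), (y, x)} \<rparr>)"

text \<open>A relation, since the order in which the vertices are smoothed is left open.\<close>

definition is_SM :: "'a pair_pre_digraph \<Rightarrow> 'a pair_pre_digraph \<Rightarrow> bool" where
  "is_SM G H \<longleftrightarrow> smooth_step\<^sup>*\<^sup>* G H \<and> (\<forall>v\<in>pverts H. out_degree (with_proj H) v \<noteq> 2)"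


section \<open>The algorithm\<close>

text \<open>
  A state consists of the current tree and of \<open>\<Psi>\<close>, the list of the unordered pairs chosen so
  far, in the order in which they were added. All choices are nondeterministic.
\<close>

type_synonym 'a gp_state = "'a pair_pre_digraph \<times> 'a set list"

definition gp_start :: "'a pair_pre_digraph \<Rightarrow> 'a gp_state \<Rightarrow> bool" where
  "gp_start T s \<longleftrightarrow> (\<exists>T'. is_SM T T' \<and> s = (T', []))"

definition gp_guard :: "'a gp_state \<Rightarrow> bool" where
  "gp_guard s \<longleftrightarrow> 3 \<le> card (pverts (fst s))"

inductive gp_step :: "'a gp_state \<Rightarrow> 'a gp_state \<Rightarrow> bool" where
  "\<lbrakk> gp_guard (T, \<Psi>); end_support_vertex T p;
     u\<^sub>1 \<in> leaf_nbrs T p; u\<^sub>2 \<in> leaf_nbrs T p; u\<^sub>1 \<noteq> u\<^sub>2;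
     is_SM (remove_verts T (insert p (leaf_nbrs T p))) T' \<rbrakk>
   \<Longrightarrow> gp_step (T, \<Psi>) (T', \<Psi> @ [{u\<^sub>1, u\<^sub>2}])"

definition gp_reachable :: "'a pair_pre_digraph \<Rightarrow> 'a gp_state \<Rightarrow> bool" where
  "gp_reachable T s \<longleftrightarrow> (\<exists>s\<^sub>0. gp_start T s\<^sub>0 \<and> gp_step\<^sup>*\<^sup>* s\<^sub>0 s)"

definition gp_output :: "'a gp_state \<Rightarrow> 'a set list" where
  "gp_output s = snd s @ (if card (pverts (fst s)) = 2 then [pverts (fst s)] else [])"

definition gp_returns :: "'a pair_pre_digraph \<Rightarrow> 'a set list \<Rightarrow> bool" where
  "gp_returns T \<Psi> \<longleftrightarrow> (\<exists>s. gp_reachable T s \<and> \<not> gp_guard s \<and> \<Psi> = gp_output s)"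

text \<open>
  Total correctness of a nondeterministic algorithm needs, besides the correctness of what it
  returns, that no execution is infinite and none gets stuck for lack of a possible choice.
\<close>

definition gp_terminates :: "'a pair_pre_digraph \<Rightarrow> bool" where
  "gp_terminates T \<longleftrightarrow> \<not> (\<exists>f. gp_start T (f 0) \<and> (\<forall>i::nat. gp_step (f i) (f (Suc i))))"

definition gp_never_stuck :: "'a pair_pre_digraph \<Rightarrow> bool" where
  "gp_never_stuck T \<longleftrightarrow> (\<exists>s. gp_start T s) \<and>
     (\<forall>s. gp_reachable T s \<and> gp_guard s \<longrightarrow> (\<exists>s'. gp_step s s'))"


section \<open>Machine model for running times\<close>

text \<open>
  Structured programs for a unit-cost random access machine whose memory consists of named
  registers and named arrays of natural numbers. The parameter \<open>W\<close> of the semantics bounds all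
  values computed during an execution, so that with \<open>W\<close> linear in the size of the input the
  machine has words of logarithmic length. Programs that exceed \<open>W\<close> have no execution.
\<close>

record mem =
  reg :: "string \<Rightarrow> nat"
  arr :: "string \<Rightarrow> nat \<Rightarrow> nat"

datatype aexp =
    Const nat
  | Reg string
  | Arr string aexp
  | Add aexp aexp
  | Sub aexp aexp

primrec val :: "mem \<Rightarrow> aexp \<Rightarrow> nat" where
  "val m (Const k) = k"
| "val m (Reg x) = reg m x"
| "val m (Arr a e) = arr m a (val m e)"
| "val m (Add e f) = val m e + val m f"
| "val m (Sub e f) = val m e - val m f"

primrec fits :: "nat \<Rightarrow> mem \<Rightarrow> aexp \<Rightarrow> bool" where
  "fits W m (Const k) \<longleftrightarrow> k \<le> W"
| "fits W m (Reg x) \<longleftrightarrow> reg m x \<le> W"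
| "fits W m (Arr a e) \<longleftrightarrow> fits W m e \<and> arr m a (val m e) \<le> W"
| "fits W m (Add e f) \<longleftrightarrow> fits W m e \<and> fits W m f \<and> val m e + val m f \<le> W"
| "fits W m (Sub e f) \<longleftrightarrow> fits W m e \<and> fits W m f"

primrec cost :: "aexp \<Rightarrow> nat" where
  "cost (Const k) = 1"
| "cost (Reg x) = 1"
| "cost (Arr a e) = cost e + 1"
| "cost (Add e f) = cost e + cost f + 1"
| "cost (Sub e f) = cost e + cost f + 1"

datatype com =
    Skip
  | Assign string aexp
  | Store string aexp aexp
  | Seq com com
  | If aexp com com
  | While aexp com

text \<open>\<open>exec W c m t m'\<close>: started in \<open>m\<close>, the program \<open>c\<close> halts in \<open>m'\<close> after \<open>t\<close> operations.
  Tests succeed on nonzero values.\<close>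

inductive exec :: "nat \<Rightarrow> com \<Rightarrow> mem \<Rightarrow> nat \<Rightarrow> mem \<Rightarrow> bool" for W where
  Skip: "exec W Skip m 1 m"
| Assign: "fits W m e \<Longrightarrow>
    exec W (Assign x e) m (cost e + 1) (m\<lparr>reg := (reg m)(x := val m e)\<rparr>)"
| Store: "\<lbrakk> fits W m i; fits W m e \<rbrakk> \<Longrightarrow>
    exec W (Store a i e) m (cost i + cost e + 1)
      (m\<lparr>arr := (arr m)(a := (arr m a)(val m i := val m e))\<rparr>)"
| Seq: "\<lbrakk> exec W c\<^sub>1 m t\<^sub>1 m'; exec W c\<^sub>2 m' t\<^sub>2 m'' \<rbrakk> \<Longrightarrow> exec W (Seq c\<^sub>1 c\<^sub>2) m (t\<^sub>1 + t\<^sub>2) m''"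
| IfTrue: "\<lbrakk> fits W m e; val m e \<noteq> 0; exec W c\<^sub>1 m t m' \<rbrakk> \<Longrightarrow>
    exec W (If e c\<^sub>1 c\<^sub>2) m (cost e + 1 + t) m'"
| IfFalse: "\<lbrakk> fits W m e; val m e = 0; exec W c\<^sub>2 m t m' \<rbrakk> \<Longrightarrow>
    exec W (If e c\<^sub>1 c\<^sub>2) m (cost e + 1 + t) m'"
| WhileFalse: "\<lbrakk> fits W m e; val m e = 0 \<rbrakk> \<Longrightarrow> exec W (While e c) m (cost e + 1) m"
| WhileTrue: "\<lbrakk> fits W m e; val m e \<noteq> 0; exec W c m t\<^sub>1 m'; exec W (While e c) m' t\<^sub>2 m'' \<rbrakk> \<Longrightarrow>
    exec W (While e c) m (cost e + 1 + t\<^sub>1 + t\<^sub>2) m''"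


subsection \<open>Input and output\<close>

definition adjacency_lists :: "nat pair_pre_digraph \<Rightarrow> nat list list \<Rightarrow> bool" where
  "adjacency_lists G adj \<longleftrightarrow> pverts G = {..<length adj} \<and>
     (\<forall>v<length adj. distinct (adj ! v) \<and> set (adj ! v) = nbrs G v)"

text \<open>
  The neighbours of \<open>v\<close> are stored in the cells \<open>start v, \<dots>, start (v + 1) - 1\<close> of the array
  \<open>adj\<close>; register \<open>n\<close> holds the order of the graph; everything else is \<open>0\<close>.
\<close>

definition input_mem :: "nat list list \<Rightarrow> mem" where
  "input_mem adj =
     \<lparr> reg = (\<lambda>_. 0)(''n'' := length adj),
       arr = (\<lambda>_ _. 0)
         (''start'' := (\<lambda>v. if v \<le> length adj then length (concat (take v adj)) else 0),
          ''adj'' := (\<lambda>i. if i < length (concat adj) then concat adj ! i else 0)) \<rparr>"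

text \<open>The output is the sequence of the pairs \<open>{fst i, snd i}\<close> for \<open>i < k\<close>.\<close>

definition output_pairs :: "mem \<Rightarrow> nat set list" where
  "output_pairs m = map (\<lambda>i. {arr m ''fst'' i, arr m ''snd'' i}) [0..<reg m ''k'']"

end

theory Submission
  imports Defs
begin

text \<open>
  In a tree the maximal geodesics are exactly the paths between two leaves. Smoothing a vertex
  changes neither the leaves nor which families of leaf-to-leaf paths are disjoint. If no vertex
  has degree 2 and \<open>p\<close> is an end support vertex, then every leaf-to-leaf path that ends in a leaf
  neighbour of \<open>p\<close> passes through \<open>p\<close>, so a packing has at most one path through \<open>p\<close>, and
  deleting \<open>p\<close> with its leaf neighbours creates no new leaf. Hence the greedy choice
  \<open>u\<^sub>1, p, u\<^sub>2\<close> is optimal.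

  For the linear time bound, root the tree at a leaf \<open>r\<close> and process the other vertices in reverse
  breadth-first order. Each processed vertex hands at most one pending leaf to its parent: a vertex
  that has received none hands over none, one that has received exactly one has been smoothed and
  passes it on, and one that has received at least two is an end support vertex of the current
  smoothed tree, so that a pair is output and nothing is passed on. If a leaf finally reaches \<open>r\<close>,
  the remaining tree is a single edge. This is one particular run of the nondeterministic algorithm.
\<close>

section \<open>Paths and acyclicity\<close>

text \<open>Optimality is carried backwards. The predicate \<open>optimal_ends\<close> speaks only
  of end pairs, which smoothing leaves alone, so an optimal answer for the graph after a step yields
  one for the graph before it; no packing of the original tree has to be followed through the run.
  For the time bound it then suffices that the machine outputs some possible result of the
  nondeterministic algorithm.

  The machine never stores a smoothed tree. Once the tree is rooted, every graph of the chosen run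
  is determined by its vertex set, with ancestry supplying the edges, and this set lives only in the
  proof. In memory each vertex has two cells for pending leaves, just enough to tell none, one and
  several apart. A root of degree at most 1 never branches, so it can be left to a final step.

  That a forest has fewer edges than vertices is used twice: it makes the adjacency array linear in
  size, and it shows that the parent edges found by the search are all edges of the tree.\<close>

lemma pair_graph_iff:
  "pair_graph G \<longleftrightarrow> finite (pverts G) \<and> parcs G \<subseteq> pverts G \<times> pverts G \<and> sym (parcs G) \<and> irrefl (parcs G)"
proof
  assume "pair_graph G"
  then interpret pair_graph G .
  show "finite (pverts G) \<and> parcs G \<subseteq> pverts G \<times> pverts G \<and> sym (parcs G) \<and> irrefl (parcs G)"
    using pair_finite_verts pair_sym_arcs arc_fst_in_verts arc_snd_in_verts pair_no_loops
    by (force simp: symmetric_def irrefl_def)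
next
  assume *: "finite (pverts G) \<and> parcs G \<subseteq> pverts G \<times> pverts G \<and> sym (parcs G) \<and> irrefl (parcs G)"
  then have "finite (parcs G)" by (meson finite_SigmaI finite_subset)
  with * show "pair_graph G"
    by unfold_locales (auto simp: symmetric_def irrefl_def)
qed

text \<open>A reformulation of \<open>vpath\<close> without arc lists, so that splitting and
  reversing paths becomes simplification with \<open>successively\<close>.\<close>

definition path_in :: "'a pair_pre_digraph \<Rightarrow> 'a list \<Rightarrow> bool" where
  "path_in G p \<longleftrightarrow> p \<noteq> [] \<and> distinct p \<and> set p \<subseteq> pverts G \<and> successively (\<lambda>a b. (a, b) \<in> parcs G) p"

lemma vpath_iff_path_in: "vpath p (with_proj G) \<longleftrightarrow> path_in G p"
proof -
  have "set (vwalk_arcs p) \<subseteq> E \<longleftrightarrow> successively (\<lambda>a b. (a, b) \<in> E) p" for E :: "('a \<times> 'a) set"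
    by (induction p rule: vwalk_arcs.induct) auto
  then show ?thesis by (auto simp: vpath_def vwalk_def path_in_def)
qed

definition acyclic_graph :: "'a pair_pre_digraph \<Rightarrow> bool" where
  "acyclic_graph G \<longleftrightarrow> \<not> (\<exists>p. path_in G p \<and> 3 \<le> length p \<and> (last p, hd p) \<in> parcs G)"

text \<open>The algorithm may delete all vertices, hence no nonemptiness is required.\<close>

definition tree_or_empty :: "'a pair_pre_digraph \<Rightarrow> bool" where
  "tree_or_empty G \<longleftrightarrow> pair_graph G \<and> (\<forall>u\<in>pverts G. \<forall>v\<in>pverts G. (u, v) \<in> (parcs G)\<^sup>*) \<and> acyclic_graph G"

text \<open>\<open>connected\<close> is stated for the symmetric closure; as the arcs are already
  symmetric, the closure adds nothing and connectivity becomes plain reachability.\<close>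

lemma utree_tree_or_empty:
  assumes "utree G"
  shows "tree_or_empty G" "pverts G \<noteq> {}"
proof -
  from assms interpret pair_graph G by (simp add: utree_def)
  have "strongly_connected (with_proj (mk_symmetric (with_proj G)))"
    using assms by (auto simp: utree_def connected_def)
  moreover have "parcs (mk_symmetric (with_proj G)) = parcs G"
    using adj_mk_symmetric_eq pair_sym_arcs by simp
  ultimately have "pverts G \<noteq> {}" and "\<forall>u\<in>pverts G. \<forall>v\<in>pverts G. (u, v) \<in> (parcs G)\<^sup>*"
    using reachable_mk_symmetric_eq[OF pair_sym_arcs] reachable_conv
    by (auto simp: strongly_connected_def)
  then show "tree_or_empty G" "pverts G \<noteq> {}"
    using assms by (auto simp: tree_or_empty_def utree_def acyclic_graph_def vpath_iff_path_in)
qed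

lemma card_nbrs: "out_degree (with_proj G) v = card (nbrs G v)"
proof -
  have "out_arcs (with_proj G) v = Pair v ` nbrs G v"
    by (auto simp: out_arcs_def nbrs_def)
  then show ?thesis by (simp add: out_degree_def card_image inj_on_def)
qed

lemma leaf_iff: "leaf G v \<longleftrightarrow> v \<in> pverts G \<and> card (nbrs G v) = 1"
  by (simp add: leaf_def card_nbrs)

lemma leafE:
  assumes "leaf G v"
  obtains w where "nbrs G v = {w}"
  using assms by (auto simp: leaf_iff card_1_singleton_iff)

lemma path_in_Cons:
  "path_in G (a # p) \<longleftrightarrow>
     a \<in> pverts G \<and> a \<notin> set p \<and> (p = [] \<or> path_in G p \<and> (a, hd p) \<in> parcs G)"
  by (auto simp: path_in_def successively_Cons)

lemma path_in_append:
  assumes "p \<noteq> []" "q \<noteq> []"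
  shows "path_in G (p @ q) \<longleftrightarrow>
    path_in G p \<and> path_in G q \<and> set p \<inter> set q = {} \<and> (last p, hd q) \<in> parcs G"
  using assms by (auto simp: path_in_def successively_append_iff)

lemma path_in_rev:
  assumes "sym (parcs G)"
  shows "path_in G (rev p) \<longleftrightarrow> path_in G p"
proof -
  have "(y, x) \<in> parcs G \<longleftrightarrow> (x, y) \<in> parcs G" for x y
    using assms by (auto simp: sym_def)
  then show ?thesis by (simp add: path_in_def)
qed

lemma rtrancl_path:
  assumes "(u, v) \<in> (parcs G)\<^sup>*" "parcs G \<subseteq> pverts G \<times> pverts G" "u \<in> pverts G"
  shows "\<exists>p. path_in G p \<and> hd p = u \<and> last p = v"
  using assms(1,3)
proof (induction rule: converse_rtrancl_induct)
  case base
  then show ?case by (intro exI[of _ "[v]"]) (simp add: path_in_def)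
next
  case (step u w)
  then obtain p where p: "path_in G p" "hd p = w" "last p = v" using assms(2) by blast
  show ?case
  proof (cases "u \<in> set p")
    case True
    then obtain xs ys where "p = xs @ u # ys" by (auto simp: in_set_conv_decomp)
    with p show ?thesis
      by (cases "xs = []") (auto simp: path_in_append intro!: exI[of _ "u # ys"])
  next
    case False
    moreover have "p \<noteq> []" using p by (auto simp: path_in_def)
    ultimately show ?thesis using p step
      by (intro exI[of _ "u # p"]) (auto simp: path_in_Cons)
  qed
qed

lemma path_rtrancl:
  assumes "path_in G p" "x \<in> set p" 
  shows "(hd p, x) \<in> (parcs G)\<^sup>*"
  using assms
proof (induction p)
  case (Cons a p)
  then show ?case 
    by (cases "p = []") (auto simp: path_in_Cons intro: converse_rtrancl_into_rtrancl)
qed simp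

text \<open>Otherwise the segment from \<open>a\<close> to \<open>w\<close> has at least three
  vertices and the arc back to \<open>a\<close> closes a cycle.\<close>

lemma acyclic_chord:
  assumes "acyclic_graph G" "path_in G (a # p)" "(w, a) \<in> parcs G" "w \<in> set p"
  shows "w = hd p"
proof (rule ccontr)
  assume "w \<noteq> hd p"
  obtain xs ys where p: "p = xs @ w # ys" using assms(4) by (auto simp: in_set_conv_decomp)
  have "xs \<noteq> []" using p \<open>w \<noteq> hd p\<close> by auto
  moreover have "path_in G (a # xs @ [w])"
  proof (cases "ys = []")
    case True then show ?thesis using assms(2) p by simp
  next
    case False then show ?thesis using assms(2) p path_in_append[of "a # xs @ [w]" ys] by auto
  qed
  ultimately show False using assms(1,3) unfolding acyclic_graph_def
    by (force dest!: spec[of _ "a # xs @ [w]"] simp: Suc_le_eq)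
qed

lemma path_first_common:
  assumes "set p \<inter> S \<noteq> {}"
  obtains xs x ys where "p = xs @ x # ys" "x \<in> S" "set xs \<inter> S = {}"
proof -
  have "\<exists>x\<in>set p. x \<in> S" using assms by blast
  from split_list_first_prop[OF this] obtain xs x ys
    where "p = xs @ x # ys" "x \<in> S" "\<forall>y\<in>set xs. y \<notin> S" by blast
  then show ?thesis using that by blast
qed

lemma path_in_prefix: "path_in G (p @ q) \<Longrightarrow> p \<noteq> [] \<Longrightarrow> path_in G p"
  by (cases "q = []") (auto simp: path_in_append)

text \<open>By induction the common first vertex can be stripped as long as the second vertices
  agree. Where they differ, running along \<open>p\<close> to the first vertex \<open>x\<close> that
  also lies on \<open>q'\<close>, and back along \<open>q'\<close>, gives a cycle through
  \<open>a\<close>.\<close>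

lemma path_unique:
  assumes "acyclic_graph G" "sym (parcs G)" "path_in G p" "path_in G q" "hd p = hd q" "last p = last q"
  shows "p = q"
  using assms(3-)
proof (induction p arbitrary: q)
  case Nil then show ?case by (simp add: path_in_def)
next
  case (Cons a p)
  obtain q' where q: "q = a # q'" using Cons.prems by (cases q) (auto simp: path_in_def)
  have prems: "path_in G (a # p)" "path_in G (a # q')" "last (a # p) = last (a # q')"
    using Cons.prems q by simp_all
  show ?case
  proof (cases "p = [] \<or> q' = []")
    case True
    then show ?thesis using prems q by (auto simp: path_in_Cons split: if_splits)
  next
    case False
    then have pp: "path_in G p" "(a, hd p) \<in> parcs G" "path_in G q'" "(a, hd q') \<in> parcs G"
      "a \<notin> set p" "a \<notin> set q'" "last p = last q'" "a \<in> pverts G"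
      using prems by (auto simp: path_in_Cons)
    have "hd p = hd q'"
    proof (rule ccontr)
      assume ne: "hd p \<noteq> hd q'"
      have "set p \<inter> set q' \<noteq> {}" using False pp(7) by (metis disjoint_iff last_in_set)
      then obtain p1 x p2 where p: "p = p1 @ x # p2" "x \<in> set q'" "set p1 \<inter> set q' = {}"
        by (rule path_first_common)
      then obtain q1 q2 where q': "q' = q1 @ x # q2" by (auto simp: in_set_conv_decomp)
      let ?c = "a # (p1 @ [x]) @ rev q1"
      have P1: "path_in G (p1 @ [x])" using pp(1) p path_in_prefix[of G "p1 @ [x]" p2] by simp
      have Q1: "q1 \<noteq> [] \<Longrightarrow> path_in G q1 \<and> (last q1, x) \<in> parcs G"
        using pp(3) q' path_in_append[of q1 "x # q2" G] by auto
      have dis: "set (p1 @ [x]) \<inter> set q1 = {}" using p(3) q' pp(3) by (auto simp: path_in_def)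
      have "path_in G ((p1 @ [x]) @ rev q1)"
      proof (cases "q1 = []")
        case True then show ?thesis using P1 by simp
      next
        case False
        then show ?thesis using P1 Q1 dis path_in_append[of "p1 @ [x]" "rev q1" G] assms(2)
          by (simp add: path_in_rev hd_rev) (meson symD)
      qed
      then have "path_in G ?c" using pp p q' by (auto simp: path_in_Cons hd_append)
      moreover have "last ?c = hd q'" using q' by (cases q1) auto
      \<comment> \<open>If both \<open>p1\<close> and \<open>q1\<close> were empty, \<open>x\<close>
        would be the second vertex of both paths; so the cycle has at least three vertices.\<close>
      moreover have "p1 \<noteq> [] \<or> q1 \<noteq> []" using ne p q' by auto
      then have "3 \<le> length ?c" by (cases p1; cases q1) auto
      ultimately show False using assms(1,2) pp(4) unfolding acyclic_graph_def
        by (metis list.sel(1) symD)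
    qed
    then show ?thesis using Cons.IH[of q'] pp q by simp
  qed
qed

lemma longest_path:
  assumes "finite (pverts G)" "path_in G p0"
  obtains p where "path_in G p" "\<And>q. path_in G q \<Longrightarrow> length q \<le> length p" "length p0 \<le> length p"
proof -
  have "length p \<le> card (pverts G)" if "path_in G p" for p
    using that assms(1) by (metis card_mono distinct_card path_in_def)
  then have "\<forall>y. path_in G y \<longrightarrow> length y < Suc (card (pverts G))" by (auto simp: less_Suc_eq_le)
  from ex_has_greatest_nat[of "path_in G", OF assms(2) this]
  obtain p where "path_in G p" "\<forall>q. path_in G q \<longrightarrow> length q \<le> length p" by blast
  with that assms(2) show thesis by blast
qed

text \<open>A neighbour of the first vertex off the path would lengthen it; one on the path can only
  be the second vertex, by \<open>acyclic_chord\<close>. So an end of a longest path has at most one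
  neighbour.\<close>

lemma longest_path_end:
  assumes "pair_graph G" "acyclic_graph G" "path_in G (a # p)"
    and "\<And>q. path_in G q \<Longrightarrow> length q \<le> length (a # p)" and "(a, w) \<in> parcs G"
  shows "p \<noteq> [] \<and> w = hd p"
proof -
  have w: "w \<in> pverts G" "w \<noteq> a" "(w, a) \<in> parcs G"
    using assms(1,5) by (auto simp: pair_graph_iff irrefl_def dest: symD)
  have "w \<in> set p"
  proof (rule ccontr)
    assume "w \<notin> set p"
    then have "path_in G (w # a # p)" using w assms(3) by (auto simp: path_in_Cons[of _ w])
    from assms(4)[OF this] show False by simp
  qed
  with acyclic_chord[OF assms(2,3) w(3)] show ?thesis by auto
qed

text \<open>
  A finite graph is a forest iff its vertices can be ordered so that each has at most one smaller
  neighbour. In this form acyclicity is a local condition, which is easily seen to survive smoothing: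
  the same order still works.
\<close>

definition degenerate_order :: "'a pair_pre_digraph \<Rightarrow> ('a \<Rightarrow> nat) \<Rightarrow> bool" where
  "degenerate_order G d \<longleftrightarrow> inj_on d (pverts G) \<and>
     (\<forall>v w w'. (v, w) \<in> parcs G \<and> (v, w') \<in> parcs G \<and> d w < d v \<and> d w' < d v \<longrightarrow> w = w')"

lemma acyclic_remove: 
  assumes "acyclic_graph G"
  shows "acyclic_graph (remove_verts G A)"
proof -
  have "path_in G p" if "path_in (remove_verts G A) p" for p
    using that by (auto simp: path_in_def remove_verts_def elim: successively_mono)
  then show ?thesis using assms unfolding acyclic_graph_def by (auto simp: remove_verts_def)
qed

lemma pair_graph_remove: "pair_graph G \<Longrightarrow> pair_graph (remove_verts G A)"
  by (auto simp: pair_graph_iff remove_verts_def sym_def irrefl_def)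

text \<open>An end of a longest path has at most one neighbour: delete it, order the rest by
  induction, and give it a number above all others.\<close>

lemma acyclic_imp_order:
  assumes "pair_graph G" "acyclic_graph G"
  shows "\<exists>d. degenerate_order G d"
  using assms
proof (induction "card (pverts G)" arbitrary: G)
  case 0
  then have "pverts G = {}" by (simp add: pair_graph_iff)
  then show ?case using 0 by (auto simp: degenerate_order_def pair_graph_iff)
next
  case (Suc n)
  then have fin: "finite (pverts G)" by (simp add: pair_graph_iff)
  obtain v0 where "v0 \<in> pverts G" using Suc.hyps(2) by fastforce
  then have "path_in G [v0]" by (simp add: path_in_def)
  from longest_path[OF fin this] obtain p where
    p: "path_in G p" "\<And>q. path_in G q \<Longrightarrow> length q \<le> length p" by blast
  then obtain a p' where ap: "p = a # p'" by (cases p) (auto simp: path_in_def)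
  then have a: "a \<in> pverts G" using p by (simp add: path_in_Cons)
  let ?G = "remove_verts G {a}"
  have "card (pverts ?G) = n" using Suc.hyps(2) a fin by (simp add: remove_verts_def)
  then obtain d where d: "degenerate_order ?G d"
    using Suc.hyps(1)[of ?G] Suc.prems by (auto intro: acyclic_remove pair_graph_remove)
  define m where "m = Suc (Max (d ` pverts G))"
  have m: "d v < m" if "v \<in> pverts G" for v using that fin by (simp add: m_def less_Suc_eq_le)
  have un: "w = hd p'" if "(a, w) \<in> parcs G" for w
    using longest_path_end[OF Suc.prems(1,2), of a p' w] p that ap by blast
  let ?d = "d(a := m)"
  have in_G: "v \<in> pverts G \<and> w \<in> pverts G" if "(v, w) \<in> parcs G" for v w
    using that Suc.prems(1) by (auto simp: pair_graph_iff)
  have "inj_on ?d (pverts G)"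
  proof (rule inj_onI)
    fix v w assume vw: "v \<in> pverts G" "w \<in> pverts G" "?d v = ?d w"
    show "v = w"
    proof (cases "v = a \<or> w = a")
      case True then show ?thesis using vw m[of v] m[of w] by (auto split: if_splits)
    next
      case False
      moreover have "inj_on d (pverts G - {a})"
        using d by (simp add: degenerate_order_def remove_verts_def)
      ultimately show ?thesis using vw by (simp add: inj_on_eq_iff)
    qed
  qed
  moreover have "w = w'" if vw: "(v, w) \<in> parcs G" "(v, w') \<in> parcs G" "?d w < ?d v" "?d w' < ?d v" for v w w'
  proof (cases "v = a")
    case True then show ?thesis using un[of w] un[of w'] vw(1,2) by simp
  next
    case False
    then have "w \<noteq> a" "w' \<noteq> a" using vw m[of v] in_G by auto
    with vw False have "(v, w) \<in> parcs ?G" "(v, w') \<in> parcs ?G" "d w < d v" "d w' < d v"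
      by (simp_all add: remove_verts_def)
    then show ?thesis using d unfolding degenerate_order_def by blast
  qed
  ultimately have "degenerate_order G ?d" unfolding degenerate_order_def by blast
  then show ?case by blast
qed

text \<open>The vertex of largest number on a cycle would have two smaller neighbours, its cyclic
  successor \<open>p ! j\<close> and predecessor \<open>p ! k\<close>, which differ because the
  cycle has at least three vertices.\<close>

lemma order_imp_acyclic:
  assumes "pair_graph G" "degenerate_order G d"
  shows "acyclic_graph G"
  unfolding acyclic_graph_def
proof (intro notI, elim exE conjE)
  fix p assume p: "path_in G p" "3 \<le> length p" "(last p, hd p) \<in> parcs G"
  let ?n = "length p"
  have e: "(p ! i, p ! (Suc i mod ?n)) \<in> parcs G" if "i < ?n" for i
  proof (cases "Suc i < ?n")
    case True
    then have "(\<lambda>a b. (a,b) \<in> parcs G) (p ! i) (p ! Suc i)"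
      using p(1) unfolding path_in_def by (metis successively_conv_nth)
    then show ?thesis using True by simp
  next
    case False
    then have "Suc i = ?n" using that by simp
    moreover have "p \<noteq> []" using p(2) by (cases p) simp_all
    ultimately show ?thesis using p(3) by (simp add: last_conv_nth hd_conv_nth flip: \<open>Suc i = ?n\<close>)
  qed
  have inj: "p ! i = p ! j \<longleftrightarrow> i = j" if "i < ?n" "j < ?n" for i j
    using that p(1) by (simp add: path_in_def nth_eq_iff_index_eq)
  have "0 \<in> {..<?n}" using p(2) by (cases p) simp_all
  then have "finite ((\<lambda>i. d (p ! i)) ` {..<?n})" "(\<lambda>i. d (p ! i)) ` {..<?n} \<noteq> {}" by blast+
  from Max_in[OF this] obtain i where i: "i < ?n" "d (p ! i) = Max ((\<lambda>i. d (p ! i)) ` {..<?n})" by auto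
  have le: "d (p ! j) \<le> d (p ! i)" if "j < ?n" for j using that i by simp
  have lt: "d (p ! j) < d (p ! i)" if "j < ?n" "j \<noteq> i" for j
  proof -
    have "p ! j \<in> pverts G" "p ! i \<in> pverts G" using p(1) i that by (auto simp: path_in_def)
    then have "d (p ! j) \<noteq> d (p ! i)" using assms(2) inj[OF that(1) i(1)] that(2)
      unfolding degenerate_order_def inj_on_def by blast
    then show ?thesis using le[OF that(1)] by simp
  qed
  define j where "j = Suc i mod ?n"
  define k where "k = (if i = 0 then ?n - 1 else i - 1)"
  have j: "j < ?n" "j \<noteq> i" "(p ! i, p ! j) \<in> parcs G"
    using e[OF i(1)] i p(2) by (auto simp: j_def mod_Suc)
  have k: "k < ?n" "k \<noteq> i" "Suc k mod ?n = i" "k \<noteq> j" using i p(2) by (auto simp: k_def j_def mod_Suc)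
  then have "(p ! i, p ! k) \<in> parcs G" using e[OF k(1)] assms(1) by (auto simp: pair_graph_iff dest: symD)
  with j k lt have "p ! j = p ! k" using assms(2) unfolding degenerate_order_def by blast
  then show False using inj j k by blast
qed

section \<open>Packings of leaf-to-leaf paths\<close>

definition leaf_path :: "'a pair_pre_digraph \<Rightarrow> 'a list \<Rightarrow> bool" where
  "leaf_path G p \<longleftrightarrow> path_in G p \<and> hd p \<noteq> last p \<and> leaf G (hd p) \<and> leaf G (last p)"

text \<open>An inner vertex of a path has two distinct neighbours, its predecessor and its successor
  on the path.\<close>

lemma leaf_on_path:
  assumes "sym (parcs G)" "path_in G p" "v \<in> set p" "leaf G v"
  shows "v = hd p \<or> v = last p"
proof (rule ccontr)
  assume "\<not> ?thesis"
  then have ne: "v \<noteq> hd p" "v \<noteq> last p" by auto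
  obtain xs ys where p: "p = xs @ v # ys" using assms(3) by (auto simp: in_set_conv_decomp)
  have "xs \<noteq> []" "ys \<noteq> []" using ne p by auto
  then have "(last xs, v) \<in> parcs G" "(v, hd ys) \<in> parcs G" "set xs \<inter> set ys = {}"
    using assms(2) p by (auto simp: path_in_append path_in_Cons)
  moreover have "last xs \<noteq> hd ys"
    using calculation(3) \<open>xs \<noteq> []\<close> \<open>ys \<noteq> []\<close> by (metis disjoint_iff hd_in_set last_in_set)
  ultimately have "last xs \<noteq> hd ys" "last xs \<in> nbrs G v" "hd ys \<in> nbrs G v" using assms(1) by (auto simp: nbrs_def dest: symD)
  then show False using assms(4) by (metis leafE singletonD)
qed

lemma path_in_length: "path_in G p \<Longrightarrow> hd p \<noteq> last p \<Longrightarrow> 2 \<le> length p"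
  by (cases p; cases "tl p") (auto simp: path_in_def)

text \<open>Minimal length is automatic: by \<open>path_unique\<close> there is no competing path
  with the same ends.\<close>

lemma geodesic_iff:
  assumes "acyclic_graph G" "sym (parcs G)"
  shows "geodesic G p \<longleftrightarrow> path_in G p \<and> hd p \<noteq> last p"
  using path_unique[OF assms] by (auto simp: geodesic_def vpath_iff_path_in)

text \<open>The first vertex has a neighbour other than the second vertex, and by
  \<open>acyclic_chord\<close> it is not on the path.\<close>

lemma path_extend:
  assumes "pair_graph G" "acyclic_graph G" "path_in G p" "hd p \<noteq> last p" "\<not> leaf G (hd p)"
  shows "\<exists>w. path_in G (w # p)"
proof -
  have G: "sym (parcs G)" "parcs G \<subseteq> pverts G \<times> pverts G" "irrefl (parcs G)" "finite (pverts G)"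
    using assms(1) by (auto simp: pair_graph_iff)
  obtain a p' where p: "p = a # p'" "p' \<noteq> []"
    using assms(3,4) by (cases p; cases "tl p") (auto simp: path_in_def)
  have e: "hd p' \<in> nbrs G a" "a \<in> pverts G" using assms(3) p by (auto simp: path_in_Cons nbrs_def)
  have "nbrs G a \<noteq> {hd p'}" using e assms(5) p by (auto simp: leaf_iff)
  then obtain w where w: "(a, w) \<in> parcs G" "w \<noteq> hd p'" using e by (auto simp: nbrs_def)
  then have w': "(w, a) \<in> parcs G" "w \<in> pverts G" "w \<noteq> a" using G by (auto dest: symD simp: irrefl_def)
  have "w \<notin> set p'" using acyclic_chord[OF assms(2) _ w'(1)] assms(3) p w(2) by blast
  then show ?thesis using w' assms(3) p by (intro exI[of _ w]) (simp add: path_in_Cons[of G w])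
qed

text \<open>At an end that is not a leaf, \<open>path_extend\<close> lengthens the path, at the far
  end after reversal. Conversely, \<open>leaf_on_path\<close> keeps leaves at the ends of every
  path, so a path between two leaves is not a proper part of another one.\<close>

lemma maximal_geodesic_iff:
  assumes "pair_graph G" "acyclic_graph G"
  shows "maximal_geodesic G p \<longleftrightarrow> leaf_path G p"
proof -
  have G: "sym (parcs G)" using assms(1) by (auto simp: pair_graph_iff)
  note geo = geodesic_iff[OF assms(2) G]
  show ?thesis
  proof
    assume max: "maximal_geodesic G p"
    then have p: "path_in G p" "hd p \<noteq> last p" by (auto simp: maximal_geodesic_def geo)
    \<comment> \<open>A longer path counts as a geodesic only if its ends differ, which the length
      of \<open>p\<close> ensures.\<close>
    have no_ext: False if "path_in G q" "strict_sublist p q" for q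
    proof -
      have "hd q \<noteq> last q"
      proof
        assume "hd q = last q"
        then have "length q = 1" using that(1) by (cases q; cases "tl q") (auto simp: path_in_def split: if_splits dest: last_in_set)
        then have "length p \<le> 1"
          using sublist_length_le[of p q] that(2) by (simp add: strict_sublist_def)
        then show False using path_in_length[OF p] by simp
      qed
      then have "geodesic G q" using that(1) by (simp add: geo)
      then show False using max that(2) by (auto simp: maximal_geodesic_def)
    qed
    have "leaf G (hd p)"
    proof (rule ccontr)
      assume "\<not> leaf G (hd p)"
      from path_extend[OF assms p this] obtain w where "path_in G ([w] @ p)" by auto
      moreover have "sublist p ([w] @ p)" by (auto simp: sublist_def intro: exI[of _ "[w]"])
      ultimately show False using no_ext[of "[w] @ p"] by (auto simp: strict_sublist_def)
    qed
    moreover have "leaf G (last p)"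
    proof (rule ccontr)
      assume "\<not> leaf G (last p)"
      moreover have "path_in G (rev p)" "hd (rev p) \<noteq> last (rev p)" "hd (rev p) = last p"
        using p path_in_rev[OF G, of p] by (auto simp: hd_rev last_rev)
      ultimately obtain w where "path_in G (w # rev p)" using path_extend[OF assms] by metis
      then have "path_in G (p @ [w])" using path_in_rev[OF G, of "p @ [w]"] by simp
      then show False using no_ext[of "p @ [w]"] by (auto simp: strict_sublist_def)
    qed
    ultimately show "leaf_path G p" using p by (simp add: leaf_path_def)
  next
    assume lp: "leaf_path G p"
    have False if q: "geodesic G q" "strict_sublist p q" for q
    proof -
      obtain ps ss where q': "q = ps @ p @ ss" using q(2) by (auto simp: strict_sublist_def sublist_def)
      have pq: "path_in G q" "path_in G p" "p \<noteq> []" using q lp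
        by (auto simp: geo leaf_path_def path_in_def)
      have "set p \<inter> set ps = {}" "set p \<inter> set ss = {}" using pq(1) q' by (auto simp: path_in_def)
      then have notin: "hd p \<notin> set ps" "last p \<notin> set ps" "hd p \<notin> set ss" "last p \<notin> set ss"
        using hd_in_set[OF pq(3)] last_in_set[OF pq(3)] by blast+
      have "ps \<noteq> [] \<or> ss \<noteq> []" using q(2) q' by (auto simp: strict_sublist_def)
      then show False
      proof
        assume "ps \<noteq> []"
        have "hd p = hd q \<or> hd p = last q"
          using leaf_on_path[OF G pq(1), of "hd p"] lp pq(3) q' by (auto simp: leaf_path_def)
        moreover have "hd p \<noteq> hd q" using notin q' \<open>ps \<noteq> []\<close> by auto
        moreover have "hd p \<noteq> last q"
          using notin q' lp pq(3) by (cases "ss = []") (auto simp: leaf_path_def)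
        ultimately show False by blast
      next
        assume "ss \<noteq> []"
        have "last p = hd q \<or> last p = last q"
          using leaf_on_path[OF G pq(1), of "last p"] lp pq(3) q' by (auto simp: leaf_path_def)
        moreover have "last p \<noteq> last q" using notin q' \<open>ss \<noteq> []\<close> by auto
        moreover have "last p \<noteq> hd q"
          using notin q' lp pq(3) by (cases "ps = []") (auto simp: leaf_path_def)
        ultimately show False by blast
      qed
    qed
    then show "maximal_geodesic G p" using lp by (auto simp: maximal_geodesic_def geo leaf_path_def)
  qed
qed

definition leaf_packing :: "'a pair_pre_digraph \<Rightarrow> 'a list set \<Rightarrow> bool" where
  "leaf_packing G S \<longleftrightarrow> (\<forall>p\<in>S. leaf_path G p) \<and> pairwise (\<lambda>p q. disjnt (set p) (set q)) S"

text \<open>Disjoint paths have different end pairs, so together with \<open>distinct\<close> the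
  list has exactly as many entries as the packing has paths.\<close>

definition optimal_ends :: "'a pair_pre_digraph \<Rightarrow> 'a set list \<Rightarrow> bool" where
  "optimal_ends G \<Psi> \<longleftrightarrow> (\<exists>S. leaf_packing G S \<and> (\<forall>S'. leaf_packing G S' \<longrightarrow> card S' \<le> card S) \<and>
     distinct \<Psi> \<and> set \<Psi> = (\<lambda>p. {hd p, last p}) ` S)"

lemma finite_leaf_packing:
  assumes "finite (pverts G)" "leaf_packing G S"
  shows "finite S"
  by (rule finite_subset[OF _ finite_subset_distinct[OF assms(1)]])
     (use assms(2) in \<open>auto simp: leaf_packing_def leaf_path_def path_in_def\<close>)

lemma optimal_ends_geodesic_packing:
  assumes "pair_graph G" "acyclic_graph G" "optimal_ends G \<Psi>"
  shows "\<exists>S. geodesic_packing G S \<and> card S = gpack G \<and> distinct \<Psi> \<and> set \<Psi> = (\<lambda>p. {hd p, last p}) ` S"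
proof -
  have gp: "geodesic_packing G S \<longleftrightarrow> leaf_packing G S" for S
    by (simp add: geodesic_packing_def leaf_packing_def maximal_geodesic_iff[OF assms(1,2)])
  obtain S where S: "leaf_packing G S" "\<forall>S'. leaf_packing G S' \<longrightarrow> card S' \<le> card S"
    "distinct \<Psi>" "set \<Psi> = (\<lambda>p. {hd p, last p}) ` S" using assms(3) by (auto simp: optimal_ends_def)
  \<comment> \<open>\<open>Max\<close> in \<open>gpack\<close> is meaningful only for a finite set;
    the optimal \<open>S\<close> bounds the cardinalities.\<close>
  have "finite {card S | S. leaf_packing G S}"
    by (rule finite_subset[of _ "{..card S}"]) (use S in auto)
  then have "gpack G = card S" unfolding gpack_def gp using S by (intro Max_eqI) auto
  then show ?thesis using S gp by metis
qed

text \<open>Injectivity of \<open>f\<close> on \<open>S\<close> comes for free: paths are nonempty,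
  so equal images intersect, hence the originals intersect and coincide as members of a
  packing.\<close>

lemma leaf_packing_image:
  assumes "leaf_packing G S"
    and f: "\<And>p. leaf_path G p \<Longrightarrow> leaf_path H (f p)"
      "\<And>p q. leaf_path G p \<Longrightarrow> leaf_path G q \<Longrightarrow> set (f p) \<inter> set (f q) \<noteq> {} \<Longrightarrow> set p \<inter> set q \<noteq> {}"
  shows "leaf_packing H (f ` S)" "card (f ` S) = card S"
proof -
  have S: "leaf_path G p" if "p \<in> S" for p using that assms(1) by (simp add: leaf_packing_def)
  have *: "p = q" if "p \<in> S" "q \<in> S" "set (f p) \<inter> set (f q) \<noteq> {}" for p q
    using that f(2)[OF S S, OF that] assms(1) by (auto simp: leaf_packing_def pairwise_def disjnt_def)
  have "set (f p) \<noteq> {}" if "p \<in> S" for p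
    using f(1)[OF S[OF that]] by (auto simp: leaf_path_def path_in_def)
  then have "inj_on f S" using * by (metis inf.idem inj_onI)
  then show "card (f ` S) = card S" by (rule card_image)
  show "leaf_packing H (f ` S)"
    using S f(1) * by (force simp: leaf_packing_def pairwise_def disjnt_def)
qed

section \<open>Smoothing\<close>

definition smooth :: "'a pair_pre_digraph \<Rightarrow> 'a \<Rightarrow> 'a \<Rightarrow> 'a \<Rightarrow> 'a pair_pre_digraph" where
  "smooth G u x y = \<lparr> pverts = pverts (remove_verts G {u}),
     parcs = parcs (remove_verts G {u}) \<union> {(x, y), (y, x)} \<rparr>"

lemma smooth_step_iff:
  "smooth_step G G' \<longleftrightarrow> (\<exists>u x y. u \<in> pverts G \<and> x \<noteq> y \<and> nbrs G u = {x, y} \<and> G' = smooth G u x y)"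
  by (simp add: smooth_step_def smooth_def)

locale smoothing =
  fixes G :: "'a pair_pre_digraph" and u x y
  assumes G: "pair_graph G" and acyclic: "acyclic_graph G"
    and u: "u \<in> pverts G" and xy: "x \<noteq> y" and nbrs_u: "nbrs G u = {x, y}"
begin

lemma graph: "sym (parcs G)" "parcs G \<subseteq> pverts G \<times> pverts G" "irrefl (parcs G)" "finite (pverts G)"
  using G by (auto simp: pair_graph_iff)

abbreviation "G' \<equiv> smooth G u x y"

lemma arcs_u: "(u, v) \<in> parcs G \<longleftrightarrow> v = x \<or> v = y" "(v, u) \<in> parcs G \<longleftrightarrow> v = x \<or> v = y"
  using nbrs_u graph(1) by (auto simp: nbrs_def dest: symD)

lemma xy_verts: "x \<in> pverts G" "y \<in> pverts G" "x \<noteq> u" "y \<noteq> u"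
  using arcs_u[of x] arcs_u[of y] graph by (auto simp: irrefl_def)

text \<open>Otherwise \<open>x\<close>, \<open>u\<close>, \<open>y\<close> would form a triangle.
  Hence the new edge never duplicates an old one, and smoothing preserves the degrees of
  \<open>x\<close> and \<open>y\<close>.\<close>

lemma not_adjacent: "(x, y) \<notin> parcs G" "(y, x) \<notin> parcs G"
proof -
  have "path_in G [x, u, y]" using xy_verts xy u arcs_u by (auto simp: path_in_def)
  then show "(y, x) \<notin> parcs G" using acyclic by (force simp: acyclic_graph_def)
  then show "(x, y) \<notin> parcs G" using graph(1) by (auto dest: symD)
qed

lemma verts': "pverts G' = pverts G - {u}"
  by (simp add: smooth_def remove_verts_def)

lemma arcs': "(v, w) \<in> parcs G' \<longleftrightarrow>
    v \<noteq> u \<and> w \<noteq> u \<and> ((v, w) \<in> parcs G \<or> v = x \<and> w = y \<or> v = y \<and> w = x)"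
  using xy_verts by (auto simp: smooth_def remove_verts_def)

lemma pair_graph': "pair_graph G'"
proof -
  have "sym (parcs G')" by (rule symI) (use graph(1) in \<open>auto simp: arcs' dest: symD\<close>)
  moreover have "irrefl (parcs G')" using graph(3) xy by (auto simp: irrefl_def arcs')
  ultimately show ?thesis using graph xy_verts by (auto simp: pair_graph_iff arcs' verts')
qed

lemma acyclic': "acyclic_graph G'"
proof -
  obtain d where d: "degenerate_order G d" using acyclic_imp_order[OF G acyclic] by blast
  have un: "w = w'" if "(v, w) \<in> parcs G" "(v, w') \<in> parcs G" "d w < d v" "d w' < d v" for v w w'
    using d that unfolding degenerate_order_def by blast
  have inj: "d v = d w \<longleftrightarrow> v = w" if "v \<in> pverts G" "w \<in> pverts G" for v w
    using d that unfolding degenerate_order_def by (blast dest: inj_onD)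
  \<comment> \<open>Only the larger end \<open>b\<close> of the new edge gains a smaller neighbour,
    namely \<open>a\<close>. A second one, \<open>w'\<close>, would be an old neighbour of
    \<open>b\<close>; since \<open>b\<close> has at most one smaller neighbour in \<open>G\<close>,
    \<open>u\<close> must be larger than \<open>b\<close>, and then \<open>u\<close> has the two
    smaller neighbours \<open>a\<close> and \<open>b\<close>.\<close>
  have one: "w' = a" if ab: "{a, b} = {x, y}" "d a < d b" "(b, w') \<in> parcs G'" "d w' < d b" for a b w'
  proof (rule ccontr)
    assume ne: "w' \<noteq> a"
    have ab': "(u, a) \<in> parcs G" "(u, b) \<in> parcs G" "(b, u) \<in> parcs G" "b \<in> pverts G" "a \<noteq> b" "b \<noteq> u"
      using ab(1) xy arcs_u xy_verts by (auto simp: doubleton_eq_iff)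
    have w': "(b, w') \<in> parcs G" "w' \<noteq> u" using ab(1,3) ne by (auto simp: arcs' doubleton_eq_iff)
    then have "\<not> d u < d b" using un[OF w'(1) ab'(3) ab(4)] by blast
    then have "d b < d u" using inj[of u b] u ab' by auto
    then have "a = b" using un[OF ab'(1,2)] ab(2) by simp
    then show False using ab' by simp
  qed
  have "w = w'" if v: "(v, w) \<in> parcs G'" "(v, w') \<in> parcs G'" "d w < d v" "d w' < d v" for v w w'
  proof (cases "(v, w) \<in> parcs G \<and> (v, w') \<in> parcs G")
    case True then show ?thesis using un v(3,4) by blast
  next
    case False
    then have "{w, v} = {x, y} \<or> {w', v} = {x, y}" using v(1,2) by (auto simp: arcs')
    then show ?thesis using one v by metis
  qed
  then have "degenerate_order G' d"
    using d unfolding degenerate_order_def verts' by (blast intro: inj_on_subset)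
  then show ?thesis using order_imp_acyclic pair_graph' by blast
qed

text \<open>Where the path runs through \<open>u\<close>, the vertices before and after it are
  \<open>x\<close> and \<open>y\<close> in some order, and the new edge bridges the gap.\<close>

lemma path_smooth:
  assumes "path_in G p" "hd p \<noteq> u" "last p \<noteq> u"
  shows "path_in G' (filter (\<lambda>v. v \<noteq> u) p)"
    "hd (filter (\<lambda>v. v \<noteq> u) p) = hd p" "last (filter (\<lambda>v. v \<noteq> u) p) = last p"
proof -
  have avoid: "path_in G' q" if "path_in G q" "u \<notin> set q" for q
  proof -
    have "successively (\<lambda>a b. (a, b) \<in> parcs G') q"
      by (rule successively_mono[of "\<lambda>a b. (a, b) \<in> parcs G"])
        (use that in \<open>auto simp: path_in_def arcs'\<close>)
    then show ?thesis using that by (auto simp: path_in_def verts')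
  qed
  have "path_in G' (filter (\<lambda>v. v \<noteq> u) p) \<and>
    hd (filter (\<lambda>v. v \<noteq> u) p) = hd p \<and> last (filter (\<lambda>v. v \<noteq> u) p) = last p"
  proof (cases "u \<in> set p")
    case False
    then have "filter (\<lambda>v. v \<noteq> u) p = p" by (auto simp: filter_id_conv)
    then show ?thesis using avoid[OF assms(1) False] by simp
  next
    case True
    then obtain xs ys where p: "p = xs @ u # ys" by (auto simp: in_set_conv_decomp)
    have ne: "xs \<noteq> []" "ys \<noteq> []" using p assms by auto
    have u': "u \<notin> set xs" "u \<notin> set ys" using assms(1) p by (auto simp: path_in_def)
    then have "filter (\<lambda>v. v \<noteq> u) xs = xs" "filter (\<lambda>v. v \<noteq> u) ys = ys" by (auto simp: filter_id_conv)
    then have f: "filter (\<lambda>v. v \<noteq> u) p = xs @ ys" using p by simp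
    have P: "path_in G xs" "path_in G ys" "(last xs, u) \<in> parcs G" "(u, hd ys) \<in> parcs G"
      "set xs \<inter> set ys = {}"
      using assms(1) p ne by (auto simp: path_in_append path_in_Cons)
    then have "last xs \<noteq> hd ys" using ne by (metis disjoint_iff hd_in_set last_in_set)
    then have "(last xs, hd ys) \<in> parcs G'" using P arcs_u xy_verts by (auto simp: arcs')
    then show ?thesis using f ne p P avoid u' by (auto simp: path_in_append)
  qed
  then show "path_in G' (filter (\<lambda>v. v \<noteq> u) p)"
    "hd (filter (\<lambda>v. v \<noteq> u) p) = hd p" "last (filter (\<lambda>v. v \<noteq> u) p) = last p" by auto
qed

text \<open>Reinsert \<open>u\<close> where the path uses the new edge. The last conjunct preserves
  disjointness: \<open>u\<close> enters only paths that contain both \<open>x\<close> and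
  \<open>y\<close>, and at most one path of a packing does.\<close>

lemma path_unsmooth:
  assumes "path_in G' p"
  shows "\<exists>q. path_in G q \<and> hd q = hd p \<and> last q = last p \<and> set q \<subseteq> insert u (set p) \<and>
    (u \<in> set q \<longrightarrow> x \<in> set p \<and> y \<in> set p)"
  using assms
proof (induction p)
  case Nil then show ?case by (simp add: path_in_def)
next
  case (Cons a p)
  show ?case
  proof (cases "p = []")
    case True then show ?thesis using Cons.prems
      by (intro exI[of _ "[a]"]) (auto simp: path_in_def verts')
  next
    case False
    then have a: "a \<in> pverts G" "a \<noteq> u" "a \<notin> set p" "path_in G' p" "(a, hd p) \<in> parcs G'"
      using Cons.prems by (auto simp: path_in_Cons verts')
    then obtain q where q: "path_in G q" "hd q = hd p" "last q = last p" "set q \<subseteq> insert u (set p)"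
      "u \<in> set q \<longrightarrow> x \<in> set p \<and> y \<in> set p" using Cons.IH by blast
    then have "q \<noteq> []" by (auto simp: path_in_def)
    show ?thesis
    proof (cases "(a, hd p) \<in> parcs G")
      case True
      then show ?thesis using q a False \<open>q \<noteq> []\<close>
        by (intro exI[of _ "a # q"]) (auto simp: path_in_Cons)
    next
      case neq: False
      then have *: "a = x \<and> hd p = y \<or> a = y \<and> hd p = x" using a(5) by (auto simp: arcs')
      \<comment> \<open>The path \<open>q\<close> cannot contain \<open>u\<close> already, since
        then \<open>x\<close> and \<open>y\<close> would both lie on \<open>p\<close>, whereas
        \<open>a\<close> is one of them.\<close>
      then have "u \<notin> set q" using q(5) a(3) by auto
      moreover have "x \<in> set (a # p)" "y \<in> set (a # p)" using * hd_in_set[OF False] by auto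
      ultimately show ?thesis using q a False \<open>q \<noteq> []\<close> * u arcs_u
        by (intro exI[of _ "a # u # q"]) (auto simp: path_in_Cons)
    qed
  qed
qed

text \<open>At \<open>x\<close> the neighbour \<open>u\<close> is exchanged for \<open>y\<close>,
  and at \<open>y\<close> for \<open>x\<close>; by \<open>not_adjacent\<close> this keeps the
  degree. The vertex \<open>u\<close> itself is a leaf on neither side.\<close>

lemma leaf_smooth: "leaf G' v \<longleftrightarrow> leaf G v"
proof (cases "v = u")
  case True
  then show ?thesis using nbrs_u xy by (simp add: leaf_iff verts')
next
  case False
  have fin: "finite (nbrs G v)"
    by (rule finite_subset[OF _ graph(4)]) (use graph(2) in \<open>auto simp: nbrs_def\<close>)
  have swap: "card (insert z (A - {u})) = card A" if "u \<in> A" "z \<notin> A" "finite A" for A z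
    using that card_Suc_Diff1[of A u] by simp
  consider "v = x" | "v = y" | "v \<noteq> x" "v \<noteq> y" by blast
  then have "card (nbrs G' v) = card (nbrs G v)"
  proof cases
    case 1
    then have "nbrs G' v = insert y (nbrs G v - {u})"
      using xy xy_verts by (auto simp: nbrs_def arcs')
    then show ?thesis using swap[of "nbrs G v" y] fin 1 not_adjacent arcs_u by (simp add: nbrs_def)
  next
    case 2
    then have "nbrs G' v = insert x (nbrs G v - {u})"
      using xy xy_verts by (auto simp: nbrs_def arcs')
    then show ?thesis using swap[of "nbrs G v" x] fin 2 not_adjacent arcs_u by (simp add: nbrs_def)
  next
    case 3
    then have "nbrs G' v = nbrs G v" using False arcs_u by (auto simp: nbrs_def arcs')
    then show ?thesis by simp
  qed
  then show ?thesis using False by (simp add: leaf_iff verts')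
qed

lemma tree_or_empty':
  assumes "tree_or_empty G"
  shows "tree_or_empty G'"
proof -
  have "(a, b) \<in> (parcs G')\<^sup>*" if ab: "a \<in> pverts G'" "b \<in> pverts G'" for a b
  proof -
    have "(a, b) \<in> (parcs G)\<^sup>*" "a \<in> pverts G" "a \<noteq> u" "b \<noteq> u"
      using assms ab by (auto simp: tree_or_empty_def verts')
    then obtain p where "path_in G p" "hd p = a" "last p = b" using rtrancl_path graph(2) by metis
    with path_smooth[of p] \<open>a \<noteq> u\<close> \<open>b \<noteq> u\<close> obtain q where "path_in G' q" "hd q = a" "last q = b" by auto
    then show ?thesis using path_rtrancl[of G' q b] by (auto simp: path_in_def)
  qed
  then show ?thesis using pair_graph' acyclic' by (simp add: tree_or_empty_def)
qed

text \<open>Both translations of paths keep ends and disjointness. Unsmoothing by \<open>f\<close>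
  turns an optimal packing of \<open>G'\<close> into a packing of \<open>G\<close> of the same size;
  smoothing by \<open>?g\<close> shows that \<open>G\<close> has no larger one.\<close>

lemma optimal_ends_unsmooth:
  assumes "optimal_ends G' \<Psi>"
  shows "optimal_ends G \<Psi>"
proof -
  have not_leaf: "\<not> leaf G u" using nbrs_u xy by (simp add: leaf_iff)
  obtain S where S: "leaf_packing G' S" "\<And>S'. leaf_packing G' S' \<Longrightarrow> card S' \<le> card S"
    "distinct \<Psi>" "set \<Psi> = (\<lambda>p. {hd p, last p}) ` S" using assms by (auto simp: optimal_ends_def)
  have "\<exists>q. path_in G' p \<longrightarrow> (path_in G q \<and> hd q = hd p \<and> last q = last p \<and>
    set q \<subseteq> insert u (set p) \<and> (u \<in> set q \<longrightarrow> x \<in> set p \<and> y \<in> set p))" for p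
    using path_unsmooth by metis
  then obtain f where "\<forall>p. path_in G' p \<longrightarrow> (path_in G (f p) \<and> hd (f p) = hd p \<and> last (f p) = last p \<and>
    set (f p) \<subseteq> insert u (set p) \<and> (u \<in> set (f p) \<longrightarrow> x \<in> set p \<and> y \<in> set p))" by metis
  then have f: "path_in G' p \<Longrightarrow> path_in G (f p)" "path_in G' p \<Longrightarrow> hd (f p) = hd p"
    "path_in G' p \<Longrightarrow> last (f p) = last p" "path_in G' p \<Longrightarrow> set (f p) \<subseteq> insert u (set p)"
    "path_in G' p \<Longrightarrow> u \<in> set (f p) \<Longrightarrow> x \<in> set p" for p by blast+
  have f1: "leaf_path G (f p)" if "leaf_path G' p" for p
    using that by (auto simp: leaf_path_def f leaf_smooth)
  have f2: "set p \<inter> set q \<noteq> {}"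
    if "leaf_path G' p" "leaf_path G' q" "set (f p) \<inter> set (f q) \<noteq> {}" for p q
  proof -
    have pq: "path_in G' p" "path_in G' q" using that by (auto simp: leaf_path_def)
    show ?thesis using that(3) f(4,5)[OF pq(1)] f(4,5)[OF pq(2)] by blast
  qed
  note fS = leaf_packing_image[OF S(1), of G f, OF f1 f2]
  let ?g = "filter (\<lambda>v. v \<noteq> u)"
  have g1: "leaf_path G' (?g p)" if "leaf_path G p" for p
  proof -
    have "hd p \<noteq> u" "last p \<noteq> u" using that not_leaf by (auto simp: leaf_path_def)
    then show ?thesis using that path_smooth[of p] by (auto simp: leaf_path_def leaf_smooth)
  qed
  have "card S' \<le> card (f ` S)" if "leaf_packing G S'" for S'
  proof -
    have "set p \<inter> set q \<noteq> {}" if "set (?g p) \<inter> set (?g q) \<noteq> {}" for p q using that by auto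
    from leaf_packing_image[OF that, of G' ?g, OF g1 this] S(2)[of "?g ` S'"] fS(2) show ?thesis by simp
  qed
  moreover have "(\<lambda>p. {hd p, last p}) ` (f ` S) = (\<lambda>p. {hd p, last p}) ` S"
    unfolding image_image by (rule image_cong) (use S(1) in \<open>auto simp: leaf_packing_def leaf_path_def f\<close>)
  ultimately show ?thesis unfolding optimal_ends_def using fS(1) S(3,4) by metis
qed

end

lemma tree_or_emptyD:
  assumes "tree_or_empty G"
  shows "pair_graph G" "acyclic_graph G" "sym (parcs G)" "parcs G \<subseteq> pverts G \<times> pverts G"
    "irrefl (parcs G)" "finite (pverts G)"
    "a \<in> pverts G \<Longrightarrow> b \<in> pverts G \<Longrightarrow> (a, b) \<in> (parcs G)\<^sup>*"
  using assms by (auto simp: tree_or_empty_def pair_graph_iff)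

lemma smooth_step_tree:
  assumes "tree_or_empty G" "smooth_step G G'"
  shows "tree_or_empty G'" "optimal_ends G' \<Psi> \<Longrightarrow> optimal_ends G \<Psi>" "card (pverts G') < card (pverts G)"
proof -
  obtain u x y where step: "u \<in> pverts G" "x \<noteq> y" "nbrs G u = {x, y}" "G' = smooth G u x y"
    using assms(2) by (auto simp: smooth_step_iff)
  interpret smoothing G u x y
    by (rule smoothing.intro[OF tree_or_emptyD(1,2)[OF assms(1)] step(1-3)])
  show "tree_or_empty G'" using tree_or_empty' assms(1) step(4) by simp
  show "optimal_ends G' \<Psi> \<Longrightarrow> optimal_ends G \<Psi>" using optimal_ends_unsmooth step(4) by simp
  show "card (pverts G') < card (pverts G)"
    using step(4) verts' u graph(4) by (simp add: card_Diff1_less del: card_Diff_insert)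
qed

lemma smooth_steps_tree:
  assumes "smooth_step\<^sup>*\<^sup>* G G'" "tree_or_empty G"
  shows "tree_or_empty G' \<and> (optimal_ends G' \<Psi> \<longrightarrow> optimal_ends G \<Psi>) \<and> card (pverts G') \<le> card (pverts G)"
  using assms
proof induction
  case (step H H')
  then show ?case using smooth_step_tree[of H H'] by fastforce
qed simp

lemma is_SM_exists:
  assumes "tree_or_empty G"
  shows "\<exists>H. is_SM G H"
  using assms
proof (induction "card (pverts G)" arbitrary: G rule: less_induct)
  case less
  show ?case
  proof (cases "\<exists>v\<in>pverts G. out_degree (with_proj G) v = 2")
    case False
    then show ?thesis by (intro exI[of _ G]) (simp add: is_SM_def)
  next
    case True
    then obtain u x y where "u \<in> pverts G" "nbrs G u = {x, y}" "x \<noteq> y"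
      by (auto simp: card_nbrs card_2_iff)
    then have step: "smooth_step G (smooth G u x y)" by (auto simp: smooth_step_iff)
    from less.hyps[OF smooth_step_tree(3,1)] less.prems step obtain H where "is_SM (smooth G u x y) H" by blast
    then have "is_SM G H" using step by (auto simp: is_SM_def intro: converse_rtranclp_into_rtranclp)
    then show ?thesis by blast
  qed
qed

section \<open>Removing an end support vertex\<close>

lemma finite_nbrs: "pair_graph G \<Longrightarrow> finite (nbrs G v)"
  by (rule finite_subset[of _ "pverts G"]) (auto simp: nbrs_def pair_graph_iff)

lemma path_in_remove: "path_in (remove_verts G A) q \<longleftrightarrow> path_in G q \<and> set q \<inter> A = {}"
proof -
  have "successively (\<lambda>a b. (a, b) \<in> parcs (remove_verts G A)) q \<longleftrightarrow> successively (\<lambda>a b. (a, b) \<in> parcs G) q"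
    if "set q \<inter> A = {}"
    using that by (intro successively_cong) (auto simp: remove_verts_def)
  then show ?thesis by (auto simp: path_in_def remove_verts_def)
qed

lemma tree_closed_set:
  assumes "tree_or_empty G" "v \<in> C" "v \<in> pverts G" "\<And>x. x \<in> C \<Longrightarrow> nbrs G x \<subseteq> C"
  shows "pverts G \<subseteq> C"
proof
  fix w assume "w \<in> pverts G"
  then have "(v, w) \<in> (parcs G)\<^sup>*" using tree_or_emptyD(7)[OF assms(1,3)] by blast
  then show "w \<in> C" by induction (use assms in \<open>auto simp: nbrs_def\<close>)
qed

text \<open>Take the second vertex \<open>s\<close> of a longest path. A neighbour of
  \<open>s\<close> that is not among the later vertices starts another longest path, so it is a
  leaf; by \<open>acyclic_chord\<close> only the third vertex remains as a possible nonleaf.\<close>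

lemma end_support_vertex_exists:
  assumes "tree_or_empty G" "2 \<le> card (pverts G)"
  shows "\<exists>p. end_support_vertex G p"
proof -
  note G = tree_or_emptyD[OF assms(1)]
  obtain v0 where "v0 \<in> pverts G" using assms(2) by fastforce
  then have "path_in G [v0]" by (simp add: path_in_def)
  from longest_path[OF G(6) this] obtain q where
    q: "path_in G q" "\<And>q'. path_in G q' \<Longrightarrow> length q' \<le> length q" by blast
  obtain a q1 where q1: "q = a # q1" using q(1) by (cases q) (auto simp: path_in_def)
  then have a: "a \<in> pverts G" using q(1) by (simp add: path_in_Cons)
  have nbr_a: "q1 \<noteq> [] \<and> w = hd q1" if "w \<in> nbrs G a" for w
    using longest_path_end[OF G(1,2), of a q1 w] q q1 that by (auto simp: nbrs_def)
  have "q1 \<noteq> []"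
  proof
    assume "q1 = []"
    then have "nbrs G a = {}" using nbr_a by blast
    then have "pverts G \<subseteq> {a}" using tree_closed_set[OF assms(1), of a "{a}"] a by auto
    then have "card (pverts G) \<le> 1" using card_mono[of "{a}"] by fastforce
    then show False using assms(2) by simp
  qed
  then obtain s q2 where q2: "q1 = s # q2" by (cases q1) auto
  have path: "a \<notin> set (s # q2)" "path_in G (s # q2)" "(a, s) \<in> parcs G" "s \<in> pverts G"
    using q(1) q1 q2 by (auto simp: path_in_Cons)
  have "nbrs G a \<subseteq> {s}" using nbr_a q2 by auto
  moreover have "s \<in> nbrs G a" using path(3) by (simp add: nbrs_def)
  ultimately have "nbrs G a = {s}" by blast
  then have "leaf G a" using a by (simp add: leaf_iff)
  then have supp: "support_vertex G s"
    using path(3,4) G(3) by (auto simp: support_vertex_def leaf_nbrs_def nbrs_def dest: symD)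
  \<comment> \<open>If \<open>q2\<close> is empty, \<open>s\<close> has no nonleaf neighbour, so the
    unspecified value of \<open>hd q2\<close> does no harm.\<close>
  have "w = hd q2" if w: "w \<in> nbrs G s" "\<not> leaf G w" for w
  proof -
    have ws: "(w, s) \<in> parcs G" "w \<in> pverts G" "w \<noteq> s"
      using w(1) G(3-5) by (auto simp: nbrs_def irrefl_def dest: symD)
    show ?thesis
    proof (cases "w \<in> set q2")
      case True
      then show ?thesis using acyclic_chord[OF G(2) path(2) ws(1)] by blast
    next
      case False
      then have wp: "path_in G (w # s # q2)" using ws path(2) by (simp add: path_in_Cons[of G w])
      have "nbrs G w \<subseteq> {s}"
        using longest_path_end[OF G(1,2) wp] q(2) q1 q2 by (auto simp: nbrs_def)
      then have "nbrs G w = {s}" using ws(1) by (auto simp: nbrs_def)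
      then show ?thesis using w(2) ws(2) by (simp add: leaf_iff)
    qed
  qed
  then have "{w \<in> nbrs G s. \<not> leaf G w} \<subseteq> {hd q2}" by auto
  then have "card {w \<in> nbrs G s. \<not> leaf G w} \<le> 1" using card_mono[of "{hd q2}"] by fastforce
  then show ?thesis using supp by (auto simp: end_support_vertex_def)
qed

locale end_removal =
  fixes G :: "'a pair_pre_digraph" and p
  assumes tree: "tree_or_empty G" and normal: "\<forall>v\<in>pverts G. out_degree (with_proj G) v \<noteq> 2"
    and size: "3 \<le> card (pverts G)" and end_support: "end_support_vertex G p"
begin

lemmas G = tree_or_emptyD[OF tree]

abbreviation "L \<equiv> leaf_nbrs G p"
abbreviation "H \<equiv> remove_verts G (insert p L)"

lemma p_vert: "p \<in> pverts G" and L_nonempty: "L \<noteq> {}"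
  using end_support by (auto simp: end_support_vertex_def support_vertex_def)

lemma nbrs_L:
  assumes "v \<in> L"
  shows "nbrs G v = {p}" "leaf G v"
proof -
  have "p \<in> nbrs G v" "leaf G v" using assms G(3) by (auto simp: leaf_nbrs_def nbrs_def dest: symD)
  then show "nbrs G v = {p}" "leaf G v" by (auto elim: leafE)
qed

text \<open>Two adjacent leaves would be the whole tree, against \<open>size\<close>.\<close>

lemma p_not_leaf: "\<not> leaf G p"
proof
  assume "leaf G p"
  obtain v where v: "v \<in> L" using L_nonempty by blast
  then have "v \<in> nbrs G p" by (simp add: leaf_nbrs_def)
  with \<open>leaf G p\<close> have "nbrs G p = {v}" by (auto elim: leafE)
  then have "pverts G \<subseteq> {p, v}"
    using tree_closed_set[OF tree, of p "{p, v}"] p_vert nbrs_L[OF v] by auto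
  then have "card (pverts G) \<le> card {p, v}" by (intro card_mono) auto
  also have "\<dots> \<le> 2" by (simp add: card_insert_if)
  finally show False using size by simp
qed

lemma nonleaf_unique:
  assumes "v \<in> nbrs G p" "w \<in> nbrs G p" "v \<notin> L" "w \<notin> L"
  shows "v = w"
proof -
  have "card {w \<in> nbrs G p. \<not> leaf G w} \<le> 1" using end_support by (simp add: end_support_vertex_def)
  moreover have "finite {w \<in> nbrs G p. \<not> leaf G w}" using finite_nbrs[OF G(1)] by simp
  ultimately show ?thesis using assms by (auto simp: card_le_Suc0_iff_eq leaf_nbrs_def)
qed

text \<open>With a single leaf neighbour and at most one other neighbour, \<open>p\<close> would
  have degree 1 or 2; the first makes it a leaf, the second contradicts \<open>normal\<close>. This
  is why the algorithm always finds its two leaves.\<close>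

lemma two_leaf_nbrs: "\<exists>v\<in>L. \<exists>w\<in>L. v \<noteq> w"
proof (rule ccontr)
  assume no: "\<not> ?thesis"
  obtain v where v: "v \<in> L" using L_nonempty by blast
  have L: "L = {v}" using v no by blast
  have "card (nbrs G p) \<noteq> 1" using p_not_leaf p_vert by (simp add: leaf_iff)
  moreover have v': "v \<in> nbrs G p" using v by (simp add: leaf_nbrs_def)
  ultimately have "nbrs G p \<noteq> {v}" by auto
  then obtain w where w: "w \<in> nbrs G p" "w \<noteq> v" using v' by blast
  have "z = v \<or> z = w" if "z \<in> nbrs G p" for z
    using nonleaf_unique[OF w(1) that] L w(2) by blast
  then have "nbrs G p = {v, w}" using v' w(1) by blast
  then have "card (nbrs G p) = 2" using w by simp
  then show False using normal p_vert by (simp add: card_nbrs)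
qed

text \<open>The only surviving vertex that can lose a neighbour is the nonleaf neighbour of
  \<open>p\<close>, and it loses just \<open>p\<close>. Its degree was neither 1 nor 2, so it does
  not become a leaf.\<close>

lemma leaf_remove:
  assumes "v \<in> pverts H"
  shows "leaf H v \<longleftrightarrow> leaf G v"
proof -
  have v: "v \<in> pverts G" "v \<noteq> p" "v \<notin> L" using assms by (auto simp: remove_verts_def)
  have "nbrs G v \<inter> L = {}"
    using nbrs_L(1) v(2) G(3) by (force simp: nbrs_def dest: symD)
  then have nb: "nbrs H v = nbrs G v - {p}" using v by (auto simp: nbrs_def remove_verts_def)
  show ?thesis
  proof (cases "p \<in> nbrs G v")
    case False
    then show ?thesis using nb v by (simp add: leaf_iff remove_verts_def)
  next
    case True
    then have "v \<in> nbrs G p" using G(3) by (auto simp: nbrs_def dest: symD)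
    then have "\<not> leaf G v" using v(3) by (auto simp: leaf_nbrs_def)
    moreover have "card (nbrs G v - {p}) \<noteq> 1"
    proof
      assume "card (nbrs G v - {p}) = 1"
      then have "card (nbrs G v) = 2" using card_Suc_Diff1[OF finite_nbrs[OF G(1)] True] by simp
      then show False using normal v(1) by (simp add: card_nbrs)
    qed
    ultimately show ?thesis using nb by (simp add: leaf_iff)
  qed
qed

text \<open>Removed leaves cannot be inner vertices, and \<open>p\<close> as an inner vertex would
  need two different nonleaf neighbours, against \<open>nonleaf_unique\<close>.\<close>

lemma path_avoids:
  assumes "path_in G q" "hd q \<in> pverts H" "last q \<in> pverts H"
  shows "path_in H q"
proof -
  have hl: "hd q \<notin> insert p L" "last q \<notin> insert p L" using assms by (auto simp: remove_verts_def)
  have L: "set q \<inter> L = {}" using leaf_on_path[OF G(3) assms(1)] nbrs_L(2) hl by blast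
  have "p \<notin> set q"
  proof
    assume "p \<in> set q"
    then obtain xs ys where q: "q = xs @ p # ys" by (auto simp: in_set_conv_decomp)
    then have ne: "xs \<noteq> []" "ys \<noteq> []" using hl by auto
    then have P: "(last xs, p) \<in> parcs G" "(p, hd ys) \<in> parcs G" "set xs \<inter> set ys = {}"
      using assms(1) q by (auto simp: path_in_append path_in_Cons)
    have "last xs \<in> set q" "hd ys \<in> set q" using ne q by auto
    then have "last xs = hd ys"
      using nonleaf_unique[of "last xs" "hd ys"] P(1,2) G(3) L by (auto simp: nbrs_def dest: symD)
    then show False using P(3) ne by (metis disjoint_iff hd_in_set last_in_set)
  qed
  then show ?thesis using assms(1) L by (simp add: path_in_remove)
qed

lemma path_remove: "path_in H q \<Longrightarrow> path_in G q"
  by (simp add: path_in_remove)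

lemma tree_remove: "tree_or_empty H"
proof -
  have "(a, b) \<in> (parcs H)\<^sup>*" if ab: "a \<in> pverts H" "b \<in> pverts H" for a b
  proof -
    have "a \<in> pverts G" "b \<in> pverts G" using ab by (auto simp: remove_verts_def)
    then obtain q where q: "path_in G q" "hd q = a" "last q = b"
      using rtrancl_path[OF _ G(4)] G(7) by metis
    then have "path_in H q" using path_avoids ab by simp
    then show ?thesis using path_rtrancl[of H q b] q by (auto simp: path_in_def)
  qed
  then show ?thesis using pair_graph_remove[OF G(1)] acyclic_remove[OF G(2)]
    by (simp add: tree_or_empty_def)
qed

lemma card_remove: "card (pverts H) < card (pverts G)"
  using G(6) p_vert by (intro psubset_card_mono) (auto simp: remove_verts_def)

lemma leaf_path_remove: "leaf_path H q \<Longrightarrow> leaf_path G q"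
  using leaf_remove by (auto simp: leaf_path_def path_remove leaf_iff)

text \<open>A path that meets a leaf of \<open>L\<close> ends there and, having at least two
  vertices, continues to \<open>p\<close>, the only neighbour of that leaf.\<close>

lemma leaf_path_avoiding:
  assumes "leaf_path G q" "p \<notin> set q"
  shows "leaf_path H q"
proof -
  have q: "path_in G q" "hd q \<noteq> last q" using assms by (auto simp: leaf_path_def)
  have "set q \<inter> L = {}"
  proof (rule ccontr)
    assume "set q \<inter> L \<noteq> {}"
    then obtain v where v: "v \<in> set q" "v \<in> L" by blast
    have "v = hd q \<or> v = last q" using leaf_on_path[OF G(3) q(1)] v nbrs_L(2) by blast
    then have "\<exists>w\<in>set q. w \<in> nbrs G v"
    proof
      assume "v = hd q"
      moreover obtain a b q' where "q = a # b # q'" using path_in_length[OF q]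
        by (cases q; cases "tl q") auto
      ultimately show ?thesis using q(1) by (auto simp: path_in_Cons nbrs_def)
    next
      assume "v = last q"
      moreover obtain a b q' where q': "rev q = a # b # q'" using path_in_length[OF q]
        by (cases "rev q"; cases "tl (rev q)") auto
      moreover have "path_in G (a # b # q')" using q(1) q' path_in_rev[OF G(3), of q] by simp
      moreover have "last q = a" using q' by (metis last_rev list.sel(1) rev_rev_ident last_ConsL hd_rev rev_is_Nil_conv)
      moreover have "b \<in> set q" using q' by (metis list.set_intros(1,2) set_rev)
      ultimately show ?thesis by (auto simp: path_in_Cons nbrs_def)
    qed
    then show False using nbrs_L(1)[OF v(2)] assms(2) by auto
  qed
  then have "set q \<subseteq> pverts H" using q(1) assms(2) by (auto simp: path_in_def remove_verts_def)
  moreover have "q \<noteq> []" using q(1) by (simp add: path_in_def)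
  ultimately have "hd q \<in> pverts H" "last q \<in> pverts H" by auto
  then show ?thesis using path_avoids[OF q(1)] leaf_remove assms(1) by (auto simp: leaf_path_def)
qed

lemma optimal_ends_remove:
  assumes "optimal_ends H \<Psi>" "u1 \<in> L" "u2 \<in> L" "u1 \<noteq> u2"
  shows "optimal_ends G ({u1, u2} # \<Psi>)"
proof -
  obtain S where S: "leaf_packing H S" "\<And>S'. leaf_packing H S' \<Longrightarrow> card S' \<le> card S"
    "distinct \<Psi>" "set \<Psi> = (\<lambda>p. {hd p, last p}) ` S" using assms by (auto simp: optimal_ends_def)
  let ?q = "[u1, p, u2]"
  have in_H: "set q \<subseteq> pverts H" "q \<noteq> []" if "q \<in> S" for q
    using S(1) that by (auto simp: leaf_packing_def leaf_path_def path_in_def)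
  have q: "leaf_path G ?q"
    using assms(2-4) nbrs_L[OF assms(2)] nbrs_L[OF assms(3)] p_not_leaf p_vert G(3)
    by (auto simp: leaf_path_def path_in_def nbrs_def leaf_iff dest: symD)
  have disj: "set ?q \<inter> set q = {}" if "q \<in> S" for q
    using in_H[OF that] assms(2,3) by (auto simp: remove_verts_def)
  have "leaf_packing G (insert ?q S)"
    using S(1) q disj leaf_path_remove
    by (fastforce simp: leaf_packing_def pairwise_insert disjnt_def)
  moreover have "?q \<notin> S" using disj[of ?q] by auto
  moreover have fin: "finite S" using finite_leaf_packing[OF _ S(1)] G(6) by (simp add: remove_verts_def)
  \<comment> \<open>The paths of \<open>S'\<close> that avoid \<open>p\<close> form a packing of
    \<open>H\<close> and are bounded by \<open>S\<close>; disjointness leaves at most one further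
    path.\<close>
  moreover have "card S' \<le> Suc (card S)" if S': "leaf_packing G S'" for S'
  proof -
    have finS': "finite S'" using finite_leaf_packing[OF G(6) S'] .
    have "leaf_packing H {q \<in> S'. p \<notin> set q}"
      using S' leaf_path_avoiding by (auto simp: leaf_packing_def pairwise_def)
    then have "card {q \<in> S'. p \<notin> set q} \<le> card S" by (rule S(2))
    moreover have "card {q \<in> S'. p \<in> set q} \<le> 1"
      using S' finS' by (auto simp: card_le_Suc0_iff_eq leaf_packing_def pairwise_def disjnt_iff)
    moreover have "card S' = card {q \<in> S'. p \<notin> set q} + card {q \<in> S'. p \<in> set q}"
      using finS' by (subst card_Un_disjoint[symmetric]) (auto intro: arg_cong[where f = card])
    ultimately show ?thesis by simp
  qed
  moreover have "{u1, u2} \<notin> set \<Psi>"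
  proof
    assume "{u1, u2} \<in> set \<Psi>"
    then obtain q where "q \<in> S" "u1 \<in> {hd q, last q}" using S(4) by auto
    then have "u1 \<in> set q" using in_H[of q] by auto
    then show False using disj[OF \<open>q \<in> S\<close>] by auto
  qed
  ultimately show ?thesis unfolding optimal_ends_def using S(3,4)
    by (intro exI[of _ "insert ?q S"]) auto
qed

end

section \<open>Correctness, termination and progress of the nondeterministic algorithm\<close>

lemma gp_stepE:
  assumes "gp_step (G, \<Psi>) s'"
  obtains p u1 u2 G' where "gp_guard (G, \<Psi>)" "end_support_vertex G p"
     "u1 \<in> leaf_nbrs G p" "u2 \<in> leaf_nbrs G p" "u1 \<noteq> u2"
     "is_SM (remove_verts G (insert p (leaf_nbrs G p))) G'" "s' = (G', \<Psi> @ [{u1, u2}])"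
  using assms by (cases rule: gp_step.cases) (rule that; assumption)

text \<open>The last claim is phrased for an arbitrary optimal answer \<open>\<Phi>\<close> of the
  remaining graph, since what the rest of the run will output is not yet known.\<close>

lemma gp_step_properties:
  assumes "gp_step (G, \<Psi>) (G', \<Psi>')" "tree_or_empty G" "\<forall>v\<in>pverts G. out_degree (with_proj G) v \<noteq> 2"
  shows "tree_or_empty G'" "\<forall>v\<in>pverts G'. out_degree (with_proj G') v \<noteq> 2"
    "card (pverts G') < card (pverts G)"
    "\<exists>e. \<Psi>' = \<Psi> @ [e] \<and> (\<forall>\<Phi>. optimal_ends G' \<Phi> \<longrightarrow> optimal_ends G (e # \<Phi>))"
proof -
  from assms(1) obtain p u1 u2 where st: "gp_guard (G, \<Psi>)" "end_support_vertex G p"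
     "u1 \<in> leaf_nbrs G p" "u2 \<in> leaf_nbrs G p" "u1 \<noteq> u2"
     "is_SM (remove_verts G (insert p (leaf_nbrs G p))) G'" "\<Psi>' = \<Psi> @ [{u1, u2}]"
    by (rule gp_stepE) blast
  interpret end_removal G p
    using assms(2,3) st(1,2) by (intro end_removal.intro) (auto simp: gp_guard_def)
  have SM: "smooth_step\<^sup>*\<^sup>* H G'" using st(6) by (simp add: is_SM_def)
  note T = smooth_steps_tree[OF SM tree_remove]
  show "tree_or_empty G'" using T by blast
  show "\<forall>v\<in>pverts G'. out_degree (with_proj G') v \<noteq> 2" using st(6) by (simp add: is_SM_def)
  show "card (pverts G') < card (pverts G)" using T[THEN conjunct2, THEN conjunct2] card_remove by (rule le_less_trans)
  show "\<exists>e. \<Psi>' = \<Psi> @ [e] \<and> (\<forall>\<Phi>. optimal_ends G' \<Phi> \<longrightarrow> optimal_ends G (e # \<Phi>))"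
    using st(7) T optimal_ends_remove[OF _ st(3-5)] by blast
qed

text \<open>The quantified tail \<open>\<Phi>'\<close> stands for the rest of the output: it lets
  the claims for consecutive steps compose, and the final pair of \<open>gp_output\<close> is
  inserted for it at the end.\<close>

lemma gp_run_properties:
  assumes "gp_step\<^sup>*\<^sup>* s s'" "tree_or_empty (fst s)" "\<forall>v\<in>pverts (fst s). out_degree (with_proj (fst s)) v \<noteq> 2"
  shows "tree_or_empty (fst s')" "\<forall>v\<in>pverts (fst s'). out_degree (with_proj (fst s')) v \<noteq> 2"
    "\<exists>\<Phi>. snd s' = snd s @ \<Phi> \<and> (\<forall>\<Phi>'. optimal_ends (fst s') \<Phi>' \<longrightarrow> optimal_ends (fst s) (\<Phi> @ \<Phi>'))"
proof -
  have "tree_or_empty (fst s') \<and> (\<forall>v\<in>pverts (fst s'). out_degree (with_proj (fst s')) v \<noteq> 2) \<and>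
    (\<exists>\<Phi>. snd s' = snd s @ \<Phi> \<and> (\<forall>\<Phi>'. optimal_ends (fst s') \<Phi>' \<longrightarrow> optimal_ends (fst s) (\<Phi> @ \<Phi>')))"
    using assms
  proof (induction rule: rtranclp_induct)
    case base then show ?case by (auto intro: exI[of _ "[]"])
  next
    case (step y z)
    obtain Gy \<Psi>y Gz \<Psi>z where yz: "y = (Gy, \<Psi>y)" "z = (Gz, \<Psi>z)" by (cases y; cases z)
    note IH = step.IH[OF step.prems, unfolded yz, simplified]
    obtain \<Phi> where \<Phi>: "\<Psi>y = snd s @ \<Phi>" "\<And>\<Phi>'. optimal_ends Gy \<Phi>' \<Longrightarrow> optimal_ends (fst s) (\<Phi> @ \<Phi>')"
      using IH by blast
    note P = gp_step_properties[OF step.hyps(2)[unfolded yz]]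
    obtain e where e: "\<Psi>z = \<Psi>y @ [e]" "\<And>\<Phi>. optimal_ends Gz \<Phi> \<Longrightarrow> optimal_ends Gy (e # \<Phi>)"
      using P(4) IH by blast
    have "\<exists>\<Phi>. \<Psi>z = snd s @ \<Phi> \<and> (\<forall>\<Phi>'. optimal_ends Gz \<Phi>' \<longrightarrow> optimal_ends (fst s) (\<Phi> @ \<Phi>'))"
      using \<Phi> e by (intro exI[of _ "\<Phi> @ [e]"]) simp
    then show ?case using P(1,2) IH yz by simp
  qed
  then show "tree_or_empty (fst s')" "\<forall>v\<in>pverts (fst s'). out_degree (with_proj (fst s')) v \<noteq> 2"
    "\<exists>\<Phi>. snd s' = snd s @ \<Phi> \<and> (\<forall>\<Phi>'. optimal_ends (fst s') \<Phi>' \<longrightarrow> optimal_ends (fst s) (\<Phi> @ \<Phi>'))"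
    by blast+
qed

lemma leaf_path_ends:
  assumes "leaf_path G q" "pair_graph G"
  shows "hd q \<in> pverts G" "last q \<in> pverts G" "hd q \<noteq> last q"
  using assms by (auto simp: leaf_path_def leaf_iff)

lemma optimal_ends_small:
  assumes "tree_or_empty G" "card (pverts G) < 3"
  shows "optimal_ends G (if card (pverts G) = 2 then [pverts G] else [])"
proof -
  note G = tree_or_emptyD[OF assms(1)]
  have two: "{hd q, last q} \<subseteq> pverts G" "card {hd q, last q} = 2" if "leaf_path G q" for q
    using leaf_path_ends[OF that G(1)] by auto
  show ?thesis
  proof (cases "card (pverts G) = 2")
    case False
    have "\<not> leaf_path G q" for q
    proof
      assume "leaf_path G q"
      then have "2 \<le> card (pverts G)" using two[of q] card_mono[OF G(6), of "{hd q, last q}"] by simp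
      then show False using False assms(2) by simp
    qed
    then have "leaf_packing G S \<longleftrightarrow> S = {}" for S by (auto simp: leaf_packing_def)
    then show ?thesis using False by (simp add: optimal_ends_def)
  next
    case True
    then obtain a b where ab: "pverts G = {a, b}" "a \<noteq> b" by (auto simp: card_2_iff)
    have ends: "{hd q, last q} = pverts G" if "leaf_path G q" for q
      using two[OF that] True by (intro card_subset_eq[OF G(6)]) auto
    \<comment> \<open>Both vertices of the graph are ends of every leaf path, so two such paths
      always meet.\<close>
    have one: "card S' \<le> 1" if S': "leaf_packing G S'" for S'
    proof -
      have "q = q'" if "q \<in> S'" "q' \<in> S'" for q q'
      proof (rule ccontr)
        assume "q \<noteq> q'"
        then have "set q \<inter> set q' = {}" using S' that by (auto simp: leaf_packing_def pairwise_def disjnt_def)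
        moreover have lp: "leaf_path G q" "leaf_path G q'" using S' that by (auto simp: leaf_packing_def)
        moreover have "a \<in> {hd q, last q}" "a \<in> {hd q', last q'}" using ends lp ab by auto
        moreover have "q \<noteq> []" "q' \<noteq> []" using lp by (auto simp: leaf_path_def path_in_def)
        ultimately show False by (metis disjoint_iff hd_in_set insertE last_in_set singletonD)
      qed
      then show ?thesis using finite_leaf_packing[OF G(6) S'] by (simp add: card_le_Suc0_iff_eq)
    qed
    have "(a, b) \<in> (parcs G)\<^sup>*" using G(7) ab by simp
    then obtain q where q: "path_in G q" "hd q = a" "last q = b"
      using rtrancl_path[OF _ G(4)] ab by blast
    obtain w where w: "(a, w) \<in> parcs G" using \<open>(a, b) \<in> (parcs G)\<^sup>*\<close> ab(2) by (meson converse_rtranclE)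
    then have "w = b" using G(4,5) ab by (auto simp: irrefl_def)
    then have "(a, b) \<in> parcs G" "(b, a) \<in> parcs G" using w G(3) by (auto dest: symD)
    then have "nbrs G a = {b}" "nbrs G b = {a}" using G(4,5) ab by (auto simp: nbrs_def irrefl_def)
    then have "leaf_path G q" using q ab by (simp add: leaf_path_def leaf_iff)
    then have "leaf_packing G {q}" by (simp add: leaf_packing_def)
    then show ?thesis unfolding optimal_ends_def using True one q ab
      by (intro exI[of _ "{q}"]) auto
  qed
qed

lemma gp_start_properties:
  assumes "gp_start T s" "utree T"
  shows "tree_or_empty (fst s)" "\<forall>v\<in>pverts (fst s). out_degree (with_proj (fst s)) v \<noteq> 2" "snd s = []"
    "optimal_ends (fst s) \<Phi> \<Longrightarrow> optimal_ends T \<Phi>"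
proof -
  obtain H where H: "is_SM T H" "s = (H, [])" using assms(1) by (auto simp: gp_start_def)
  have "smooth_step\<^sup>*\<^sup>* T H" using H(1) by (simp add: is_SM_def)
  note this = smooth_steps_tree[OF this utree_tree_or_empty(1)[OF assms(2)]]
  then show "tree_or_empty (fst s)" "\<forall>v\<in>pverts (fst s). out_degree (with_proj (fst s)) v \<noteq> 2" "snd s = []"
    "optimal_ends (fst s) \<Phi> \<Longrightarrow> optimal_ends T \<Phi>"
    using H by (auto simp: is_SM_def)
qed

lemma gp_returns_optimal:
  assumes "utree T" "gp_returns T \<Psi>"
  shows "optimal_ends T \<Psi>"
proof -
  obtain s0 s where s: "gp_start T s0" "gp_step\<^sup>*\<^sup>* s0 s" "\<not> gp_guard s" "\<Psi> = gp_output s"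
    using assms(2) by (auto simp: gp_returns_def gp_reachable_def)
  note start = gp_start_properties[OF s(1) assms(1)]
  note run = gp_run_properties[OF s(2) start(1,2)]
  obtain \<Phi> where \<Phi>: "snd s = \<Phi>" "\<And>\<Phi>'. optimal_ends (fst s) \<Phi>' \<Longrightarrow> optimal_ends (fst s0) (\<Phi> @ \<Phi>')"
    using run(3) start(3) by auto
  have "optimal_ends (fst s) (if card (pverts (fst s)) = 2 then [pverts (fst s)] else [])"
    using optimal_ends_small[OF run(1)] s(3) by (simp add: gp_guard_def)
  from start(4)[OF \<Phi>(2)[OF this]] show ?thesis using \<Phi>(1) s(4) by (simp add: gp_output_def)
qed

lemma gp_terminates_utree:
  assumes "utree T"
  shows "gp_terminates T"
  unfolding gp_terminates_def
proof (intro notI, elim exE conjE)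
  fix f assume f: "gp_start T (f 0)" "\<forall>i::nat. gp_step (f i) (f (Suc i))"
  note start = gp_start_properties[OF f(1) assms]
  have reach: "gp_step\<^sup>*\<^sup>* (f 0) (f i)" for i
    by (induction i) (use f(2) in \<open>auto intro: rtranclp.rtrancl_into_rtrancl\<close>)
  have decr: "card (pverts (fst (f (Suc i)))) < card (pverts (fst (f i)))" for i
    using gp_run_properties(1,2)[OF reach start(1,2), of i] f(2)
      gp_step_properties(3)[of "fst (f i)" "snd (f i)" "fst (f (Suc i))" "snd (f (Suc i))"] by simp
  have "card (pverts (fst (f i))) + i \<le> card (pverts (fst (f 0)))" for i
  proof (induction i)
    case (Suc i)
    then show ?case using decr[of i] by linarith
  qed simp
  from this[of "Suc (card (pverts (fst (f 0))))"] show False by simp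
qed

lemma gp_never_stuck_utree:
  assumes "utree T"
  shows "gp_never_stuck T"
  unfolding gp_never_stuck_def
proof (intro conjI allI impI)
  show "\<exists>s. gp_start T s"
    using is_SM_exists[OF utree_tree_or_empty(1)[OF assms]] by (auto simp: gp_start_def)
next
  fix s assume "gp_reachable T s \<and> gp_guard s"
  then obtain s0 where s: "gp_start T s0" "gp_step\<^sup>*\<^sup>* s0 s" "gp_guard s" by (auto simp: gp_reachable_def)
  note start = gp_start_properties[OF s(1) assms]
  note run = gp_run_properties[OF s(2) start(1,2)]
  obtain p where p: "end_support_vertex (fst s) p"
    using end_support_vertex_exists[OF run(1)] s(3) by (auto simp: gp_guard_def)
  interpret end_removal "fst s" p
    using run(1,2) p s(3) by (intro end_removal.intro) (auto simp: gp_guard_def)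
  obtain u1 u2 where "u1 \<in> L" "u2 \<in> L" "u1 \<noteq> u2" using two_leaf_nbrs by blast
  moreover obtain T' where "is_SM H T'" using is_SM_exists[OF tree_remove] by blast
  ultimately show "\<exists>s'. gp_step s s'"
    using gp_step.intros[of "fst s" "snd s" p] s(3) p by (metis prod.collapse)
qed

section \<open>Contractions of a rooted tree\<close>

text \<open>\<open>ix\<close> only serves as a measure that decreases towards the root.\<close>

locale rooted =
  fixes V :: "'a set" and r :: 'a and par :: "'a \<Rightarrow> 'a" and ix :: "'a \<Rightarrow> nat"
  assumes finite_V: "finite V" and r_V: "r \<in> V" and par_r: "par r = r"
    and par_V: "v \<in> V \<Longrightarrow> par v \<in> V"
    and par_ix: "v \<in> V \<Longrightarrow> v \<noteq> r \<Longrightarrow> ix (par v) < ix v"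
begin

definition anc :: "'a \<Rightarrow> 'a \<Rightarrow> bool" where
  "anc a b \<longleftrightarrow> (\<exists>k. (par ^^ k) b = a)"

definition kids :: "'a \<Rightarrow> 'a set" where
  "kids v = {c \<in> V. c \<noteq> r \<and> par c = v}"

definition sub :: "'a \<Rightarrow> 'a set" where
  "sub v = {w \<in> V. anc v w}"

lemma anc_refl [simp]: "anc a a"
  unfolding anc_def by (rule exI[of _ 0]) simp

lemma anc_par [simp]: "anc (par b) b"
  unfolding anc_def by (rule exI[of _ 1]) simp

lemma anc_trans: "anc a b \<Longrightarrow> anc b c \<Longrightarrow> anc a c"
proof -
  assume "anc a b" "anc b c"
  then obtain j k where "(par ^^ j) b = a" "(par ^^ k) c = b" by (auto simp: anc_def)
  then have "(par ^^ (j + k)) c = a" by (simp add: funpow_add)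
  then show ?thesis unfolding anc_def by blast
qed

lemma anc_step: "anc a b \<Longrightarrow> a = b \<or> anc a (par b)"
proof -
  assume "anc a b"
  then obtain k where k: "(par ^^ k) b = a" by (auto simp: anc_def)
  show ?thesis
  proof (cases k)
    case (Suc j)
    then have "(par ^^ j) (par b) = a" using k by (simp add: funpow_swap1)
    then show ?thesis unfolding anc_def by blast
  qed (use k in simp)
qed

text \<open>Both are iterates of \<open>par\<close> at the same vertex, so the later iterate is
  reached from the earlier one.\<close>

lemma anc_linear:
  assumes "anc a c" "anc b c"
  shows "anc a b \<or> anc b a"
proof -
  obtain i j where ij: "(par ^^ i) c = a" "(par ^^ j) c = b" using assms by (auto simp: anc_def)
  have "(par ^^ (m - n)) ((par ^^ n) c) = (par ^^ m) c" if "n \<le> m" for m n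
    using that by (metis comp_apply funpow_add le_add_diff_inverse2)
  then show ?thesis using ij by (metis anc_def nat_le_linear)
qed

text \<open>Every step to the parent lowers the measure, except at the root, where
  \<open>par\<close> stays put. Antisymmetry of \<open>anc\<close> on \<open>V\<close>
  follows.\<close>

lemma anc_ix:
  assumes "anc a b" "b \<in> V"
  shows "a \<in> V" "a = b \<or> ix a < ix b"
proof -
  have "a \<in> V \<and> (a = b \<or> ix a < ix b)" if "(par ^^ k) b = a" for k a
    using that
  proof (induction k arbitrary: a)
    case (Suc k)
    let ?c = "(par ^^ k) b"
    have "?c \<in> V" "?c = b \<or> ix ?c < ix b" using Suc.IH by auto
    moreover have "a = par ?c" using Suc.prems by simp
    ultimately show ?case using par_V[of ?c] par_ix[of ?c] par_r by (cases "?c = r") auto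
  qed (use assms(2) in simp)
  then show "a \<in> V" "a = b \<or> ix a < ix b" using assms(1) by (auto simp: anc_def)
qed

lemma anc_antisym: "anc a b \<Longrightarrow> anc b a \<Longrightarrow> b \<in> V \<Longrightarrow> a = b"
  using anc_ix(1)[of a b] anc_ix(2)[of a b] anc_ix(2)[of b a] by auto

lemma anc_root: "v \<in> V \<Longrightarrow> anc r v"
proof (induction "ix v" arbitrary: v rule: less_induct)
  case less
  show ?case
  proof (cases "v = r")
    case False
    then have "anc r (par v)" using less par_ix par_V by blast
    then show ?thesis using anc_trans anc_par by blast
  qed simp
qed

lemma anc_of_root: "anc v r \<Longrightarrow> v = r"
  using anc_antisym[of v r] anc_root[of v] anc_ix(1)[of v r] r_V by blast

lemma sub_self: "v \<in> V \<Longrightarrow> v \<in> sub v"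
  by (simp add: sub_def)

lemma sub_V: "sub v \<subseteq> V"
  by (auto simp: sub_def)

lemma finite_sub: "finite (sub v)"
  using finite_subset[OF sub_V finite_V] .

lemma sub_mono: "anc v w \<Longrightarrow> sub w \<subseteq> sub v"
  unfolding sub_def using anc_trans by blast

lemma sub_root: "sub r = V"
  using anc_root by (auto simp: sub_def)

lemma kidsD: "c \<in> kids v \<Longrightarrow> c \<in> V \<and> c \<noteq> r \<and> anc v c \<and> v \<noteq> c \<and> par c = v \<and> v \<in> V"
  using par_ix[of c] par_V[of c] by (auto simp: kids_def)

lemma sub_unfold:
  assumes "v \<in> V"
  shows "sub v = insert v (\<Union>c\<in>kids v. sub c)"
proof -
  have "\<exists>c\<in>kids v. anc c w" if "w \<in> V" "anc v w" "w \<noteq> v" for w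
    using that
  proof (induction "ix w" arbitrary: w rule: less_induct)
    case less
    then have wr: "w \<noteq> r" using anc_of_root by blast
    then have p: "anc v (par w)" "par w \<in> V" "ix (par w) < ix w"
      using anc_step less.prems par_V par_ix by blast+
    show ?case
    proof (cases "par w = v")
      case True then show ?thesis using wr less.prems(1) by (auto simp: kids_def)
    next
      case False
      then show ?thesis using less.hyps p anc_trans anc_par by blast
    qed
  qed
  then have "sub v \<subseteq> insert v (\<Union>c\<in>kids v. sub c)" unfolding sub_def by blast
  moreover have "sub c \<subseteq> sub v" if "c \<in> kids v" for c using kidsD[OF that] sub_mono by blast
  ultimately show ?thesis using sub_self[OF assms] by blast
qed

lemma kids_sub_less: "c \<in> kids v \<Longrightarrow> sub c \<subset> sub v"
proof -
  assume "c \<in> kids v"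
  then have c: "c \<in> V" "anc v c" "v \<noteq> c" "v \<in> V" using kidsD by blast+
  then have "v \<notin> sub c" using anc_antisym[of c v] by (auto simp: sub_def)
  then show ?thesis using sub_mono[OF c(2)] sub_self[OF c(4)] by blast
qed

lemma kids_disjoint:
  assumes "c \<in> kids v" "c' \<in> kids v" "c \<noteq> c'"
  shows "sub c \<inter> sub c' = {}"
proof -
  have "\<not> anc c c'" if "c \<in> kids v" "c' \<in> kids v" "c \<noteq> c'" for c c'
  proof
    assume "anc c c'"
    then have "anc c v" using anc_step that kidsD by metis
    then show False using anc_antisym[of c v] kidsD[OF that(1)] by blast
  qed
  then show ?thesis using anc_linear assms by (force simp: sub_def)
qed

text \<open>The covering relation of the ancestor order restricted to \<open>A\<close>.\<close>

definition cov :: "'a set \<Rightarrow> 'a \<Rightarrow> 'a \<Rightarrow> bool" where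
  "cov A v w \<longleftrightarrow> v \<in> A \<and> w \<in> A \<and> anc v w \<and> v \<noteq> w \<and> (\<forall>z\<in>A. anc v z \<and> anc z w \<longrightarrow> z = v \<or> z = w)"

text \<open>
  All graphs that occur in the run are contractions of the input to some vertex set \<open>A\<close>, with an
  edge from each vertex to its nearest proper ancestor in \<open>A\<close>. Smoothing and the deletion of
  whole branches then merely shrink \<open>A\<close>.
\<close>

definition contraction :: "'a set \<Rightarrow> 'a pair_pre_digraph" where
  "contraction A = \<lparr> pverts = A, parcs = {(v, w). cov A v w \<or> cov A w v} \<rparr>"

lemma pverts_contraction [simp]: "pverts (contraction A) = A"
  by (simp add: contraction_def)

lemma nbrs_contraction: "nbrs (contraction A) v = {w. cov A v w} \<union> {w. cov A w v}"
  by (auto simp: nbrs_def contraction_def)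

lemma covD: "cov A v w \<Longrightarrow> v \<in> A \<and> w \<in> A \<and> anc v w \<and> v \<noteq> w"
  by (simp add: cov_def)

lemma cov_between: "cov A v w \<Longrightarrow> z \<in> A \<Longrightarrow> anc v z \<Longrightarrow> anc z w \<Longrightarrow> z = v \<or> z = w"
  by (simp add: cov_def)

lemma cov_parent_unique: "cov A v w \<Longrightarrow> cov A v' w \<Longrightarrow> v = v'"
proof -
  assume vw: "cov A v w" "cov A v' w"
  then consider "anc v v'" | "anc v' v" using anc_linear covD by blast
  then show "v = v'"
    using cov_between[OF vw(1), of v'] cov_between[OF vw(2), of v] covD[OF vw(1)] covD[OF vw(2)] by cases auto
qed

text \<open>Among the proper ancestors in \<open>A\<close>, which include \<open>r\<close>, one of
  maximal \<open>ix\<close> is the nearest.\<close>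

lemma cov_parent_exists:
  assumes "w \<in> A" "w \<noteq> r" "r \<in> A" "A \<subseteq> V"
  shows "\<exists>v. cov A v w"
proof -
  let ?S = "{z \<in> A. anc z w \<and> z \<noteq> w}"
  have "finite ?S" "r \<in> ?S" using assms finite_V anc_root finite_subset[of A V] by auto
  then have "Max (ix ` ?S) \<in> ix ` ?S" by (intro Max_in) auto
  then obtain v where v: "v \<in> ?S" "ix v = Max (ix ` ?S)" by force
  have max: "ix z \<le> ix v" if "z \<in> ?S" for z
    unfolding v(2) using \<open>finite ?S\<close> that by (intro Max_ge) auto
  have "z = v \<or> z = w" if "z \<in> A" "anc v z" "anc z w" for z
  proof (rule ccontr)
    assume "\<not> ?thesis"
    then have "z \<in> ?S" "z \<noteq> v" using that by auto
    then show False using max[of z] anc_ix(2)[OF that(2)] that(1) assms(4) by auto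
  qed
  then show ?thesis using v(1) assms(1) by (auto simp: cov_def)
qed

lemma cov_root: "\<not> cov A v r"
  using anc_of_root covD by blast

definition live :: "'a set \<Rightarrow> 'a \<Rightarrow> bool" where
  "live A c \<longleftrightarrow> A \<inter> sub c \<noteq> {}"

text \<open>Ensures that the children of \<open>w\<close> in the contraction correspond to its live kids.\<close>

definition meet_closed :: "'a set \<Rightarrow> bool" where
  "meet_closed A \<longleftrightarrow> (\<forall>w. \<forall>c\<in>kids w. \<forall>c'\<in>kids w. c \<noteq> c' \<and> live A c \<and> live A c' \<longrightarrow> w \<in> A)"

definition branching :: "'a set \<Rightarrow> 'a \<Rightarrow> bool" where
  "branching A w \<longleftrightarrow> (\<exists>c\<in>kids w. \<exists>c'\<in>kids w. c \<noteq> c' \<and> live A c \<and> live A c')"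

text \<open>Descend from \<open>c\<close>: as long as the current vertex is outside
  \<open>A\<close>, meet closure leaves just one live kid to descend into, so nothing of
  \<open>A\<close> is lost.\<close>

lemma live_top:
  assumes "meet_closed A" "c \<in> V" "live A c"
  shows "\<exists>y\<in>A \<inter> sub c. \<forall>z\<in>A \<inter> sub c. anc y z"
  using assms(2,3)
proof (induction "card (sub c)" arbitrary: c rule: less_induct)
  case less
  show ?case
  proof (cases "c \<in> A")
    case True
    then show ?thesis using less.prems sub_self by (auto simp: sub_def)
  next
    case False
    then have Ac: "A \<inter> sub c = (\<Union>d\<in>kids c. A \<inter> sub d)" using sub_unfold[OF less.prems(1)] by auto
    then obtain d where d: "d \<in> kids c" "live A d" using less.prems(2) by (auto simp: live_def)
    have "A \<inter> sub d' = {}" if "d' \<in> kids c" "d' \<noteq> d" for d'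
      using assms(1) d that False by (auto simp: meet_closed_def live_def)
    then have "A \<inter> sub c = A \<inter> sub d" using Ac d(1) by blast
    moreover have "card (sub d) < card (sub c)" by (rule psubset_card_mono[OF finite_sub kids_sub_less[OF d(1)]])
    ultimately show ?thesis using less.hyps[of d] d kidsD by auto
  qed
qed

text \<open>The topmost vertex \<open>y\<close> of the branch at \<open>c\<close> is the child: a
  vertex of \<open>A\<close> strictly between \<open>w\<close> and \<open>y\<close> would lie in
  \<open>sub c\<close> and hence below \<open>y\<close>. Each live kid thus accounts for exactly one
  child in the contraction.\<close>

lemma cov_child:
  assumes "meet_closed A" "A \<subseteq> V" "w \<in> A" "c \<in> kids w" "live A c"
  obtains y where "cov A w y" "y \<in> sub c" "\<And>z. cov A w z \<Longrightarrow> z \<in> sub c \<Longrightarrow> z = y"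
    "\<And>z. z \<in> A \<Longrightarrow> z \<in> sub c \<Longrightarrow> anc y z"
proof -
  have c: "c \<in> V" "anc w c" "w \<noteq> c" "w \<in> V" using kidsD[OF assms(4)] by blast+
  obtain y where y: "y \<in> A" "y \<in> sub c" "\<And>z. z \<in> A \<Longrightarrow> z \<in> sub c \<Longrightarrow> anc y z"
    using live_top[OF assms(1) c(1) assms(5)] by auto
  have yV: "y \<in> V" "anc c y" using y(2) by (auto simp: sub_def)
  have wy: "anc w y" using c(2) yV(2) anc_trans by blast
  have "w \<noteq> y" using c yV anc_antisym[of w c] by blast
  have "z = w \<or> z = y" if z: "z \<in> A" "anc w z" "anc z y" for z
  proof -
    have "z \<in> V" using z assms(2) by blast
    consider "anc c z" | "anc z c" using anc_linear z(3) yV(2) by blast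
    then show ?thesis
    proof cases
      case 1
      then have "anc y z" using y(3) z(1) \<open>z \<in> V\<close> by (simp add: sub_def)
      then show ?thesis using anc_antisym z(3) yV(1) by blast
    next
      case 2
      then have "z = c \<or> anc z w" using anc_step kidsD[OF assms(4)] by metis
      then show ?thesis
      proof
        assume "z = c"
        then have "anc y z" using y(3) z(1) \<open>z \<in> V\<close> by (simp add: sub_def)
        then show ?thesis using anc_antisym z(3) yV(1) by blast
      next
        assume "anc z w" then show ?thesis using anc_antisym z(2) c(4) by blast
      qed
    qed
  qed
  then have cov: "cov A w y" using assms(3) y(1) wy \<open>w \<noteq> y\<close> by (auto simp: cov_def)
  have "z = y" if "cov A w z" "z \<in> sub c" for z
    using cov_between[OF that(1) y(1) wy] y(3)[of z] that covD[OF that(1)] \<open>w \<noteq> y\<close> by blast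
  with that cov y show thesis by blast
qed

lemma cov_in_kid:
  assumes "cov A w z" "A \<subseteq> V"
  shows "\<exists>c\<in>kids w. z \<in> sub c \<and> live A c"
proof -
  have "z \<in> sub w" "w \<in> V" "w \<noteq> z" using covD[OF assms(1)] assms(2) by (auto simp: sub_def)
  then show ?thesis using sub_unfold[of w] covD[OF assms(1)] by (auto simp: live_def)
qed

text \<open>\<open>kids\<close> refers to the original tree, \<open>branching\<close> to what is
  left of it. A vertex other than the root is either an original leaf or has at least two children
  besides its parent; the root is exempt because in \<open>rooted_tree\<close> it has at most one
  kid.\<close>

definition normal :: "'a set \<Rightarrow> bool" where
  "normal A \<longleftrightarrow> (\<forall>w\<in>A. w \<noteq> r \<longrightarrow> kids w = {} \<or> branching A w)"

text \<open>The state before smoothing: degree 2 may occur, but an inner vertex of the original tree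
  has not become a leaf.\<close>

definition prenormal :: "'a set \<Rightarrow> bool" where
  "prenormal A \<longleftrightarrow> r \<in> A \<and> A \<subseteq> V \<and> meet_closed A \<and>
     (\<forall>w\<in>A. w \<noteq> r \<longrightarrow> kids w = {} \<or> (\<exists>c\<in>kids w. live A c))"

text \<open>A vertex with exactly one live kid has one parent \<open>x\<close> and one child
  \<open>y\<close> in the contraction; once it is omitted, \<open>x\<close> covers \<open>y\<close>,
  and the other covers among the remaining vertices are unchanged.\<close>

lemma smooth_contraction:
  assumes "prenormal A" "q \<in> A" "q \<noteq> r" "kids q \<noteq> {}" "\<not> branching A q"
  shows "smooth_step (contraction A) (contraction (A - {q}))" "prenormal (A - {q})"
proof -
  have A: "r \<in> A" "A \<subseteq> V" "meet_closed A" using assms(1) by (auto simp: prenormal_def)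
  obtain c where c: "c \<in> kids q" "live A c" using assms(1-4) by (auto simp: prenormal_def)
  obtain y where y: "cov A q y" "y \<in> sub c" "\<And>z. cov A q z \<Longrightarrow> z \<in> sub c \<Longrightarrow> z = y"
    using cov_child[OF A(3,2) assms(2) c] by metis
  have kid: "z = y" if "cov A q z" for z
  proof -
    obtain d where d: "d \<in> kids q" "z \<in> sub d" "live A d" using cov_in_kid[OF \<open>cov A q z\<close> A(2)] by blast
    then have "d = c" using assms(5) c unfolding branching_def by blast
    then show ?thesis using d y(3) that by blast
  qed
  obtain x where x: "cov A x q" using cov_parent_exists[OF assms(2,3) A(1,2)] by blast
  have xq: "x \<in> A" "anc x q" "x \<noteq> q" and qy: "y \<in> A" "anc q y" "q \<noteq> y" using covD[OF x] covD[OF y(1)] by auto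
  have V: "x \<in> V" "q \<in> V" "y \<in> V" using xq qy assms(2) A(2) by auto
  have "x \<noteq> y" using anc_antisym[of x q] xq qy V by blast
  have nbrs: "nbrs (contraction A) q = {x, y}"
  proof -
    have "{w. cov A q w} = {y}" using kid y(1) by blast
    moreover have "{w. cov A w q} = {x}" using x cov_parent_unique by blast
    ultimately show ?thesis unfolding nbrs_contraction by auto
  qed
  have xy: "cov (A - {q}) x y"
  proof -
    have "z = x \<or> z = y" if z: "z \<in> A" "z \<noteq> q" "anc x z" "anc z y" for z
      using anc_linear[OF z(4) qy(2)] cov_between[OF x z(1,3)] cov_between[OF y(1) z(1) _ z(4)] z(2) by blast
    then show ?thesis using xq qy \<open>x \<noteq> y\<close> anc_trans[OF xq(2) qy(2)] by (auto simp: cov_def)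
  qed
  \<comment> \<open>A pair that covers only after the omission has \<open>q\<close> strictly between
    and nothing else, so it consists of the parent and the child of \<open>q\<close>.\<close>
  have cov_iff: "cov (A - {q}) v w \<longleftrightarrow> cov A v w \<and> v \<noteq> q \<and> w \<noteq> q \<or> v = x \<and> w = y" for v w
  proof
    assume L: "cov (A - {q}) v w"
    show "cov A v w \<and> v \<noteq> q \<and> w \<noteq> q \<or> v = x \<and> w = y"
    proof (cases "cov A v w")
      case False
      have vw: "v \<in> A" "w \<in> A" "anc v w" "v \<noteq> w" "v \<noteq> q" "w \<noteq> q" using covD[OF L] by auto
      then have qb: "anc v q" "anc q w" using False L by (auto simp: cov_def)
      have "z = v \<or> z = q" if z: "z \<in> A" "anc v z" "anc z q" for z
      proof (rule ccontr)
        assume ne: "\<not> ?thesis"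
        then have "z = w" using cov_between[OF L _ z(2)] anc_trans[OF z(3) qb(2)] z(1) by blast
        then show False using anc_antisym[of w q] z(3) qb(2) V(2) vw(6) by blast
      qed
      then have "cov A v q" using vw(1,5) qb(1) assms(2) unfolding cov_def by blast
      moreover have "z = q \<or> z = w" if z: "z \<in> A" "anc q z" "anc z w" for z
      proof (rule ccontr)
        assume ne: "\<not> ?thesis"
        then have "z = v" using cov_between[OF L _ _ z(3)] anc_trans[OF qb(1) z(2)] z(1) by blast
        then show False using anc_antisym[of v q] z(2) qb(1) V(2) vw(5) by blast
      qed
      then have "cov A q w" using vw(2,6) qb(2) assms(2) unfolding cov_def by blast
      ultimately show ?thesis using kid cov_parent_unique[OF _ x] by blast
    qed (use covD[OF L] in auto)
  next
    assume "cov A v w \<and> v \<noteq> q \<and> w \<noteq> q \<or> v = x \<and> w = y"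
    then show "cov (A - {q}) v w"
    proof
      assume "cov A v w \<and> v \<noteq> q \<and> w \<noteq> q"
      then show ?thesis unfolding cov_def by blast
    qed (use xy in simp)
  qed
  have "contraction (A - {q}) = smooth (contraction A) q x y"
    unfolding smooth_def remove_verts_def contraction_def cov_iff by auto
  then show "smooth_step (contraction A) (contraction (A - {q}))"
    unfolding smooth_step_iff using nbrs \<open>x \<noteq> y\<close> assms(2)
    by (intro exI[of _ q] exI[of _ x] exI[of _ y]) simp
  \<comment> \<open>Every branch containing \<open>q\<close> also contains \<open>y\<close>, so no
    branch dies.\<close>
  have live: "live (A - {q}) d \<longleftrightarrow> live A d" for d
  proof
    assume "live A d"
    then obtain z where z: "z \<in> A" "z \<in> sub d" by (auto simp: live_def)
    show "live (A - {q}) d"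
    proof (cases "z = q")
      case True
      then have "y \<in> sub d" using z(2) qy(2) V(3) anc_trans by (auto simp: sub_def)
      then show ?thesis using qy by (auto simp: live_def)
    qed (use z in \<open>auto simp: live_def\<close>)
  qed (auto simp: live_def)
  have "w \<noteq> q" if "d \<in> kids w" "d' \<in> kids w" "d \<noteq> d'" "live A d" "live A d'" for w d d'
    using that assms(5) by (auto simp: branching_def)
  then show "prenormal (A - {q})"
    using assms(1,3) by (auto simp: prenormal_def meet_closed_def live)
qed

text \<open>Induction on the size of \<open>A\<close>. The final conjunct records that leaves of the
  original tree are never smoothed away.\<close>

lemma smooth_to_normal:
  assumes "prenormal A"
  shows "\<exists>A'\<subseteq>A. smooth_step\<^sup>*\<^sup>* (contraction A) (contraction A') \<and> prenormal A' \<and> normal A' \<and>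
    (\<forall>w\<in>A - A'. kids w \<noteq> {})"
  using assms
proof (induction "card A" arbitrary: A rule: less_induct)
  case less
  show ?case
  proof (cases "normal A")
    case True then show ?thesis using less.prems by auto
  next
    case False
    then obtain q where q: "q \<in> A" "q \<noteq> r" "kids q \<noteq> {}" "\<not> branching A q" by (auto simp: normal_def)
    note s = smooth_contraction[OF less.prems q]
    have "finite A" using less.prems finite_V finite_subset by (auto simp: prenormal_def)
    then have "card (A - {q}) < card A" using q(1) by (rule card_Diff1_less)
    from less.hyps[OF this s(2)] obtain A' where A': "A' \<subseteq> A - {q}"
      "smooth_step\<^sup>*\<^sup>* (contraction (A - {q})) (contraction A')" "prenormal A'" "normal A'"
      "\<forall>w\<in>A - {q} - A'. kids w \<noteq> {}" by auto
    then show ?thesis using s(1) q(3) converse_rtranclp_into_rtranclp[of smooth_step]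
      by (intro exI[of _ A']) auto
  qed
qed

end

section \<open>Bottom-up execution of the algorithm\<close>

locale rooted_tree = rooted +
  fixes T :: "'a pair_pre_digraph"
  assumes root_kids: "c \<in> kids r \<Longrightarrow> c' \<in> kids r \<Longrightarrow> c = c'"
    and T_contraction: "T = contraction V"
begin

lemma cov_asym: "cov A x w \<Longrightarrow> cov A w y \<Longrightarrow> A \<subseteq> V \<Longrightarrow> x \<noteq> y"
  using anc_antisym[of x w] covD[of A x w] covD[of A w y] by blast

lemma finite_contraction_nbrs:
  assumes "A \<subseteq> V"
  shows "finite (nbrs (contraction A) w)"
  by (rule finite_subset[OF _ finite_subset[OF assms finite_V]])
    (use covD in \<open>auto simp: nbrs_contraction\<close>)

lemma root_nbrs:
  assumes "A \<subseteq> V" "meet_closed A" "z \<in> nbrs (contraction A) r" "z' \<in> nbrs (contraction A) r"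
  shows "z = z'"
proof -
  have z: "cov A r z" "cov A r z'" using assms(3,4) cov_root by (auto simp: nbrs_contraction)
  obtain c where c: "c \<in> kids r" "z \<in> sub c" "live A c" using cov_in_kid[OF z(1) assms(1)] by blast
  obtain c' where c': "c' \<in> kids r" "z' \<in> sub c'" using cov_in_kid[OF z(2) assms(1)] by blast
  have "c' = c" using root_kids[OF c'(1) c(1)] .
  moreover have "r \<in> A" using covD[OF z(1)] by blast
  from cov_child[OF assms(2,1) this c(1,3)] obtain y
    where "\<And>z. cov A r z \<Longrightarrow> z \<in> sub c \<Longrightarrow> z = y" by metis
  ultimately show ?thesis using z c(2) c'(2) by blast
qed

text \<open>The root has degree at most 1, an original leaf only its parent, and a branching vertex
  its parent and at least two children.\<close>

lemma degree_normal:
  assumes "normal A" "prenormal A" "w \<in> A"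
  shows "out_degree (with_proj (contraction A)) w \<noteq> 2"
proof -
  have A: "r \<in> A" "A \<subseteq> V" "meet_closed A" using assms(2) by (auto simp: prenormal_def)
  let ?N = "nbrs (contraction A) w"
  have fin: "finite ?N" using finite_contraction_nbrs[OF A(2)] .
  have "card ?N \<noteq> 2"
  proof (cases "w = r")
    case True
    then have "card ?N \<le> Suc 0" unfolding card_le_Suc0_iff_eq[OF fin] using root_nbrs[OF A(2,3)] by blast
    then show ?thesis by simp
  next
    case False
    obtain x where x: "cov A x w" using cov_parent_exists[OF assms(3) False A(1,2)] by blast
    from assms(1,3) False consider "kids w = {}" | "branching A w" by (auto simp: normal_def)
    then show ?thesis
    proof cases
      case 1
      then have "{z. cov A w z} = {}" using cov_in_kid[OF _ A(2)] by blast
      moreover have "{v. cov A v w} = {x}" using x cov_parent_unique by blast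
      ultimately have "?N = {x}" unfolding nbrs_contraction by blast
      then show ?thesis by simp
    next
      case 2
      then obtain c c' where c: "c \<in> kids w" "c' \<in> kids w" "c \<noteq> c'" "live A c" "live A c'"
        unfolding branching_def by blast
      obtain y where y: "cov A w y" "y \<in> sub c" using cov_child[OF A(3,2) assms(3) c(1,4)] by metis
      obtain y' where y': "cov A w y'" "y' \<in> sub c'" using cov_child[OF A(3,2) assms(3) c(2,5)] by metis
      have "y \<noteq> y'" using kids_disjoint[OF c(1-3)] y(2) y'(2) by blast
      moreover have "x \<noteq> y" "x \<noteq> y'" using cov_asym[OF x] y(1) y'(1) A(2) by blast+
      ultimately have "card {x, y, y'} = 3" by simp
      moreover have "{x, y, y'} \<subseteq> ?N" using x y(1) y'(1) by (simp add: nbrs_contraction)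
      ultimately show ?thesis using card_mono[OF fin, of "{x, y, y'}"] by simp
    qed
  qed
  then show ?thesis by (simp add: card_nbrs)
qed

text \<open>
  \<open>D\<close> is the set of processed vertices. The last condition says that at most one pending leaf is
  left below a processed vertex. \<open>A\<close> becomes empty when \<open>r\<close> itself is a leaf neighbour of the
  deleted vertex.
\<close>

definition sweep_inv :: "'a set \<Rightarrow> 'a set \<Rightarrow> 'a set list \<Rightarrow> bool" where
  "sweep_inv D A \<Psi> \<longleftrightarrow> gp_reachable T (contraction A, \<Psi>) \<and> D \<subseteq> V - {r} \<and> (\<forall>v\<in>D. kids v \<subseteq> D) \<and>
     (A = {} \<or> prenormal A \<and> normal A) \<and> (\<forall>w\<in>V - D. w \<noteq> r \<and> kids w = {} \<longrightarrow> w \<in> A) \<and>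
     (\<forall>v\<in>D. \<forall>x\<in>A \<inter> sub v. \<forall>y\<in>A \<inter> sub v. x = y)"

lemma is_SM_normal:
  assumes "smooth_step\<^sup>*\<^sup>* G (contraction A)" "prenormal A" "normal A"
  shows "is_SM G (contraction A)"
  using assms degree_normal by (simp add: is_SM_def)

lemma sweep_start: "\<exists>A. sweep_inv {} A []"
proof -
  have live: "live V c" if "c \<in> V" for c using that sub_self by (auto simp: live_def)
  have "w \<in> V" if "c \<in> kids w" for c w using kidsD[OF that] by blast
  then have "meet_closed V" unfolding meet_closed_def by blast
  moreover have "kids w = {} \<or> (\<exists>c\<in>kids w. live V c)" for w using live kidsD by blast
  ultimately have "prenormal V" using r_V by (simp add: prenormal_def)
  from smooth_to_normal[OF this] obtain A where A: "A \<subseteq> V"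
    "smooth_step\<^sup>*\<^sup>* (contraction V) (contraction A)" "prenormal A" "normal A" "\<forall>w\<in>V - A. kids w \<noteq> {}" by blast
  have "is_SM T (contraction A)" using is_SM_normal A(2-4) T_contraction by simp
  then have "gp_reachable T (contraction A, [])"
    by (auto simp: gp_reachable_def gp_start_def)
  then show ?thesis using A unfolding sweep_inv_def by blast
qed

lemma sub_subset_processed:
  assumes "\<forall>v\<in>D. kids v \<subseteq> D" "v \<in> V" "kids v \<subseteq> D"
  shows "sub v \<subseteq> insert v D"
  using assms(2,3)
proof (induction "card (sub v)" arbitrary: v rule: less_induct)
  case less
  have "sub c \<subseteq> D" if "c \<in> kids v" for c
  proof -
    have "card (sub c) < card (sub v)" by (rule psubset_card_mono[OF finite_sub kids_sub_less[OF that]])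
    moreover have "c \<in> V" "c \<in> D" "kids c \<subseteq> D" using kidsD[OF that] that less.prems assms(1) by blast+
    ultimately show ?thesis using less.hyps[of c] by blast
  qed
  then show ?case using sub_unfold[OF less.prems(1)] by blast
qed

lemma sweep_insert:
  assumes "sweep_inv D A \<Psi>" "v \<in> V - D" "v \<noteq> r" "kids v \<subseteq> D"
    "\<And>x y. x \<in> A \<inter> sub v \<Longrightarrow> y \<in> A \<inter> sub v \<Longrightarrow> x = y"
  shows "sweep_inv (insert v D) A \<Psi>"
proof -
  have p: "gp_reachable T (contraction A, \<Psi>)" "A = {} \<or> prenormal A \<and> normal A"
    and D: "D \<subseteq> V - {r}" "\<forall>v\<in>D. kids v \<subseteq> D"
    and childless: "\<forall>w\<in>V - D. w \<noteq> r \<and> kids w = {} \<longrightarrow> w \<in> A"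
    and single: "\<forall>v\<in>D. \<forall>x\<in>A \<inter> sub v. \<forall>y\<in>A \<inter> sub v. x = y"
    using assms(1) unfolding sweep_inv_def by simp_all
  have "insert v D \<subseteq> V - {r}" using D(1) assms(2,3) by blast
  moreover have "\<forall>w\<in>insert v D. kids w \<subseteq> insert v D" using D(2) assms(4) by blast
  moreover have "\<forall>w\<in>V - insert v D. w \<noteq> r \<and> kids w = {} \<longrightarrow> w \<in> A" using childless by blast
  moreover have "\<forall>w\<in>insert v D. \<forall>x\<in>A \<inter> sub w. \<forall>y\<in>A \<inter> sub w. x = y"
    using single assms(5) by (metis insertE)
  ultimately show ?thesis using p unfolding sweep_inv_def by (intro conjI)
qed

lemma sweep_leaf:
  assumes "sweep_inv D A \<Psi>" "v \<in> V - D" "v \<noteq> r" "kids v = {}"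
  shows "sweep_inv (insert v D) A \<Psi>" "A \<inter> sub v = {v}"
proof -
  have "\<forall>w\<in>V - D. w \<noteq> r \<and> kids w = {} \<longrightarrow> w \<in> A" using assms(1) unfolding sweep_inv_def by (elim conjE)
  then have "v \<in> A" using assms(2-4) by blast
  moreover have "sub v = {v}" using sub_unfold[of v] assms(2,4) by blast
  ultimately show "A \<inter> sub v = {v}" by blast
  then have "x = y" if "x \<in> A \<inter> sub v" "y \<in> A \<inter> sub v" for x y using that by simp
  then show "sweep_inv (insert v D) A \<Psi>" using sweep_insert[OF assms(1-3)] assms(4) by blast
qed

text \<open>By normality \<open>v\<close> is not in \<open>A\<close>, so the run makes no step here,
  and what is pending at \<open>v\<close> is what its only live kid, if any, has pending.\<close>

lemma sweep_pass:
  assumes "sweep_inv D A \<Psi>" "v \<in> V - D" "v \<noteq> r" "kids v \<noteq> {}" "kids v \<subseteq> D" "\<not> branching A v"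
  shows "sweep_inv (insert v D) A \<Psi>" "A \<inter> sub v = (\<Union>c\<in>kids v. A \<inter> sub c)"
proof -
  have inv: "A = {} \<or> prenormal A \<and> normal A" "\<forall>v\<in>D. \<forall>x\<in>A \<inter> sub v. \<forall>y\<in>A \<inter> sub v. x = y"
    using assms(1) unfolding sweep_inv_def by simp_all
  have "v \<notin> A"
  proof
    assume "v \<in> A"
    then have "normal A" using inv(1) by blast
    then have "kids v = {} \<or> branching A v" using \<open>v \<in> A\<close> assms(3) by (simp add: normal_def)
    then show False using assms(4,6) by blast
  qed
  moreover have "sub v = insert v (\<Union>c\<in>kids v. sub c)" using sub_unfold assms(2) by simp
  ultimately show sub: "A \<inter> sub v = (\<Union>c\<in>kids v. A \<inter> sub c)" by simp
  have "x = y" if xy: "x \<in> A \<inter> sub v" "y \<in> A \<inter> sub v" for x y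
  proof -
    obtain c c' where c: "c \<in> kids v" "c' \<in> kids v" "x \<in> A \<inter> sub c" "y \<in> A \<inter> sub c'" using xy unfolding sub by (elim UN_E)
    then have "c = c'" using assms(6) unfolding branching_def live_def by blast
    moreover have "c \<in> D" using c(1) assms(5) by blast
    ultimately show ?thesis using c(3,4) inv(2) by blast
  qed
  then show "sweep_inv (insert v D) A \<Psi>" by (rule sweep_insert[OF assms(1-3,5)])
qed

lemma kid_not_sub:
  assumes "c \<in> kids v"
  shows "v \<notin> sub c"
  using kidsD[OF assms] anc_antisym[of c v] by (auto simp: sub_def)

text \<open>The vertices deleted from \<open>A\<close> never lie above kept ones, so none of them
  separates two kept ones and no new cover arises.\<close>

lemma contraction_remove:
  assumes "\<And>x. x \<in> A - B \<Longrightarrow> x \<in> C" "\<And>x. x \<in> C \<Longrightarrow> x \<notin> B" "B \<subseteq> A"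
    and "\<And>z x. z \<in> A - B \<Longrightarrow> x \<in> B \<Longrightarrow> \<not> anc z x"
  shows "remove_verts (contraction A) C = contraction B"
proof -
  have "cov B v w \<longleftrightarrow> cov A v w \<and> v \<in> B \<and> w \<in> B" for v w
    unfolding cov_def using assms(3,4) by blast
  moreover have "v \<in> A \<and> v \<notin> C \<longleftrightarrow> v \<in> B" for v using assms(1-3) by blast
  moreover have "cov A v w \<Longrightarrow> v \<in> A \<and> w \<in> A" for v w using covD by blast
  ultimately show ?thesis unfolding remove_verts_def contraction_def by auto blast+
qed

text \<open>A branch point outside \<open>sub v\<close> has two live kids, and the cut affects the
  branch of at most one of them, so no inner vertex becomes a leaf. It may be left with a single
  live kid, hence the result is only prenormal.\<close>

lemma prenormal_remove_sub:
  assumes "prenormal A" "normal A" "v \<in> V" "v \<noteq> r"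
  shows "prenormal (A - sub v)"
proof -
  have A: "r \<in> A" "A \<subseteq> V" "meet_closed A" using assms(1) by (auto simp: prenormal_def)
  have "v \<notin> sub r \<or> r \<notin> sub v" using anc_of_root[of v] assms(4) by (auto simp: sub_def)
  then have "r \<notin> sub v" using sub_root assms(3) by blast
  have live_mono: "live (A - sub v) c \<Longrightarrow> live A c" for c by (auto simp: live_def)
  have not_live: "\<not> live (A - sub v) c" if "c \<in> kids w" "w \<in> sub v" for c w
  proof -
    have "anc v c" using kidsD[OF that(1)] that(2) anc_trans by (auto simp: sub_def)
    then show ?thesis using sub_mono by (auto simp: live_def)
  qed
  have "meet_closed (A - sub v)"
    using A(3) live_mono not_live unfolding meet_closed_def by blast
  moreover have "\<exists>c\<in>kids w. live (A - sub v) c" if w: "w \<in> A - sub v" "w \<noteq> r" "kids w \<noteq> {}" for w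
  proof -
    have "branching A w" using assms(2) w unfolding normal_def by blast
    then obtain c c' where c: "c \<in> kids w" "c' \<in> kids w" "c \<noteq> c'" "live A c" "live A c'"
      unfolding branching_def by blast
    have keep: "live (A - sub v) d" if d: "d \<in> kids w" "live A d" "v \<notin> sub d" for d
    proof -
      have "sub d \<inter> sub v = {}"
      proof (rule ccontr)
        assume "sub d \<inter> sub v \<noteq> {}"
        then obtain z where "anc d z" "anc v z" by (auto simp: sub_def)
        then have "anc v d" using anc_linear d(3) assms(3) by (auto simp: sub_def)
        moreover have "v \<noteq> d" using d(3) assms(3) sub_self by blast
        ultimately have "anc v w" using anc_step kidsD[OF d(1)] by metis
        then show False using w(1) kidsD[OF d(1)] by (simp add: sub_def)
      qed
      then show ?thesis using d(2) by (auto simp: live_def)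
    qed
    show ?thesis
    proof (cases "v \<in> sub c")
      case True
      then have "v \<notin> sub c'" using kids_disjoint[OF c(1-3)] by blast
      then show ?thesis using keep c by blast
    qed (use keep c in blast)
  qed
  ultimately show ?thesis using A \<open>r \<notin> sub v\<close> unfolding prenormal_def by blast
qed

text \<open>Two live kids force \<open>v\<close> into \<open>A\<close> by meet closure. As each
  processed kid has at most one pending leaf, the children of \<open>v\<close> in the contraction,
  collected in \<open>U\<close>, are all leaves, and \<open>v\<close> is an end support vertex. The
  deletion then cuts out exactly \<open>sub v\<close>, unless the parent \<open>q\<close> is a leaf
  as well.\<close>

lemma sweep_branch:
  assumes inv: "sweep_inv D A \<Psi>" and v: "v \<in> V - D" "v \<noteq> r" "kids v \<subseteq> D"
    and c: "c1 \<in> kids v" "c2 \<in> kids v" "c1 \<noteq> c2" and u: "u1 \<in> A \<inter> sub c1" "u2 \<in> A \<inter> sub c2"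
  shows "\<exists>A'. sweep_inv (insert v D) A' (\<Psi> @ [{u1, u2}]) \<and> A' \<inter> sub v = {} \<and>
    (\<forall>d\<in>D. d \<notin> sub v \<longrightarrow> A' \<inter> sub d = A \<inter> sub d)"
proof -
  have reach: "gp_reachable T (contraction A, \<Psi>)" and D: "D \<subseteq> V - {r}" "\<forall>v\<in>D. kids v \<subseteq> D"
    and A: "prenormal A" "normal A"
    and childless: "\<And>w. w \<in> V - D \<Longrightarrow> w \<noteq> r \<Longrightarrow> kids w = {} \<Longrightarrow> w \<in> A"
    and single: "\<And>v x y. v \<in> D \<Longrightarrow> x \<in> A \<inter> sub v \<Longrightarrow> y \<in> A \<inter> sub v \<Longrightarrow> x = y"
    using inv u unfolding sweep_inv_def by blast+
  have A': "r \<in> A" "A \<subseteq> V" "meet_closed A" using A(1) by (auto simp: prenormal_def)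
  have vV: "v \<in> V" using v by blast
  have live: "live A c1" "live A c2" using u by (auto simp: live_def)
  have vA: "v \<in> A" using A'(3) c live unfolding meet_closed_def by blast
  have sub_D: "sub v \<subseteq> insert v D" using sub_subset_processed[OF D(2) vV v(3)] .
  have r_sub: "r \<notin> sub v" using sub_D D(1) v(2) by blast
  define U where "U = A \<inter> sub v - {v}"
  have U_kid: "\<exists>c\<in>kids v. x \<in> sub c" if "x \<in> U" for x using that sub_unfold[OF vV] by (auto simp: U_def)
  have U_single: "z = x" if x: "x \<in> U" and z: "z \<in> A" "anc x z" for x z
  proof -
    obtain c where c: "c \<in> kids v" "x \<in> sub c" using U_kid[OF x] by blast
    have "z \<in> sub c" using c(2) z A'(2) anc_trans by (auto simp: sub_def)
    then show ?thesis using single[of c z x] c v(3) z(1) x by (auto simp: U_def)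
  qed
  have U_cov: "cov A v x" if x: "x \<in> U" for x
  proof -
    obtain c where c: "c \<in> kids v" "x \<in> sub c" using U_kid[OF x] by blast
    have lc: "live A c" using c(2) x by (auto simp: live_def U_def)
    obtain y where y: "cov A v y" "y \<in> sub c" using cov_child[OF A'(3,2) vA c(1) lc] by metis
    have "y = x" using single[of c y x] c v(3) x y covD[OF y(1)] by (auto simp: U_def)
    then show ?thesis using y by simp
  qed
  have cov_U: "x \<in> U" if "cov A v x" for x
    using covD[OF that] A'(2) by (auto simp: U_def sub_def)
  have kids_v: "{x. cov A v x} = U" using U_cov cov_U by blast
  obtain q where q: "cov A q v" using cov_parent_exists[OF vA v(2) A'(1,2)] by blast
  have nbrs_v: "nbrs (contraction A) v = insert q U"
    using kids_v q cov_parent_unique[of A] unfolding nbrs_contraction by blast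
  have "nbrs (contraction A) x = {v}" if x: "x \<in> U" for x
  proof -
    have "\<not> cov A x z" for z using U_single[OF x] covD by metis
    then show ?thesis using U_cov[OF x] cov_parent_unique[of A] unfolding nbrs_contraction by blast
  qed
  then have U_leaf: "leaf (contraction A) x" if "x \<in> U" for x
    using that by (simp add: leaf_iff U_def)
  have uU: "u1 \<in> U" "u2 \<in> U"
    using u kids_sub_less[OF c(1)] kids_sub_less[OF c(2)] kid_not_sub[OF c(1)] kid_not_sub[OF c(2)]
    unfolding U_def by blast+
  have u12: "u1 \<noteq> u2" using kids_disjoint[OF c] u by blast
  let ?T = "contraction A"
  have L: "leaf_nbrs ?T v = (if leaf ?T q then insert q U else U)"
    using U_leaf by (auto simp: leaf_nbrs_def nbrs_v)
  have guard: "gp_guard (?T, \<Psi>)"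
  proof -
    have "card {v, u1, u2} = 3" using u12 uU by (auto simp: U_def)
    moreover have "card {v, u1, u2} \<le> card A"
      using vA uU by (intro card_mono finite_subset[OF A'(2) finite_V]) (auto simp: U_def)
    ultimately show ?thesis by (simp add: gp_guard_def)
  qed
  have end_supp: "end_support_vertex ?T v"
  proof -
    have "{w \<in> nbrs ?T v. \<not> leaf ?T w} \<subseteq> {q}" using U_leaf by (auto simp: nbrs_v)
    then have "card {w \<in> nbrs ?T v. \<not> leaf ?T w} \<le> 1" using card_mono[of "{q}"] by fastforce
    moreover have "u1 \<in> leaf_nbrs ?T v" using uU L by auto
    ultimately show ?thesis using vA by (auto simp: end_support_vertex_def support_vertex_def)
  qed
  have step: "gp_reachable T (T', \<Psi> @ [{u1, u2}])"
    if "is_SM (remove_verts ?T (insert v (leaf_nbrs ?T v))) T'" for T'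
  proof -
    have "gp_step (?T, \<Psi>) (T', \<Psi> @ [{u1, u2}])"
      using gp_step.intros[OF guard end_supp _ _ u12 that] uU L by auto
    then show ?thesis using reach unfolding gp_reachable_def by (meson rtranclp.rtrancl_into_rtrancl)
  qed
  \<comment> \<open>Processed vertices are closed under descendants, so a processed \<open>d\<close>
    is not an ancestor of the unprocessed \<open>v\<close>, and the two subtrees are
    disjoint.\<close>
  have other: "sub d \<inter> sub v = {}" if "d \<in> D" "d \<notin> sub v" for d
  proof (rule ccontr)
    assume "sub d \<inter> sub v \<noteq> {}"
    then obtain z where "anc d z" "anc v z" by (auto simp: sub_def)
    then have "anc d v" using anc_linear that D(1) by (auto simp: sub_def)
    then have "v \<in> sub d" using vV by (simp add: sub_def)
    then have "v \<in> insert d D" using sub_subset_processed[OF D(2), of d] that(1) D by blast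
    then show False using that vV sub_self v(1) by blast
  qed
  show ?thesis
  proof (cases "leaf ?T q")
    \<comment> \<open>A leaf parent has no neighbour but \<open>v\<close>, so it is the root and the
      whole graph is a star around \<open>v\<close>; the deletion leaves the empty graph.\<close>
    case True
    have qA: "q \<in> A" "q \<noteq> v" "anc q v" using covD[OF q] by auto
    have "v \<in> nbrs ?T q" using q by (simp add: nbrs_contraction)
    then have nq: "nbrs ?T q = {v}" using True by (auto elim: leafE)
    have "q = r"
    proof (rule ccontr)
      assume "q \<noteq> r"
      then obtain x where x: "cov A x q" using cov_parent_exists[OF qA(1) _ A'(1,2)] by blast
      then have "x = v" using nq by (auto simp: nbrs_contraction)
      then show False using cov_asym[OF x q A'(2)] by blast
    qed
    have A_sub: "w \<in> sub v" if w: "w \<in> A" "w \<noteq> r" for w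
    proof -
      have "w \<in> sub r" using w A'(2) sub_root by blast
      then obtain d where d: "d \<in> kids r" "w \<in> sub d" using sub_unfold[OF r_V] w(2) by blast
      then have "live A d" using w(1) by (auto simp: live_def)
      then obtain z where z: "cov A r z" "\<And>w. w \<in> A \<Longrightarrow> w \<in> sub d \<Longrightarrow> anc z w"
        using cov_child[OF A'(3,2,1) d(1)] by metis
      have "z = v" using z(1) nq \<open>q = r\<close> by (auto simp: nbrs_contraction)
      then show ?thesis using z(2)[OF w(1) d(2)] w(1) A'(2) by (auto simp: sub_def)
    qed
    have "A \<subseteq> insert v (leaf_nbrs ?T v)" using A_sub L True \<open>q = r\<close> by (auto simp: U_def)
    then have "remove_verts ?T (insert v (leaf_nbrs ?T v)) = contraction {}"
      by (intro contraction_remove) auto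
    moreover have "is_SM (contraction {}) (contraction {})" by (simp add: is_SM_def)
    ultimately have "gp_reachable T (contraction {}, \<Psi> @ [{u1, u2}])" using step by simp
    moreover have "False" if "w \<in> V - insert v D" "w \<noteq> r" "kids w = {}" for w
      using A_sub[OF childless] that sub_D by blast
    ultimately have "sweep_inv (insert v D) {} (\<Psi> @ [{u1, u2}])"
      using D v unfolding sweep_inv_def by blast
    moreover have "A \<inter> sub d = {}" if "d \<in> D" "d \<notin> sub v" for d
    proof -
      have "r \<notin> sub d" using anc_of_root[of d] that(1) D(1) by (auto simp: sub_def)
      then show ?thesis using A_sub other[OF that] by blast
    qed
    ultimately show ?thesis by (intro exI[of _ "{}"]) auto
  next
    case False
    let ?B = "A - sub v"
    have q_sub: "q \<notin> sub v" using covD[OF q] anc_antisym[of q v] vV by (auto simp: sub_def)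
    have rem: "remove_verts ?T (insert v (leaf_nbrs ?T v)) = contraction ?B"
    proof (rule contraction_remove)
      show "x \<in> insert v (leaf_nbrs ?T v)" if "x \<in> A - ?B" for x using that L by (auto simp: U_def)
      show "x \<notin> ?B" if "x \<in> insert v (leaf_nbrs ?T v)" for x
        using that L False sub_self[OF vV] by (auto simp: U_def)
      show "\<not> anc z x" if "z \<in> A - ?B" "x \<in> ?B" for z x
        using that A'(2) anc_trans[of v z x] by (auto simp: sub_def)
    qed auto
    obtain A'' where A'': "A'' \<subseteq> ?B" "smooth_step\<^sup>*\<^sup>* (contraction ?B) (contraction A'')"
      "prenormal A''" "normal A''" "\<forall>w\<in>?B - A''. kids w \<noteq> {}"
      using smooth_to_normal[OF prenormal_remove_sub[OF A vV v(2)]] by blast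
    have "gp_reachable T (contraction A'', \<Psi> @ [{u1, u2}])"
      using step is_SM_normal[OF A''(2-4)] rem by simp
    moreover have "w \<in> A''" if "w \<in> V - insert v D" "w \<noteq> r" "kids w = {}" for w
      using childless[of w] that sub_D A''(5) by blast
    moreover have "A'' \<inter> sub v = {}" using A''(1) by blast
    moreover have A_D: "x = y" if "d \<in> insert v D" "x \<in> A'' \<inter> sub d" "y \<in> A'' \<inter> sub d" for d x y
      using that single[of d x y] A''(1) by blast
    ultimately have "sweep_inv (insert v D) A'' (\<Psi> @ [{u1, u2}])"
      using D v A''(3,4) unfolding sweep_inv_def by blast
    \<comment> \<open>Smoothing does not touch the pending leaves elsewhere: a vertex smoothed away
      has kids, so by normality it had two live ones, but below a processed vertex at most one
      vertex of \<open>A\<close> is left.\<close>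
    moreover have "A'' \<inter> sub d = A \<inter> sub d" if d: "d \<in> D" "d \<notin> sub v" for d
    proof -
      have "z \<in> A''" if z: "z \<in> A" "z \<in> sub d" for z
      proof (rule ccontr)
        assume "z \<notin> A''"
        moreover have "z \<in> ?B" using z other[OF d] by blast
        ultimately have "kids z \<noteq> {}" using A''(5) by blast
        moreover have zD: "z \<in> D" using sub_subset_processed[OF D(2), of d] d(1) D z(2) by blast
        ultimately have "branching A z" using A(2) z(1) D(1) unfolding normal_def by blast
        then obtain e e' where e: "e \<in> kids z" "e' \<in> kids z" "e \<noteq> e'" "live A e" "live A e'"
          unfolding branching_def by blast
        obtain a a' where a: "a \<in> A \<inter> sub e" "a' \<in> A \<inter> sub e'" using e(4,5) unfolding live_def by blast
        then have "a = a'" using single[OF zD, of a a'] kids_sub_less[OF e(1)] kids_sub_less[OF e(2)] by blast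
        then show False using kids_disjoint[OF e(1-3)] a by blast
      qed
      then show ?thesis using A''(1) by blast
    qed
    moreover have "A'' \<inter> sub v = {}" using A''(1) by blast
    ultimately show ?thesis by blast
  qed
qed

text \<open>The root has at most one kid, and below it at most one vertex is left. So the final
  graph is the edge from \<open>r\<close> to \<open>u\<close>, or it has at most one vertex.\<close>

lemma sweep_finish:
  assumes "sweep_inv (V - {r}) A \<Psi>"
  shows "c \<in> kids r \<Longrightarrow> u \<in> A \<inter> sub c \<Longrightarrow> gp_returns T (\<Psi> @ [{r, u}])"
    and "\<forall>c\<in>kids r. A \<inter> sub c = {} \<Longrightarrow> gp_returns T \<Psi>"
proof -
  have reach: "gp_reachable T (contraction A, \<Psi>)" and AV: "A \<subseteq> V" "A = {} \<or> r \<in> A"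
    using assms unfolding sweep_inv_def prenormal_def by blast+
  have V: "\<exists>d\<in>kids r. x \<in> sub d" if "x \<in> A" "x \<noteq> r" for x
  proof -
    have "x \<in> sub r" using that AV(1) sub_root by blast
    then show ?thesis using sub_unfold[OF r_V] that(2) by blast
  qed
  show "gp_returns T (\<Psi> @ [{r, u}])" if c: "c \<in> kids r" and u: "u \<in> A \<inter> sub c"
  proof -
    have cD: "c \<in> V - {r}" using kidsD[OF c] by blast
    have "r \<notin> sub c" using anc_of_root[of c] cD by (auto simp: sub_def)
    then have "u \<noteq> r" using u by blast
    have "x = u" if "x \<in> A" "x \<noteq> r" for x
    proof -
      obtain d where "d \<in> kids r" "x \<in> sub d" using V[OF \<open>x \<in> A\<close> \<open>x \<noteq> r\<close>] by blast
      then have "x \<in> A \<inter> sub c" using root_kids[OF c] that(1) by blast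
      then show ?thesis using assms u cD unfolding sweep_inv_def by blast
    qed
    then have "A = {r, u}" using u AV(2) by blast
    then have "gp_output (contraction A, \<Psi>) = \<Psi> @ [{r, u}]" "\<not> gp_guard (contraction A, \<Psi>)"
      using \<open>u \<noteq> r\<close> by (auto simp: gp_output_def gp_guard_def)
    then show ?thesis using reach unfolding gp_returns_def by metis
  qed
  show "gp_returns T \<Psi>" if "\<forall>c\<in>kids r. A \<inter> sub c = {}"
  proof -
    have "A \<subseteq> {r}" using that V by blast
    then have "card A \<le> 1" using card_mono[of "{r}" A] by simp
    then have "gp_output (contraction A, \<Psi>) = \<Psi>" "\<not> gp_guard (contraction A, \<Psi>)"
      by (auto simp: gp_output_def gp_guard_def)
    then show ?thesis using reach unfolding gp_returns_def by metis
  qed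
qed

end

section \<open>A calculus for the machine\<close>

text \<open>Weakest preconditions for loop-free code. A \<open>While\<close> is sent to
  \<open>False\<close> because loops are treated only by \<open>runs_While\<close>, whose body must
  be loop-free.\<close>

primrec wp :: "nat \<Rightarrow> com \<Rightarrow> (mem \<Rightarrow> bool) \<Rightarrow> mem \<Rightarrow> bool" where
  "wp W Skip Q m \<longleftrightarrow> Q m"
| "wp W (Assign x e) Q m \<longleftrightarrow> fits W m e \<and> Q (m\<lparr>reg := (reg m)(x := val m e)\<rparr>)"
| "wp W (Store a i e) Q m \<longleftrightarrow> fits W m i \<and> fits W m e \<and>
     Q (m\<lparr>arr := (arr m)(a := (arr m a)(val m i := val m e))\<rparr>)"
| "wp W (Seq c\<^sub>1 c\<^sub>2) Q m \<longleftrightarrow> wp W c\<^sub>1 (wp W c\<^sub>2 Q) m"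
| "wp W (If e c\<^sub>1 c\<^sub>2) Q m \<longleftrightarrow> fits W m e \<and> (if val m e \<noteq> 0 then wp W c\<^sub>1 Q m else wp W c\<^sub>2 Q m)"
| "wp W (While e c) Q m \<longleftrightarrow> False"

text \<open>Adding the costs of both branches of an \<open>If\<close> keeps the bound a constant of
  the program text without taking maxima.\<close>

primrec steps :: "com \<Rightarrow> nat" where
  "steps Skip = 1"
| "steps (Assign x e) = cost e + 1"
| "steps (Store a i e) = cost i + cost e + 1"
| "steps (Seq c\<^sub>1 c\<^sub>2) = steps c\<^sub>1 + steps c\<^sub>2"
| "steps (If e c\<^sub>1 c\<^sub>2) = cost e + 1 + (steps c\<^sub>1 + steps c\<^sub>2)"
| "steps (While e c) = 0"

definition runs :: "nat \<Rightarrow> com \<Rightarrow> mem \<Rightarrow> nat \<Rightarrow> (mem \<Rightarrow> bool) \<Rightarrow> bool" where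
  "runs W c m k Q \<longleftrightarrow> (\<exists>t m'. exec W c m t m' \<and> t \<le> k \<and> Q m')"

lemma runs_wp: "wp W c Q m \<Longrightarrow> runs W c m (steps c) Q"
proof (induction c arbitrary: Q m)
  case Skip
  then show ?case using exec.Skip by (force simp: runs_def)
next
  case (Assign x e)
  then show ?case using exec.Assign[of W m e x] unfolding runs_def by force
next
  case (Store a i e)
  then show ?case using exec.Store[of W m i e a] unfolding runs_def by force
next
  case (Seq c1 c2)
  then have "wp W c1 (wp W c2 Q) m" by simp
  from Seq.IH(1)[OF this] obtain t m' where 1: "exec W c1 m t m'" "t \<le> steps c1" "wp W c2 Q m'"
    unfolding runs_def by blast
  from Seq.IH(2)[OF 1(3)] obtain t' m'' where 2: "exec W c2 m' t' m''" "t' \<le> steps c2" "Q m''"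
    unfolding runs_def by blast
  have "t + t' \<le> steps (Seq c1 c2)" using 1(2) 2(2) by simp
  then show ?case using exec.Seq[OF 1(1) 2(1)] 2(3) unfolding runs_def by blast
next
  case (If e c1 c2)
  then have fits: "fits W m e" by simp
  show ?case
  proof (cases "val m e = 0")
    case True
    then have "wp W c2 Q m" using If.prems by simp
    from If.IH(2)[OF this] obtain t m' where 1: "exec W c2 m t m'" "t \<le> steps c2" "Q m'"
      unfolding runs_def by blast
    have "cost e + 1 + t \<le> steps (If e c1 c2)" using 1(2) by simp
    then show ?thesis using exec.IfFalse[OF fits True 1(1)] 1(3) unfolding runs_def by blast
  next
    case False
    then have "wp W c1 Q m" using If.prems by simp
    from If.IH(1)[OF this] obtain t m' where 1: "exec W c1 m t m'" "t \<le> steps c1" "Q m'"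
      unfolding runs_def by blast
    have "cost e + 1 + t \<le> steps (If e c1 c2)" using 1(2) by simp
    then show ?thesis using exec.IfTrue[OF fits False 1(1)] 1(3) unfolding runs_def by blast
  qed
qed simp

lemma runs_Seq:
  assumes "runs W c\<^sub>1 m k\<^sub>1 Q" "\<And>m'. Q m' \<Longrightarrow> runs W c\<^sub>2 m' k\<^sub>2 R"
  shows "runs W (Seq c\<^sub>1 c\<^sub>2) m (k\<^sub>1 + k\<^sub>2) R"
proof -
  obtain t m' where 1: "exec W c\<^sub>1 m t m'" "t \<le> k\<^sub>1" "Q m'" using assms(1) unfolding runs_def by blast
  obtain t' m'' where 2: "exec W c\<^sub>2 m' t' m''" "t' \<le> k\<^sub>2" "R m''"
    using assms(2)[OF 1(3)] unfolding runs_def by blast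
  have "t + t' \<le> k\<^sub>1 + k\<^sub>2" using 1(2) 2(2) by simp
  then show ?thesis using exec.Seq[OF 1(1) 2(1)] 2(3) unfolding runs_def by blast
qed

text \<open>The loop-free body has constant cost and every iteration lowers the potential
  \<open>\<phi>\<close>, so the time is linear in its initial value. Each of the three loops of the
  program is an instance.\<close>

lemma runs_While:
  assumes "I m" "\<And>m. I m \<Longrightarrow> fits W m e"
    and "\<And>m. I m \<Longrightarrow> val m e \<noteq> 0 \<Longrightarrow> wp W c (\<lambda>m'. I m' \<and> \<phi> m' < \<phi> m) m"
  shows "runs W (While e c) m ((cost e + 1 + steps c) * \<phi> m + cost e + 1) (\<lambda>m'. I m' \<and> val m' e = 0)"
  using assms(1)
proof (induction "\<phi> m" arbitrary: m rule: less_induct)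
  case less
  let ?K = "cost e + 1 + steps c"
  show ?case
  proof (cases "val m e = 0")
    case True
    then show ?thesis using exec.WhileFalse[OF assms(2)[OF less.prems] True] less.prems
      unfolding runs_def by force
  next
    case False
    from runs_wp[OF assms(3)[OF less.prems False]] obtain t m' where
      1: "exec W c m t m'" "t \<le> steps c" "I m'" "\<phi> m' < \<phi> m" unfolding runs_def by blast
    from less.hyps[OF 1(4,3)] obtain t' m'' where
      2: "exec W (While e c) m' t' m''" "t' \<le> ?K * \<phi> m' + cost e + 1" "I m''" "val m'' e = 0"
      unfolding runs_def by blast
    have "?K * Suc (\<phi> m') \<le> ?K * \<phi> m" using 1(4) by (intro mult_le_mono2) simp
    then have "cost e + 1 + t + t' \<le> ?K * \<phi> m + cost e + 1" using 1(2) 2(2) by simp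
    then show ?thesis using exec.WhileTrue[OF assms(2)[OF less.prems] False 1(1) 2(1)] 2(3,4)
      unfolding runs_def by blast
  qed
qed

section \<open>Edge counts and low degrees in forests\<close>

lemma acyclic_low_arcs:
  assumes "pair_graph G" "degenerate_order G d"
  defines "L \<equiv> {(v, w) \<in> parcs G. d w < d v}"
  shows "finite L" "inj_on fst L" "pverts G \<noteq> {} \<Longrightarrow> card L < card (pverts G)"
    "parcs G = L \<union> L\<inverse>"
proof -
  have G: "finite (pverts G)" "parcs G \<subseteq> pverts G \<times> pverts G" "sym (parcs G)" "irrefl (parcs G)"
    using assms(1) by (auto simp: pair_graph_iff)
  have inj: "d v \<noteq> d w" if "v \<in> pverts G" "w \<in> pverts G" "v \<noteq> w" for v w
    using assms(2) that unfolding degenerate_order_def by (blast dest: inj_onD)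
  show fin: "finite L" unfolding L_def by (rule finite_subset[of _ "pverts G \<times> pverts G"]) (use G in auto)
  show inj_fst: "inj_on fst L"
    using assms(2) unfolding degenerate_order_def L_def inj_on_def by fastforce
  \<comment> \<open>A low arc is determined by its larger end, and the vertex of least number is
    never the larger end.\<close>
  show "card L < card (pverts G)" if "pverts G \<noteq> {}"
  proof -
    have "Min (d ` pverts G) \<in> d ` pverts G" using G(1) that by (intro Min_in) auto
    then obtain v where v: "v \<in> pverts G" "d v = Min (d ` pverts G)" by force
    have "d v \<le> d w" if "w \<in> pverts G" for w unfolding v(2) using G(1) that by (intro Min_le) auto
    then have "fst ` L \<subseteq> pverts G - {v}" using G(2) unfolding L_def by force
    then have "card (fst ` L) \<le> card (pverts G - {v})" using G(1) by (intro card_mono) auto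
    also have "\<dots> < card (pverts G)" using G(1) v(1) by (rule card_Diff1_less)
    finally show ?thesis using card_image[OF inj_fst] by simp
  qed
  have "(v, w) \<in> L \<or> (w, v) \<in> L" if "(v, w) \<in> parcs G" for v w
  proof -
    have "v \<in> pverts G" "w \<in> pverts G" "v \<noteq> w" "(w, v) \<in> parcs G"
      using that G by (auto simp: irrefl_def dest: symD)
    then show ?thesis using inj[of v w] that unfolding L_def by auto
  qed
  then show "parcs G = L \<union> L\<inverse>" using G(3) unfolding L_def by (auto dest: symD)
qed

text \<open>The low arcs and their converses together are all arcs, and there are at most as many
  low arcs as vertices. This bounds the length of the adjacency array.\<close>

lemma card_arcs_le:
  assumes "pair_graph G" "acyclic_graph G"
  shows "card (parcs G) \<le> 2 * card (pverts G)"
proof (cases "pverts G = {}")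
  case True
  then show ?thesis using assms(1) by (simp add: pair_graph_iff)
next
  case False
  obtain d where d: "degenerate_order G d" using acyclic_imp_order[OF assms] by blast
  note L = acyclic_low_arcs[OF assms(1) d]
  have "card (parcs G) \<le> card {(v, w) \<in> parcs G. d w < d v} + card ({(v, w) \<in> parcs G. d w < d v}\<inverse>)"
    by (subst (1) L(4)) (rule card_Un_le)
  then show ?thesis using L(3)[OF False] by simp
qed

lemma low_degree_exists:
  assumes "tree_or_empty G" "pverts G \<noteq> {}"
  shows "\<exists>v\<in>pverts G. card (nbrs G v) \<le> 1"
proof -
  note G = tree_or_emptyD[OF assms(1)]
  obtain v0 where "v0 \<in> pverts G" using assms(2) by blast
  then have "path_in G [v0]" by (simp add: path_in_def)
  from longest_path[OF G(6) this] obtain q where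
    q: "path_in G q" "\<And>q'. path_in G q' \<Longrightarrow> length q' \<le> length q" by blast
  obtain a q1 where q1: "q = a # q1" using q(1) by (cases q) (auto simp: path_in_def)
  have "w = hd q1" if "w \<in> nbrs G a" for w
    using longest_path_end[OF G(1,2), of a q1 w] q q1 that by (simp add: nbrs_def)
  then have "nbrs G a \<subseteq> {hd q1}" by blast
  then have "card (nbrs G a) \<le> 1" using card_mono[of "{hd q1}"] by fastforce
  moreover have "a \<in> pverts G" using q(1) q1 by (simp add: path_in_Cons)
  ultimately show ?thesis by blast
qed

section \<open>Finding a leaf and a breadth-first order: program text and memory layout\<close>

abbreviation one :: aexp where "one \<equiv> Const 1"

definition degree_of :: "aexp \<Rightarrow> aexp" where
  "degree_of e = Sub (Arr ''start'' (Add e one)) (Arr ''start'' e)"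

text \<open>Subtraction is truncated, so the test vanishes for degree 0 as well as for degree
  1.\<close>

definition leaf_test :: aexp where "leaf_test = Sub (degree_of (Reg ''r'')) one"
definition leaf_step :: com where "leaf_step = Assign ''r'' (Add (Reg ''r'') one)"

text \<open>
  \<open>ord\<close> is the queue. In \<open>par\<close> parents are shifted by one, \<open>0\<close> marks unvisited vertices, and the
  root is its own parent.
\<close>

definition bfs_init :: com where
  "bfs_init = Seq (Store ''par'' (Reg ''r'') (Add (Reg ''r'') one))
    (Seq (Store ''ord'' (Const 0) (Reg ''r''))
    (Seq (Assign ''q'' one)
    (Assign ''j'' (Arr ''start'' (Reg ''r'')))))"

definition bfs_test :: aexp where "bfs_test = Sub (Reg ''q'') (Reg ''i'')"

text \<open>Scanning neighbours and advancing the queue are merged into one loop steered by the cell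
  index \<open>j\<close>; so the body is loop-free and a single potential bounds the total
  work.\<close>

definition bfs_step :: com where
  "bfs_step = If (Sub (Arr ''start'' (Add (Arr ''ord'' (Reg ''i'')) one)) (Reg ''j''))
    (Seq (Assign ''w'' (Arr ''adj'' (Reg ''j'')))
    (Seq (Assign ''j'' (Add (Reg ''j'') one))
    (If (Arr ''par'' (Reg ''w'')) Skip
      (Seq (Store ''par'' (Reg ''w'') (Add (Arr ''ord'' (Reg ''i'')) one))
      (Seq (Store ''ord'' (Reg ''q'') (Reg ''w''))
      (Assign ''q'' (Add (Reg ''q'') one)))))))
    (Seq (Assign ''i'' (Add (Reg ''i'') one))
    (Assign ''j'' (Arr ''start'' (Arr ''ord'' (Reg ''i'')))))"

text \<open>The largest values that the program computes are positions in the adjacency array, at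
  most \<open>2 * n\<close>; the word bound leaves some slack.\<close>

locale ram_input =
  fixes T :: "nat pair_pre_digraph" and adj :: "nat list list" and W n :: nat
  assumes T: "utree T" and adj: "adjacency_lists T adj" and n: "n = length adj" and W: "5 * n \<le> W"
begin

lemmas tree = utree_tree_or_empty(1)[OF T]
lemmas G = tree_or_emptyD[OF tree]

lemma verts: "pverts T = {..<n}"
  using adj n by (simp add: adjacency_lists_def)

lemma n_pos: "0 < n"
  using utree_tree_or_empty(2)[OF T] verts by auto

lemma adj_nbrs: "v < n \<Longrightarrow> set (adj ! v) = nbrs T v" and adj_distinct: "v < n \<Longrightarrow> distinct (adj ! v)"
  using adj n by (auto simp: adjacency_lists_def)

lemma length_adj: "v < n \<Longrightarrow> length (adj ! v) = card (nbrs T v)"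
  using adj_nbrs adj_distinct distinct_card by metis

lemma nbrs_less: "w \<in> nbrs T v \<Longrightarrow> w < n \<and> v < n \<and> v \<in> nbrs T w"
  using G(3,4) verts by (auto simp: nbrs_def dest: symD)

definition st :: "nat \<Rightarrow> nat" where "st v = length (concat (take v adj))"

lemma st_Suc: "v < n \<Longrightarrow> st (Suc v) = st v + length (adj ! v)"
  using n by (simp add: st_def take_Suc_conv_app_nth)

lemma concat_split: "v < n \<Longrightarrow> concat adj = concat (take v adj) @ adj ! v @ concat (drop (Suc v) adj)"
  using n by (metis append.assoc append_take_drop_id concat.simps(2) concat_append id_take_nth_drop)

lemma concat_nth: "v < n \<Longrightarrow> l < length (adj ! v) \<Longrightarrow> concat adj ! (st v + l) = adj ! v ! l \<and> st v + l < length (concat adj)"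
  using concat_split[of v] by (simp add: st_def nth_append)

lemma sum_degrees: "(\<Sum>v<n. length (adj ! v)) \<le> 2 * n"
proof -
  have "parcs T = Sigma (pverts T) (nbrs T)" using G(4) by (auto simp: nbrs_def)
  then have "card (parcs T) = (\<Sum>v\<in>pverts T. card (nbrs T v))"
    using card_SigmaI[of "pverts T" "nbrs T"] finite_nbrs[OF G(1)] G(6) by simp
  then show ?thesis using card_arcs_le[OF G(1,2)] verts length_adj by simp
qed

lemma length_concat_adj: "length (concat adj) \<le> 2 * n"
  using sum_degrees n by (simp add: length_concat sum_list_sum_nth atLeast0LessThan)

lemma st_le: "st v \<le> 2 * n"
proof -
  have "length (concat adj) = st v + length (concat (drop v adj))"
    unfolding st_def by (metis append_take_drop_id concat_append length_append)
  then show ?thesis using length_concat_adj by simp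
qed

definition start_arr :: "nat \<Rightarrow> nat" where "start_arr = arr (input_mem adj) ''start''"
definition adj_arr :: "nat \<Rightarrow> nat" where "adj_arr = arr (input_mem adj) ''adj''"

lemma start_arr: "v \<le> n \<Longrightarrow> start_arr v = st v" and start_arr_le: "start_arr v \<le> 2 * n"
  using st_le n by (auto simp: start_arr_def input_mem_def st_def)

lemma adj_arr: "v < n \<Longrightarrow> l < length (adj ! v) \<Longrightarrow> adj_arr (st v + l) = adj ! v ! l"
  using concat_nth by (simp add: adj_arr_def input_mem_def)

lemma degree_arr: "v < n \<Longrightarrow> start_arr (Suc v) - start_arr v = card (nbrs T v)"
  using st_Suc length_adj by (simp add: start_arr)

text \<open>The witness \<open>v\<close>, not yet passed by the scan, keeps register
  \<open>r\<close> inside the vertex range and makes the search succeed.\<close>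

definition leaf_inv :: "mem \<Rightarrow> bool" where
  "leaf_inv m \<longleftrightarrow> m = (input_mem adj)\<lparr>reg := (reg (input_mem adj))(''r'' := reg m ''r'')\<rparr> \<and>
     (\<exists>v<n. reg m ''r'' \<le> v \<and> card (nbrs T v) \<le> 1)"

lemma leaf_inv_arr:
  assumes "leaf_inv m"
  shows "arr m ''start'' = start_arr" "arr m ''adj'' = adj_arr" "reg m ''n'' = n"
    "x \<noteq> ''n'' \<Longrightarrow> x \<noteq> ''r'' \<Longrightarrow> reg m x = 0" "x \<noteq> ''start'' \<Longrightarrow> x \<noteq> ''adj'' \<Longrightarrow> arr m x = (\<lambda>_. 0)"
proof -
  from assms obtain r where m: "m = (input_mem adj)\<lparr>reg := (reg (input_mem adj))(''r'' := r)\<rparr>"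
    unfolding leaf_inv_def by blast
  show "arr m ''start'' = start_arr" "arr m ''adj'' = adj_arr" "reg m ''n'' = n"
    "x \<noteq> ''n'' \<Longrightarrow> x \<noteq> ''r'' \<Longrightarrow> reg m x = 0" "x \<noteq> ''start'' \<Longrightarrow> x \<noteq> ''adj'' \<Longrightarrow> arr m x = (\<lambda>_. 0)"
    unfolding m by (simp_all add: start_arr_def adj_arr_def) (simp_all add: input_mem_def n)
qed

lemma leaf_loop:
  "runs W (While leaf_test leaf_step) (input_mem adj) ((cost leaf_test + 1 + steps leaf_step) * n + cost leaf_test + 1)
     (\<lambda>m. leaf_inv m \<and> reg m ''r'' < n \<and> card (nbrs T (reg m ''r'')) \<le> 1)"
proof -
  let ?\<phi> = "\<lambda>m. n - reg m ''r''"
  have lt: "reg m ''r'' < n" if "leaf_inv m" for m using that by (auto simp: leaf_inv_def)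
  have val: "val m leaf_test = card (nbrs T (reg m ''r'')) - 1" if "leaf_inv m" for m
    using degree_arr[OF lt[OF that]] leaf_inv_arr[OF that] by (simp add: leaf_test_def degree_of_def)
  have start: "leaf_inv (input_mem adj)"
  proof -
    have "\<exists>v<n. card (nbrs T v) \<le> 1"
      using low_degree_exists[OF tree] verts n_pos by auto
    moreover have r0: "reg (input_mem adj) ''r'' = 0" by (simp add: input_mem_def)
    moreover have "(reg (input_mem adj))(''r'' := 0) = reg (input_mem adj)" using r0 by (rule fun_upd_idem)
    ultimately show ?thesis unfolding leaf_inv_def by simp
  qed
  have "runs W (While leaf_test leaf_step) (input_mem adj)
    ((cost leaf_test + 1 + steps leaf_step) * ?\<phi> (input_mem adj) + cost leaf_test + 1)
    (\<lambda>m'. leaf_inv m' \<and> val m' leaf_test = 0)"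
  proof (rule runs_While[where I = leaf_inv])
    show "leaf_inv (input_mem adj)" by (rule start)
  next
    fix m assume m: "leaf_inv m"
    show "fits W m leaf_test"
      using leaf_inv_arr[OF m] lt[OF m] W start_arr_le[of "reg m ''r''"] start_arr_le[of "Suc (reg m ''r'')"]
      by (simp add: leaf_test_def degree_of_def)
  next
    fix m assume m: "leaf_inv m" "val m leaf_test \<noteq> 0"
    obtain v where v: "v < n" "reg m ''r'' \<le> v" "card (nbrs T v) \<le> 1"
      and eq: "m = (input_mem adj)\<lparr>reg := (reg (input_mem adj))(''r'' := reg m ''r'')\<rparr>"
      using m(1) unfolding leaf_inv_def by blast
    have "\<not> card (nbrs T (reg m ''r'')) \<le> 1" using m(2) val[OF m(1)] by simp
    then have "reg m ''r'' \<noteq> v" using v(3) by blast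
    then have less: "Suc (reg m ''r'') \<le> v" using v(2) by simp
    have upd: "m\<lparr>reg := f\<rparr> = (input_mem adj)\<lparr>reg := f\<rparr>" for f
      using arg_cong[OF eq, of "\<lambda>m. m\<lparr>reg := f\<rparr>"] by simp
    have "reg m = (reg (input_mem adj))(''r'' := reg m ''r'')" using arg_cong[OF eq, of reg] by simp
    then have regs: "(reg m)(''r'' := k) = (reg (input_mem adj))(''r'' := k)" for k by (metis fun_upd_upd)
    have "leaf_inv (m\<lparr>reg := (reg m)(''r'' := Suc (reg m ''r''))\<rparr>)"
      unfolding leaf_inv_def upd regs using v(1,3) less by auto
    then show "wp W leaf_step (\<lambda>m'. leaf_inv m' \<and> ?\<phi> m' < ?\<phi> m) m"
      using less v(1) W by (simp add: leaf_step_def)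
  qed
  moreover have "?\<phi> (input_mem adj) = n" by (simp add: input_mem_def)
  moreover have "leaf_inv m \<and> reg m ''r'' < n \<and> card (nbrs T (reg m ''r'')) \<le> 1"
    if "leaf_inv m \<and> val m leaf_test = 0" for m using that lt[of m] val[of m] by simp
  ultimately show ?thesis unfolding runs_def by auto
qed

end

section \<open>Breadth-first search\<close>

context rooted
begin

lemma cov_V: "cov V v w \<longleftrightarrow> w \<in> V \<and> w \<noteq> r \<and> v = par w"
proof
  assume c: "cov V v w"
  have w: "w \<in> V" "v \<noteq> w" "anc v w" using covD[OF c] by auto
  have "w \<noteq> r" using w anc_of_root by blast
  then have "par w \<noteq> w" using par_ix[OF w(1)] by auto
  moreover have "anc v (par w)" using anc_step w by blast
  ultimately have "par w = v" using cov_between[OF c par_V[OF w(1)]] anc_par by blast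
  then show "w \<in> V \<and> w \<noteq> r \<and> v = par w" using w \<open>w \<noteq> r\<close> by blast
next
  assume w: "w \<in> V \<and> w \<noteq> r \<and> v = par w"
  then have "v \<noteq> w" "v \<in> V" using par_ix[of w] par_V[of w] by auto
  moreover have "z = v \<or> z = w" if "anc v z" "anc z w" for z
    using anc_step[OF that(2)] anc_antisym[of z v] that(1) w \<open>v \<in> V\<close> by blast
  ultimately show "cov V v w" using w anc_par[of w] unfolding cov_def by blast
qed

end

lemma nth_notin_take: "distinct xs \<Longrightarrow> i < length xs \<Longrightarrow> xs ! i \<notin> set (take i xs)"
  by (auto simp: in_set_conv_nth nth_eq_iff_index_eq)

context ram_input
begin

text \<open>About the order of the search only one thing is recorded: a parent stands before its
  children in \<open>os\<close>. This suffices for the position in the queue to serve as the measure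
  \<open>ix\<close>; distances from the root do not enter.\<close>

definition bfs_inv :: "nat \<Rightarrow> nat list \<Rightarrow> nat \<Rightarrow> nat \<Rightarrow> (nat \<Rightarrow> nat) \<Rightarrow> bool" where
  "bfs_inv r os i j par \<longleftrightarrow> os \<noteq> [] \<and> os ! 0 = r \<and> distinct os \<and> set os \<subseteq> {..<n} \<and> i \<le> length os \<and>
     (\<forall>w<n. par w \<noteq> 0 \<longleftrightarrow> w \<in> set os) \<and>
     (\<forall>k<length os. 0 < k \<longrightarrow> (\<exists>l<k. par (os ! k) = Suc (os ! l) \<and> os ! k \<in> nbrs T (os ! l))) \<and>
     par r = Suc r \<and> (\<forall>k<i. nbrs T (os ! k) \<subseteq> set os) \<and>
     (i < length os \<longrightarrow> st (os ! i) \<le> j \<and> j \<le> st (Suc (os ! i)) \<and>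
        set (take (j - st (os ! i)) (adj ! (os ! i))) \<subseteq> set os)"

text \<open>Each step either scans a cell of the adjacency array or advances the head of the queue.\<close>

definition slots_left :: "nat list \<Rightarrow> nat \<Rightarrow> nat \<Rightarrow> nat" where
  "slots_left os i j = (if i < length os
     then n - i + ((\<Sum>v\<in>{..<n} - set (take i os). length (adj ! v)) - (j - st (os ! i))) else 0)"

lemma bfs_nth:
  assumes "bfs_inv r os i j par" "k < length os"
  shows "os ! k < n"
proof -
  have "os ! k \<in> set os" using assms(2) by simp
  then show ?thesis using assms(1) unfolding bfs_inv_def by blast
qed

lemma bfs_length:
  assumes "bfs_inv r os i j par"
  shows "length os \<le> n"
proof -
  have "card (set os) \<le> card {..<n}" using assms unfolding bfs_inv_def by (intro card_mono) auto
  moreover have "distinct os" using assms unfolding bfs_inv_def by blast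
  ultimately show ?thesis by (simp add: distinct_card)
qed

lemma bfs_scan:
  assumes "bfs_inv r os i j par" "i < length os" "j < st (Suc (os ! i))"
  defines "w \<equiv> adj_arr j"
  shows "w \<in> nbrs T (os ! i)" "w < n" "j < 2 * n" "st (os ! i) \<le> j"
    "set (take (Suc j - st (os ! i)) (adj ! (os ! i))) \<subseteq> insert w (set os)"
    "j - st (os ! i) < length (adj ! (os ! i))"
proof -
  let ?v = "os ! i"
  have v: "?v < n" using bfs_nth assms(1,2) .
  have j: "st ?v \<le> j" "set (take (j - st ?v) (adj ! ?v)) \<subseteq> set os"
    using assms(1,2) unfolding bfs_inv_def by simp_all
  define l where "l = j - st ?v"
  have l: "l < length (adj ! ?v)" "j = st ?v + l" using assms(3) st_Suc[OF v] j(1) by (auto simp: l_def)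
  then have w: "w = adj ! ?v ! l" using adj_arr[OF v l(1)] by (simp add: w_def)
  then show nb: "w \<in> nbrs T ?v" using adj_nbrs[OF v] l(1) nth_mem by blast
  then show "w < n" using nbrs_less by blast
  show "j < 2 * n" using concat_nth[OF v l(1)] l(2) length_concat_adj by simp
  show "st ?v \<le> j" by (rule j(1))
  show "j - st ?v < length (adj ! ?v)" using l by simp
  have "Suc j - st ?v = Suc l" using l(2) by simp
  then show "set (take (Suc j - st ?v) (adj ! ?v)) \<subseteq> insert w (set os)"
    using j(2) l(1) w by (auto simp: take_Suc_conv_app_nth l_def)
qed

lemma bfs_skip:
  assumes inv: "bfs_inv r os i j par" and i: "i < length os" and j: "j < st (Suc (os ! i))"
    and "par (adj_arr j) \<noteq> 0"
  shows "bfs_inv r os i (Suc j) par"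
proof -
  note s = bfs_scan[OF inv i j]
  have "adj_arr j \<in> set os" using assms(4) s(2) inv unfolding bfs_inv_def by blast
  then have "set (take (Suc j - st (os ! i)) (adj ! (os ! i))) \<subseteq> set os" using s(5) by blast
  then show ?thesis using inv s(4) j unfolding bfs_inv_def by simp
qed

lemma bfs_visit:
  assumes inv: "bfs_inv r os i j par" and i: "i < length os" and j: "j < st (Suc (os ! i))"
    and new: "par (adj_arr j) = 0"
  defines "w \<equiv> adj_arr j"
  shows "bfs_inv r (os @ [w]) i (Suc j) (par(w := Suc (os ! i)))" "length os < n"
proof -
  note s = bfs_scan[OF inv i j, folded w_def]
  let ?par = "par(w := Suc (os ! i))" and ?os = "os @ [w]"
  have I: "os \<noteq> []" "os ! 0 = r" "distinct os" "set os \<subseteq> {..<n}" "\<forall>w<n. par w \<noteq> 0 \<longleftrightarrow> w \<in> set os"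
    "\<forall>k<length os. 0 < k \<longrightarrow> (\<exists>l<k. par (os ! k) = Suc (os ! l) \<and> os ! k \<in> nbrs T (os ! l))"
    "par r = Suc r" "\<forall>k<i. nbrs T (os ! k) \<subseteq> set os"
    using inv unfolding bfs_inv_def by simp_all
  have w: "w \<notin> set os" using new I(5) s(2) unfolding w_def by blast
  have "r \<in> set os" using I(1,2) by (metis length_greater_0_conv nth_mem)
  then have "?par r = Suc r" using I(7) w by auto
  moreover have "\<exists>l<k. ?par (?os ! k) = Suc (?os ! l) \<and> ?os ! k \<in> nbrs T (?os ! l)"
    if k: "k < length ?os" "0 < k" for k
  proof (cases "k = length os")
    case True
    then show ?thesis using i s(1) by (intro exI[of _ i]) (simp add: nth_append)
  next
    case False
    then have k': "k < length os" using k(1) by simp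
    then obtain l where l: "l < k" "par (os ! k) = Suc (os ! l)" "os ! k \<in> nbrs T (os ! l)" using I(6) k(2) by blast
    have "os ! k \<noteq> w" using w k' nth_mem by metis
    then show ?thesis using l k' by (intro exI[of _ l]) (simp add: nth_append)
  qed
  moreover have "\<forall>u<n. ?par u \<noteq> 0 \<longleftrightarrow> u \<in> set ?os" using I(5) by simp
  moreover have "\<forall>k<i. nbrs T (?os ! k) \<subseteq> set ?os" using I(8) i by (auto simp: nth_append)
  moreover have "set (take (Suc j - st (?os ! i)) (adj ! (?os ! i))) \<subseteq> set ?os"
    using s(5) i by (simp add: nth_append)
  moreover have "st (?os ! i) \<le> Suc j" "Suc j \<le> st (Suc (?os ! i))" using s(4) j i by (simp_all add: nth_append)
  moreover have "?os ! 0 = r" using I(1,2) by (simp add: nth_append)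
  moreover have "distinct ?os" "set ?os \<subseteq> {..<n}" "i \<le> length ?os" using I(3,4) w s(2) i by simp_all
  ultimately show new_inv: "bfs_inv r ?os i (Suc j) ?par" unfolding bfs_inv_def by simp
  show "length os < n" using bfs_length[OF new_inv] by simp
qed

lemma bfs_next:
  assumes inv: "bfs_inv r os i j par" and i: "i < length os" and j: "\<not> j < st (Suc (os ! i))"
    and j': "Suc i < length os \<Longrightarrow> j' = st (os ! Suc i)"
  shows "bfs_inv r os (Suc i) j' par"
proof -
  let ?v = "os ! i"
  have v: "?v < n" using bfs_nth[OF inv i] .
  have "set (take (j - st ?v) (adj ! ?v)) \<subseteq> set os" "st ?v \<le> j" "j \<le> st (Suc ?v)"
    using inv i unfolding bfs_inv_def by simp_all
  moreover from this have "j - st ?v = length (adj ! ?v)" using j st_Suc[OF v] by simp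
  ultimately have "nbrs T ?v \<subseteq> set os" using adj_nbrs[OF v] by simp
  moreover have "st (os ! Suc i) \<le> st (Suc (os ! Suc i))" if "Suc i < length os"
    using st_Suc[OF bfs_nth[OF inv that]] by simp
  moreover have I: "os \<noteq> []" "os ! 0 = r" "distinct os" "set os \<subseteq> {..<n}" "\<forall>w<n. par w \<noteq> 0 \<longleftrightarrow> w \<in> set os"
    "\<forall>k<length os. 0 < k \<longrightarrow> (\<exists>l<k. par (os ! k) = Suc (os ! l) \<and> os ! k \<in> nbrs T (os ! l))"
    "par r = Suc r" "\<forall>k<i. nbrs T (os ! k) \<subseteq> set os"
    using inv unfolding bfs_inv_def by simp_all
  ultimately show ?thesis using i j' unfolding bfs_inv_def by (simp add: less_Suc_eq)
qed

lemma slots_left_scan: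
  assumes inv: "bfs_inv r os i j par" and i: "i < length os" and j: "j < st (Suc (os ! i))"
  shows "slots_left os i (Suc j) < slots_left os i j" "slots_left (os @ [w]) i (Suc j) < slots_left os i j"
proof -
  let ?R = "{..<n} - set (take i os)"
  have "distinct os" using inv unfolding bfs_inv_def by blast
  then have "os ! i \<notin> set (take i os)" using i by (rule nth_notin_take)
  then have "os ! i \<in> ?R" using bfs_nth[OF inv i] by simp
  \<comment> \<open>The row of \<open>os ! i\<close> is among those summed, so the truncated
    difference really drops when a cell is scanned.\<close>
  then have "length (adj ! (os ! i)) \<le> (\<Sum>v\<in>?R. length (adj ! v))" by (intro member_le_sum) auto
  then have "j - st (os ! i) < (\<Sum>v\<in>?R. length (adj ! v))" using bfs_scan(6)[OF inv i j] by simp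
  moreover have "Suc j - st (os ! i) = Suc (j - st (os ! i))" using bfs_scan(4)[OF inv i j] by simp
  ultimately show "slots_left os i (Suc j) < slots_left os i j" "slots_left (os @ [w]) i (Suc j) < slots_left os i j"
    using i by (simp_all add: slots_left_def nth_append)
qed

text \<open>The finished row leaves the sum just as its scanned cells leave the subtracted offset,
  so the drop comes from \<open>n - i\<close> alone. At the end of the queue the potential becomes
  0.\<close>

lemma slots_left_next:
  assumes inv: "bfs_inv r os i j par" and i: "i < length os" and j: "\<not> j < st (Suc (os ! i))"
    and j': "Suc i < length os \<Longrightarrow> j' = st (os ! Suc i)"
  shows "slots_left os (Suc i) j' < slots_left os i j"
proof -
  have len: "i < n" using bfs_length[OF inv] i by simp
  show ?thesis
  proof (cases "Suc i < length os")
    case False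
    then show ?thesis using i len by (simp add: slots_left_def)
  next
    case True
    let ?v = "os ! i" and ?R = "{..<n} - set (take i os)"
    have v: "?v < n" using bfs_nth[OF inv i] .
    have "st ?v \<le> j" "j \<le> st (Suc ?v)" using inv i unfolding bfs_inv_def by simp_all
    then have d: "j - st ?v = length (adj ! ?v)" using j st_Suc[OF v] by simp
    have "distinct os" using inv unfolding bfs_inv_def by blast
    then have "?v \<notin> set (take i os)" using i by (rule nth_notin_take)
    then have vR: "?v \<in> ?R" using v by simp
    have "{..<n} - set (take (Suc i) os) = ?R - {?v}" using i by (auto simp: take_Suc_conv_app_nth)
    then have "(\<Sum>u\<in>{..<n} - set (take (Suc i) os). length (adj ! u)) = (\<Sum>u\<in>?R. length (adj ! u)) - length (adj ! ?v)"
      using sum_diff1_nat[of "\<lambda>u. length (adj ! u)" ?R ?v] vR by simp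
    then show ?thesis using d True i len j' by (simp add: slots_left_def)
  qed
qed

text \<open>When the queue is exhausted, \<open>os\<close> is closed under neighbours, and the tree
  is connected.\<close>

lemma bfs_complete:
  assumes "bfs_inv r os (length os) j par"
  shows "set os = {..<n}"
proof -
  have I: "os \<noteq> []" "os ! 0 = r" "set os \<subseteq> {..<n}" "\<forall>k<length os. nbrs T (os ! k) \<subseteq> set os"
    using assms unfolding bfs_inv_def by simp_all
  have "r \<in> set os" using I(1,2) by (metis length_greater_0_conv nth_mem)
  moreover from this have "r \<in> pverts T" using I(3) verts by blast
  moreover have "nbrs T x \<subseteq> set os" if "x \<in> set os" for x using I(4) that by (metis in_set_conv_nth)
  ultimately have "pverts T \<subseteq> set os" using tree_closed_set[OF tree] by blast
  then show ?thesis using I(3) verts by blast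
qed

lemma bfs_rooted_tree:
  assumes inv: "bfs_inv r os (length os) j par" and r: "card (nbrs T r) \<le> 1"
  shows "\<exists>ix. rooted_tree {..<n} r (\<lambda>v. par v - 1) ix T \<and> (\<forall>k<n. ix (os ! k) = k)" "length os = n"
proof -
  have I: "os \<noteq> []" "os ! 0 = r" "distinct os"
    "\<forall>k<length os. 0 < k \<longrightarrow> (\<exists>l<k. par (os ! k) = Suc (os ! l) \<and> os ! k \<in> nbrs T (os ! l))"
    "par r = Suc r"
    using inv unfolding bfs_inv_def by simp_all
  note os = bfs_complete[OF inv]
  have len: "length os = n" using distinct_card[OF I(3)] os by simp
  then show "length os = n" .
  \<comment> \<open>The position in the queue, which by the invariant is smaller for the
    parent.\<close>
  define ix where "ix v = (LEAST k. k < n \<and> os ! k = v)" for v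
  have ix: "ix (os ! k) = k" if "k < n" for k
    unfolding ix_def using that len nth_eq_iff_index_eq[OF I(3)] by (intro Least_equality) auto
  let ?p = "\<lambda>v. par v - 1"
  have p: "?p v < n \<and> ix (?p v) < ix v \<and> v \<in> nbrs T (?p v)" if v: "v < n" "v \<noteq> r" for v
  proof -
    have "v \<in> set os" using os v(1) by simp
    then obtain k where k: "k < n" "v = os ! k" using len by (metis in_set_conv_nth)
    then have "0 < k" using v(2) I(2) by (cases k) auto
    then obtain l where l: "l < k" "par (os ! k) = Suc (os ! l)" "os ! k \<in> nbrs T (os ! l)"
      using I(4) k(1) len by blast
    then have "?p v = os ! l" "l < n" using k by simp_all
    moreover have "os ! l < n" using os nth_mem[of l os] len \<open>l < n\<close> by auto
    ultimately show ?thesis using l k ix by simp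
  qed
  have pr: "?p r = r" using I(5) by simp
  have rn: "r < n" using os I(1,2) nth_mem[of 0 os] by auto
  interpret R: rooted "{..<n}" r ?p ix
  proof
    show "?p v \<in> {..<n}" if "v \<in> {..<n}" for v using p[of v] pr rn that by (cases "v = r") simp_all
    show "ix (?p v) < ix v" if "v \<in> {..<n}" "v \<noteq> r" for v using p that by simp
  qed (use pr rn in simp_all)
  obtain d where d: "degenerate_order T d" using acyclic_imp_order[OF G(1,2)] by blast
  define L where "L = {(v, w) \<in> parcs T. d w < d v}"
  note L = acyclic_low_arcs[OF G(1) d, folded L_def]
  txt \<open>A forest has fewer than \<open>n\<close> edges, so the \<open>n - 1\<close> search tree edges are all of them.\<close>
  define f where "f x = (if d (?p x) < d x then (x, ?p x) else (?p x, x))" for x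
  have fL: "f x \<in> L" if "x \<in> {..<n} - {r}" for x
  proof -
    have a: "(?p x, x) \<in> parcs T" "(x, ?p x) \<in> parcs T"
      using p[of x] that nbrs_less by (auto simp: nbrs_def)
    then have "(?p x, x) \<in> L \<or> (x, ?p x) \<in> L" using L(4) by blast
    then show ?thesis unfolding f_def L_def using a by auto
  qed
  \<comment> \<open>Two different vertices with the same parent edge would be parents of each other,
    against the decrease of \<open>ix\<close>.\<close>
  have inj_f: "inj_on f ({..<n} - {r})"
  proof (rule inj_onI)
    fix x y assume xy: "x \<in> {..<n} - {r}" "y \<in> {..<n} - {r}" "f x = f y"
    then have "x = y \<or> x = ?p y \<and> y = ?p x" by (auto simp: f_def split: if_splits)
    then show "x = y" using p[of x] p[of y] xy by (metis DiffE insertI1 lessThan_iff order.asym)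
  qed
  have "card L < n" using L(3) verts n_pos by auto
  moreover have "card (f ` ({..<n} - {r})) = n - 1" using card_image[OF inj_f] rn by simp
  ultimately have "card L \<le> card (f ` ({..<n} - {r}))" by linarith
  moreover have "f ` ({..<n} - {r}) \<subseteq> L" using fL by blast
  ultimately have "f ` ({..<n} - {r}) = L" using card_seteq[OF L(1)] by blast
  then have arcs: "\<exists>x\<in>{..<n} - {r}. v = x \<and> w = ?p x \<or> v = ?p x \<and> w = x" if "(v, w) \<in> parcs T" for v w
  proof -
    have "(v, w) \<in> L \<or> (w, v) \<in> L" using that L(4) by blast
    then obtain x where "x \<in> {..<n} - {r}" "f x = (v, w) \<or> f x = (w, v)"
      using \<open>f ` ({..<n} - {r}) = L\<close> by (metis imageE)
    then show ?thesis by (intro bexI[of _ x]) (auto simp: f_def split: if_splits)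
  qed
  have "(v, w) \<in> parcs T \<longleftrightarrow> R.cov {..<n} v w \<or> R.cov {..<n} w v" for v w
  proof
    assume "(v, w) \<in> parcs T"
    then show "R.cov {..<n} v w \<or> R.cov {..<n} w v" using arcs unfolding R.cov_V by blast
  next
    assume "R.cov {..<n} v w \<or> R.cov {..<n} w v"
    then show "(v, w) \<in> parcs T" unfolding R.cov_V using p G(3) by (auto simp: nbrs_def dest: symD)
  qed
  then have "parcs T = {(v, w). R.cov {..<n} v w \<or> R.cov {..<n} w v}" by auto
  then have con: "T = R.contraction {..<n}" unfolding R.contraction_def using verts by (cases T) simp
  have kid: "c \<in> nbrs T r" if "c \<in> R.kids r" for c
    using p[of c] that unfolding R.kids_def by auto
  have "c = c'" if "c \<in> R.kids r" "c' \<in> R.kids r" for c c'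
  proof -
    have "card (nbrs T r) \<le> Suc 0" using r by simp
    then have "\<forall>x\<in>nbrs T r. \<forall>y\<in>nbrs T r. x = y" unfolding card_le_Suc0_iff_eq[OF finite_nbrs[OF G(1)]] .
    then show ?thesis using kid that by blast
  qed
  then have "rooted_tree {..<n} r ?p ix T"
    using con by unfold_locales
  then show "\<exists>ix. rooted_tree {..<n} r ?p ix T \<and> (\<forall>k<n. ix (os ! k) = k)" using ix by blast
qed

definition ord_list :: "mem \<Rightarrow> nat list" where
  "ord_list m = map (arr m ''ord'') [0..<reg m ''q'']"

text \<open>After the last vertex the step still reads one cell of \<open>ord\<close> behind the
  queue; its content 0 is a legal vertex number. The conditions on \<open>k\<close>,
  \<open>a\<close> and \<open>b\<close> are carried along for the start of the sweep.\<close>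

definition bfs_mem :: "nat \<Rightarrow> mem \<Rightarrow> bool" where
  "bfs_mem r m \<longleftrightarrow> arr m ''start'' = start_arr \<and> arr m ''adj'' = adj_arr \<and> reg m ''n'' = n \<and>
     reg m ''r'' = r \<and> reg m ''k'' = 0 \<and> arr m ''a'' = (\<lambda>_. 0) \<and> arr m ''b'' = (\<lambda>_. 0) \<and>
     (\<forall>k\<ge>reg m ''q''. arr m ''ord'' k = 0) \<and>
     bfs_inv r (ord_list m) (reg m ''i'') (reg m ''j'') (arr m ''par'')"

lemma bfs_start:
  assumes "leaf_inv m" "reg m ''r'' < n"
  shows "wp W bfs_init (\<lambda>m'. bfs_mem (reg m ''r'') m' \<and> slots_left (ord_list m') (reg m' ''i'') (reg m' ''j'') \<le> 3 * n) m"
proof -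
  let ?r = "reg m ''r''"
  have "bfs_inv ?r [?r] 0 (st ?r) ((\<lambda>_. 0)(?r := Suc ?r))"
    using assms(2) st_Suc[OF assms(2)] by (simp add: bfs_inv_def)
  \<comment> \<open>The bound consists of \<open>n\<close> queue positions and at most
    \<open>2 * n\<close> adjacency cells.\<close>
  moreover have "slots_left [?r] 0 (st ?r) \<le> 3 * n"
    using sum_degrees by (simp add: slots_left_def lessThan_def)
  moreover have "start_arr ?r = st ?r" using start_arr assms(2) by simp
  moreover have "st ?r \<le> W" using st_le[of ?r] W by simp
  ultimately show ?thesis
    using assms(2) W leaf_inv_arr[OF assms(1)] by (simp add: bfs_init_def bfs_mem_def ord_list_def)
qed

lemma bfs_loop:
  assumes "bfs_mem r m"
  shows "runs W (While bfs_test bfs_step) m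
    ((cost bfs_test + 1 + steps bfs_step) * slots_left (ord_list m) (reg m ''i'') (reg m ''j'') + cost bfs_test + 1)
    (\<lambda>m. bfs_mem r m \<and> reg m ''i'' = reg m ''q'')"
proof -
  let ?\<phi> = "\<lambda>m. slots_left (ord_list m) (reg m ''i'') (reg m ''j'')"
  have len: "length (ord_list m) = reg m ''q''" for m by (simp add: ord_list_def)
  have bounds: "reg m ''q'' \<le> n \<and> reg m ''i'' \<le> reg m ''q''" if "bfs_mem r m" for m
  proof -
    have inv: "bfs_inv r (ord_list m) (reg m ''i'') (reg m ''j'') (arr m ''par'')"
      using that unfolding bfs_mem_def by blast
    show ?thesis using bfs_length[OF inv] inv unfolding bfs_inv_def by (simp add: len)
  qed
  have "runs W (While bfs_test bfs_step) m ((cost bfs_test + 1 + steps bfs_step) * ?\<phi> m + cost bfs_test + 1)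
    (\<lambda>m. bfs_mem r m \<and> val m bfs_test = 0)"
  proof (rule runs_While[where I = "bfs_mem r"])
    fix m assume m: "bfs_mem r m"
    show "fits W m bfs_test" using bounds[OF m] W by (simp add: bfs_test_def)
  next
    fix m assume m: "bfs_mem r m" "val m bfs_test \<noteq> 0"
    let ?i = "reg m ''i''" and ?j = "reg m ''j''" and ?q = "reg m ''q''" and ?os = "ord_list m"
      and ?ord = "arr m ''ord''" and ?par = "arr m ''par''"
    have inv: "bfs_inv r ?os ?i ?j ?par"
      and mem: "arr m ''start'' = start_arr" "arr m ''adj'' = adj_arr" "reg m ''n'' = n"
        "reg m ''r'' = r" "reg m ''k'' = 0" "arr m ''a'' = (\<lambda>_. 0)" "arr m ''b'' = (\<lambda>_. 0)"
      and ord0: "\<forall>k\<ge>?q. ?ord k = 0"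
      using m(1) unfolding bfs_mem_def by simp_all
    have i: "?i < ?q" using m(2) by (simp add: bfs_test_def)
    then have i': "?i < length ?os" by (simp add: len)
    have qn: "?q \<le> n" using bounds[OF m(1)] by blast
    have ordi: "?os ! ?i = ?ord ?i" using i by (simp add: ord_list_def)
    have ordn: "?ord ?i < n" using bfs_nth[OF inv i'] ordi by simp
    have startS: "start_arr (Suc (?ord ?i)) = st (Suc (?ord ?i))" using start_arr ordn by simp
    have j_le: "?j \<le> 2 * n" 
    proof -
      have "?j \<le> st (Suc (?os ! ?i))" using inv i' unfolding bfs_inv_def by blast
      then show ?thesis using st_le[of "Suc (?os ! ?i)"] by simp
    qed
    have st_W: "st (Suc (?ord ?i)) \<le> W" using st_le[of "Suc (?ord ?i)"] W by simp
    show "wp W bfs_step (\<lambda>m'. bfs_mem r m' \<and> ?\<phi> m' < ?\<phi> m) m"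
    proof (cases "?j < st (Suc (?ord ?i))")
      case True
      then have j: "?j < st (Suc (?os ! ?i))" using ordi by simp
      note scan = bfs_scan[OF inv i' j]
      note left = slots_left_scan[OF inv i' j]
      let ?w = "adj_arr ?j"
      show ?thesis
      proof (cases "?par ?w = 0")
        case False
        have "bfs_inv r ?os ?i (Suc ?j) ?par" using bfs_skip[OF inv i' j False] .
        \<comment> \<open>A cell used as a test must fit into a word; a nonzero entry of
          \<open>par\<close> is a vertex shifted by one, hence at most \<open>n\<close>.\<close>
        moreover have "?par ?w \<le> W"
        proof -
          have "?w \<in> set ?os" using False scan(2) inv unfolding bfs_inv_def by blast
          then obtain k where k: "k < length ?os" "?w = ?os ! k" by (metis in_set_conv_nth)
          have "?par (?os ! k) \<le> n"
          proof (cases "k = 0")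
            case True
            then show ?thesis using inv bfs_nth[OF inv k(1)] unfolding bfs_inv_def by auto
          next
            case False
            then obtain l where "l < k" "?par (?os ! k) = Suc (?os ! l)" using inv k(1) unfolding bfs_inv_def by blast
            then show ?thesis using bfs_nth[OF inv, of l] k(1) by simp
          qed
          then show ?thesis using k W by simp
        qed
        ultimately show ?thesis
          using True False mem ord0 i qn ordn startS scan(2,3) st_W W j_le left(1)
          by (simp add: bfs_step_def bfs_mem_def ord_list_def)
      next
        case new: True
        note visit = bfs_visit[OF inv i' j new]
        have "map (?ord(?q := ?w)) [0..<?q] @ [?w] = ?os @ [?w]" by (simp add: ord_list_def)
        then show ?thesis
          using True new mem ord0 i qn ordn ordi startS scan(2,3) st_W W j_le left(2)[of ?w] visit
          by (simp add: bfs_step_def bfs_mem_def ord_list_def)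
      qed
    next
      case False
      then have j: "\<not> ?j < st (Suc (?os ! ?i))" using ordi by simp
      let ?j' = "start_arr (?ord (Suc ?i))"
      have j': "?j' = st (?os ! Suc ?i)" if "Suc ?i < length ?os"
        using start_arr[of "?ord (Suc ?i)"] bfs_nth[OF inv that] that by (simp add: ord_list_def)
      have ordSn: "?ord (Suc ?i) < n"
      proof (cases "Suc ?i < ?q")
        case True
        then show ?thesis using bfs_nth[OF inv, of "Suc ?i"] by (simp add: ord_list_def)
      next
        case False
        then show ?thesis using ord0 n_pos by simp
      qed
      show ?thesis
        using False mem ord0 i qn ordn startS st_W W j_le ordSn start_arr_le[of "?ord (Suc ?i)"]
          bfs_next[OF inv i' j j'] slots_left_next[OF inv i' j j']
        by (simp add: bfs_step_def bfs_mem_def ord_list_def)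
    qed
  qed (rule assms)
  moreover have "reg m ''i'' = reg m ''q''" if "bfs_mem r m" "val m bfs_test = 0" for m
    using bounds[OF that(1)] that(2) by (simp add: bfs_test_def)
  ultimately show ?thesis unfolding runs_def by blast
qed

end

section \<open>The sweep\<close>

locale nat_rooted_tree = rooted_tree V r par ix T
  for V :: "nat set" and r par ix T
begin

text \<open>
  \<open>x\<close> and \<open>y\<close> are the first two pending leaves received by \<open>w\<close>, shifted by one so that \<open>0\<close>
  means none.
\<close>

definition slots :: "nat set \<Rightarrow> nat set \<Rightarrow> nat \<Rightarrow> nat \<Rightarrow> nat \<Rightarrow> bool" where
  "slots D A x y w \<longleftrightarrow>
     (x = 0 \<longrightarrow> (\<forall>c\<in>kids w \<inter> D. \<not> live A c)) \<and>
     (x \<noteq> 0 \<longrightarrow> (\<exists>c\<in>kids w \<inter> D. x - 1 \<in> A \<inter> sub c)) \<and>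
     (y = 0 \<longrightarrow> (\<forall>c\<in>kids w \<inter> D. \<forall>c'\<in>kids w \<inter> D. live A c \<and> live A c' \<longrightarrow> c = c')) \<and>
     (y \<noteq> 0 \<longrightarrow> x \<noteq> 0 \<and> (\<exists>c\<in>kids w \<inter> D. \<exists>c'\<in>kids w \<inter> D. c \<noteq> c' \<and> x - 1 \<in> A \<inter> sub c \<and> y - 1 \<in> A \<inter> sub c'))"

lemma slotsD:
  assumes "slots D A x y w"
  shows "x = 0 \<Longrightarrow> \<forall>c\<in>kids w \<inter> D. \<not> live A c"
    and "x \<noteq> 0 \<Longrightarrow> \<exists>c\<in>kids w \<inter> D. x - 1 \<in> A \<inter> sub c"
    and "y = 0 \<Longrightarrow> \<forall>c\<in>kids w \<inter> D. \<forall>c'\<in>kids w \<inter> D. live A c \<and> live A c' \<longrightarrow> c = c'"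
    and "y \<noteq> 0 \<Longrightarrow> x \<noteq> 0 \<and> (\<exists>c\<in>kids w \<inter> D. \<exists>c'\<in>kids w \<inter> D. c \<noteq> c' \<and> x - 1 \<in> A \<inter> sub c \<and> y - 1 \<in> A \<inter> sub c')"
proof -
  note s = assms[unfolded slots_def]
  show "\<forall>c\<in>kids w \<inter> D. \<not> live A c" if "x = 0"
    by (rule s[THEN conjunct1, THEN mp, OF that])
  show "\<exists>c\<in>kids w \<inter> D. x - 1 \<in> A \<inter> sub c" if "x \<noteq> 0"
    by (rule s[THEN conjunct2, THEN conjunct1, THEN mp, OF that])
  show "\<forall>c\<in>kids w \<inter> D. \<forall>c'\<in>kids w \<inter> D. live A c \<and> live A c' \<longrightarrow> c = c'" if "y = 0"
    by (rule s[THEN conjunct2, THEN conjunct2, THEN conjunct1, THEN mp, OF that])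
  show "x \<noteq> 0 \<and> (\<exists>c\<in>kids w \<inter> D. \<exists>c'\<in>kids w \<inter> D. c \<noteq> c' \<and> x - 1 \<in> A \<inter> sub c \<and> y - 1 \<in> A \<inter> sub c')" if "y \<noteq> 0"
    by (rule s[THEN conjunct2, THEN conjunct2, THEN conjunct2, THEN mp, OF that])
qed

text \<open>A frame rule: processing \<open>v\<close> is invisible at \<open>w\<close> if the
  branches of the processed kids of \<open>w\<close> stay as they are and \<open>v\<close>, should
  it be a kid of \<open>w\<close>, hands nothing over.\<close>

lemma slots_keep:
  assumes "slots D A x y w" "\<And>c. c \<in> kids w \<inter> D \<Longrightarrow> A' \<inter> sub c = A \<inter> sub c"
    and "v \<in> kids w \<Longrightarrow> A' \<inter> sub v = {}"
  shows "slots (insert v D) A' x y w"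
proof -
  have D: "\<exists>c\<in>kids w \<inter> insert v D. z \<in> A' \<inter> sub c" if "\<exists>c\<in>kids w \<inter> D. z \<in> A \<inter> sub c" for z
    using that assms(2) by blast
  have live: "c \<in> kids w \<inter> D \<and> live A c" if "c \<in> kids w \<inter> insert v D" "live A' c" for c
    using that assms(2)[of c] assms(3) unfolding live_def by blast
  have two: "\<exists>c\<in>kids w \<inter> insert v D. \<exists>c'\<in>kids w \<inter> insert v D. c \<noteq> c' \<and> z \<in> A' \<inter> sub c \<and> z' \<in> A' \<inter> sub c'"
    if zz: "\<exists>c\<in>kids w \<inter> D. \<exists>c'\<in>kids w \<inter> D. c \<noteq> c' \<and> z \<in> A \<inter> sub c \<and> z' \<in> A \<inter> sub c'" for z z'
  proof -
    obtain c c' where c: "c \<in> kids w \<inter> D" "c' \<in> kids w \<inter> D" "c \<noteq> c'" "z \<in> A \<inter> sub c" "z' \<in> A \<inter> sub c'"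
      using zz by blast
    then have "z \<in> A' \<inter> sub c" "z' \<in> A' \<inter> sub c'" using assms(2) by simp_all
    then show ?thesis using c(1-3) by blast
  qed
  note s = slotsD[OF assms(1)]
  have 1: "\<forall>c\<in>kids w \<inter> insert v D. \<not> live A' c" if "x = 0" using s(1)[OF that] live by blast
  have 2: "\<exists>c\<in>kids w \<inter> insert v D. x - 1 \<in> A' \<inter> sub c" if "x \<noteq> 0" using D[OF s(2)[OF that]] .
  have 3: "\<forall>c\<in>kids w \<inter> insert v D. \<forall>c'\<in>kids w \<inter> insert v D. live A' c \<and> live A' c' \<longrightarrow> c = c'" if "y = 0"
    using s(3)[OF that] live by blast
  have 4: "x \<noteq> 0 \<and> (\<exists>c\<in>kids w \<inter> insert v D. \<exists>c'\<in>kids w \<inter> insert v D.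
      c \<noteq> c' \<and> x - 1 \<in> A' \<inter> sub c \<and> y - 1 \<in> A' \<inter> sub c')" if "y \<noteq> 0"
    using s(4)[OF that] two by blast
  show ?thesis unfolding slots_def by (intro conjI[of "_ \<longrightarrow> _"] impI 1 2 3 4)
qed

lemma slots_first:
  assumes "slots D A 0 y w" "v \<in> kids w" "u \<in> A \<inter> sub v"
  shows "slots (insert v D) A (Suc u) y w"
proof -
  have dead: "\<not> live A c" if "c \<in> kids w \<inter> D" for c using assms(1) that unfolding slots_def by simp
  have "y = 0" using assms(1) unfolding slots_def by blast
  moreover have "c = v" if "c \<in> kids w \<inter> insert v D" "live A c" for c using dead that by blast
  ultimately show ?thesis using assms(2,3) unfolding slots_def by auto
qed

text \<open>The old value \<open>y\<close> may be nonzero: a third or later leaf simply overwrites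
  the second cell, since any two leaves from different kids will do.\<close>

lemma slots_second:
  assumes "slots D A x y w" "v \<in> kids w" "v \<notin> D" "u \<in> A \<inter> sub v" "x \<noteq> 0"
  shows "slots (insert v D) A x (Suc u) w"
proof -
  obtain c where c: "c \<in> kids w \<inter> D" "x - 1 \<in> A \<inter> sub c" using assms(1,5) unfolding slots_def by blast
  then have "c \<noteq> v" using assms(3) by blast
  moreover have "Suc u - 1 \<in> A \<inter> sub v" using assms(4) by simp
  ultimately show ?thesis using c assms(2,5) unfolding slots_def by blast
qed

text \<open>The set \<open>A\<close> is existentially quantified because it has no counterpart in
  memory; the machine sees only the arrays \<open>a\<close> and \<open>b\<close>.\<close>

definition swept :: "nat set \<Rightarrow> nat set list \<Rightarrow> (nat \<Rightarrow> nat) \<Rightarrow> (nat \<Rightarrow> nat) \<Rightarrow> bool" where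
  "swept D \<Psi> a b \<longleftrightarrow> (\<exists>A. sweep_inv D A \<Psi> \<and> (\<forall>w\<in>V - D. slots D A (a w) (b w) w))"

lemma swept_start: "swept {} [] (\<lambda>_. 0) (\<lambda>_. 0)"
  using sweep_start by (auto simp: swept_def slots_def)

lemma swept_bound:
  assumes "swept D \<Psi> a b" "w \<in> V - D"
  shows "a w \<noteq> 0 \<Longrightarrow> a w - 1 \<in> V" "b w \<noteq> 0 \<Longrightarrow> b w - 1 \<in> V"
  using assms sub_V unfolding swept_def slots_def by blast+

lemma sweep_inv_closed: "sweep_inv D A \<Psi> \<Longrightarrow> v \<in> D \<Longrightarrow> kids v \<subseteq> D"
  unfolding sweep_inv_def by blast

lemma swept_branch:
  assumes "swept D \<Psi> a b" "v \<in> V - D" "v \<noteq> r" "kids v \<subseteq> D" "b v \<noteq> 0"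
  shows "swept (insert v D) (\<Psi> @ [{a v - 1, b v - 1}]) a b"
proof -
  obtain A where A: "sweep_inv D A \<Psi>" "\<forall>w\<in>V - D. slots D A (a w) (b w) w"
    using assms(1) unfolding swept_def by blast
  have "slots D A (a v) (b v) v" using A(2) assms(2) by blast
  then obtain c c' where c: "c \<in> kids v" "c' \<in> kids v" "c \<noteq> c'" "a v - 1 \<in> A \<inter> sub c" "b v - 1 \<in> A \<inter> sub c'"
    using assms(5) unfolding slots_def by blast
  from sweep_branch[OF A(1) assms(2-4) c] obtain A' where A': "sweep_inv (insert v D) A' (\<Psi> @ [{a v - 1, b v - 1}])"
    "A' \<inter> sub v = {}" "\<And>d. d \<in> D \<Longrightarrow> d \<notin> sub v \<Longrightarrow> A' \<inter> sub d = A \<inter> sub d" by blast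
  have "slots (insert v D) A' (a w) (b w) w" if w: "w \<in> V - insert v D" for w
  proof (rule slots_keep)
    show "slots D A (a w) (b w) w" using A(2) w by blast
    show "A' \<inter> sub v = {}" by (rule A'(2))
    show "A' \<inter> sub c = A \<inter> sub c" if cw: "c \<in> kids w \<inter> D" for c
    proof (rule A'(3))
      show "c \<in> D" using cw by blast
      \<comment> \<open>If a kid of the unprocessed vertex \<open>w\<close> lay below
        \<open>v\<close>, then so would \<open>w\<close> itself, and it would be processed.\<close>
      show "c \<notin> sub v"
      proof
        assume "c \<in> sub v"
        then have "v = c \<or> anc v w" using anc_step kidsD[of c w] cw by (auto simp: sub_def)
        moreover have "v \<noteq> c" using cw assms(2) by blast
        ultimately have "w \<in> sub v" using w by (simp add: sub_def)
        moreover have "sub v \<subseteq> insert v D"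
          using sub_subset_processed[of D v] sweep_inv_closed[OF A(1)] assms(2,4) by blast
        ultimately show False using w by blast
      qed
    qed
  qed
  then show ?thesis using A'(1) unfolding swept_def by blast
qed

text \<open>\<open>c\<close> is what \<open>v\<close> hands to its parent, shifted by one:
  \<open>v\<close> itself if it is an original leaf, else its own first cell. As the second cell is
  empty, \<open>v\<close> does not branch and the run makes no step.\<close>

lemma swept_pass:
  assumes "swept D \<Psi> a b" "v \<in> V - D" "v \<noteq> r" "kids v \<subseteq> D" "b v = 0"
  defines "c \<equiv> if kids v = {} then Suc v else a v"
  shows "c = 0 \<Longrightarrow> swept (insert v D) \<Psi> a b"
    and "c \<noteq> 0 \<Longrightarrow> a (par v) = 0 \<Longrightarrow> swept (insert v D) \<Psi> (a(par v := c)) b"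
    and "c \<noteq> 0 \<Longrightarrow> a (par v) \<noteq> 0 \<Longrightarrow> swept (insert v D) \<Psi> a (b(par v := c))"
    and "c \<noteq> 0 \<Longrightarrow> c - 1 \<in> V"
proof -
  obtain A where A: "sweep_inv D A \<Psi>" "\<forall>w\<in>V - D. slots D A (a w) (b w) w"
    using assms(1) unfolding swept_def by blast
  have v: "slots D A (a v) (b v) v" using A(2) assms(2) by blast
  have "sweep_inv (insert v D) A \<Psi> \<and> (c = 0 \<longrightarrow> A \<inter> sub v = {}) \<and> (c \<noteq> 0 \<longrightarrow> c - 1 \<in> A \<inter> sub v)"
  proof (cases "kids v = {}")
    case True
    then show ?thesis using sweep_leaf[OF A(1) assms(2,3) True] by (simp add: c_def)
  next
    case False
    have Int: "kids v \<inter> D = kids v" using assms(4) by blast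
    have nb: "\<not> branching A v" using v assms(5) unfolding slots_def branching_def Int by blast
    note pass = sweep_pass[OF A(1) assms(2,3) False assms(4) nb]
    have "A \<inter> sub v = {}" if "a v = 0"
      using v that unfolding slots_def Int live_def pass(2) by blast
    moreover have "a v - 1 \<in> A \<inter> sub v" if "a v \<noteq> 0"
      using v that unfolding slots_def Int pass(2) by blast
    ultimately show ?thesis using pass(1) False by (simp add: c_def)
  qed
  then have inv: "sweep_inv (insert v D) A \<Psi>" and c0: "c = 0 \<Longrightarrow> A \<inter> sub v = {}"
    and c1: "c \<noteq> 0 \<Longrightarrow> c - 1 \<in> A \<inter> sub v" by blast+
  have vk: "v \<in> kids (par v)" using assms(2,3) by (simp add: kids_def)
  have not_kid: "v \<notin> kids w" if "w \<noteq> par v" for w using that by (auto simp: kids_def)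
  have par_D: "par v \<in> V - D" using sweep_inv_closed[OF A(1), of "par v"] vk assms(2) par_V by blast
  then have sp: "slots D A (a (par v)) (b (par v)) (par v)" using A(2) by blast
  have other: "slots (insert v D) A (a w) (b w) w" if "w \<in> V - insert v D" "w \<noteq> par v" for w
    by (rule slots_keep[of D A]) (use A(2) that not_kid in auto)
  show "swept (insert v D) \<Psi> a b" if "c = 0"
  proof -
    have "slots (insert v D) A (a w) (b w) w" if "w \<in> V - insert v D" for w
      by (rule slots_keep[of D A]) (use A(2) that c0[OF \<open>c = 0\<close>] in auto)
    then show ?thesis using inv unfolding swept_def by blast
  qed
  show "swept (insert v D) \<Psi> (a(par v := c)) b" if "c \<noteq> 0" "a (par v) = 0"
  proof -
    have "slots D A 0 (b (par v)) (par v)" using sp that(2) by simp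
    from slots_first[OF this vk c1[OF that(1)]] have "slots (insert v D) A c (b (par v)) (par v)"
      using that(1) by simp
    then have "\<forall>w\<in>V - insert v D. slots (insert v D) A ((a(par v := c)) w) (b w) w" using other by simp
    then show ?thesis using inv unfolding swept_def by blast
  qed
  show "swept (insert v D) \<Psi> a (b(par v := c))" if "c \<noteq> 0" "a (par v) \<noteq> 0"
  proof -
    have "v \<notin> D" using assms(2) by blast
    from slots_second[OF sp vk this c1[OF that(1)] that(2)]
    have "slots (insert v D) A (a (par v)) c (par v)" using that(1) by simp
    then have "\<forall>w\<in>V - insert v D. slots (insert v D) A (a w) ((b(par v := c)) w) w" using other by simp
    then show ?thesis using inv unfolding swept_def by blast
  qed
  show "c - 1 \<in> V" if "c \<noteq> 0" using c1[OF that] sub_V by blast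
qed

lemma swept_finish:
  assumes "swept (V - {r}) \<Psi> a b"
  shows "a r = 0 \<Longrightarrow> gp_returns T \<Psi>" "a r \<noteq> 0 \<Longrightarrow> gp_returns T (\<Psi> @ [{r, a r - 1}])"
proof -
  obtain A where A: "sweep_inv (V - {r}) A \<Psi>" "\<forall>w\<in>V - (V - {r}). slots (V - {r}) A (a w) (b w) w"
    using assms unfolding swept_def by blast
  have s: "slots (V - {r}) A (a r) (b r) r" using A(2) r_V by blast
  have Int: "kids r \<inter> (V - {r}) = kids r" using kidsD by blast
  show "gp_returns T \<Psi>" if "a r = 0"
  proof (rule sweep_finish(2)[OF A(1)])
    show "\<forall>c\<in>kids r. A \<inter> sub c = {}" using s that unfolding slots_def Int live_def by blast
  qed
  show "gp_returns T (\<Psi> @ [{r, a r - 1}])" if "a r \<noteq> 0"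
  proof -
    obtain c where "c \<in> kids r" "a r - 1 \<in> A \<inter> sub c" using slotsD(2)[OF s \<open>a r \<noteq> 0\<close>] by blast
    then show ?thesis using sweep_finish(1)[OF A(1)] by blast
  qed
qed

text \<open>Away from the root exactly one neighbour is the parent, so the degree test of the
  program recognises the original leaves.\<close>

lemma degree_kids:
  assumes "v \<in> V" "v \<noteq> r"
  shows "card (nbrs T v) - 1 = 0 \<longleftrightarrow> kids v = {}"
proof -
  have "nbrs T v = insert (par v) (kids v)"
    using assms unfolding T_contraction nbrs_contraction cov_V kids_def by auto
  moreover have "par v \<notin> kids v" using par_ix[OF assms] par_ix[of "par v"] by (auto simp: kids_def)
  moreover have "finite (kids v)" using finite_V by (rule rev_finite_subset) (auto simp: kids_def)
  ultimately show ?thesis by simp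
qed

end

section \<open>The complete program and its running time\<close>

definition sweep_test :: aexp where "sweep_test = Sub (Reg ''i'') one"

definition emit :: "aexp \<Rightarrow> aexp \<Rightarrow> com" where
  "emit e f = Seq (Store ''fst'' (Reg ''k'') e) (Seq (Store ''snd'' (Reg ''k'') f)
    (Assign ''k'' (Add (Reg ''k'') one)))"

definition sweep_step :: com where
  "sweep_step = Seq (Assign ''i'' (Sub (Reg ''i'') one))
    (Seq (Assign ''v'' (Arr ''ord'' (Reg ''i'')))
    (Seq (Assign ''p'' (Sub (Arr ''par'' (Reg ''v'')) one))
    (If (Arr ''b'' (Reg ''v''))
      (emit (Sub (Arr ''a'' (Reg ''v'')) one) (Sub (Arr ''b'' (Reg ''v'')) one))
      (Seq (If (Sub (degree_of (Reg ''v'')) one) (Assign ''c'' (Arr ''a'' (Reg ''v'')))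
          (Assign ''c'' (Add (Reg ''v'') one)))
        (If (Reg ''c'') (If (Arr ''a'' (Reg ''p'')) (Store ''b'' (Reg ''p'') (Reg ''c''))
          (Store ''a'' (Reg ''p'') (Reg ''c''))) Skip)))))"

definition sweep_end :: com where
  "sweep_end = If (Arr ''a'' (Reg ''r'')) (emit (Reg ''r'') (Sub (Arr ''a'' (Reg ''r'')) one)) Skip"

definition gpack_program :: com where
  "gpack_program = Seq (While leaf_test leaf_step) (Seq bfs_init (Seq (While bfs_test bfs_step)
    (Seq (While sweep_test sweep_step) sweep_end)))"

text \<open>Storing a pair in the cells at \<open>k\<close> leaves the pairs output before
  intact.\<close>

lemma map_pairs_upd:
  "map (\<lambda>i. {if i = k then x else f i, if i = k then y else g i}) [0..<k] = map (\<lambda>i. {f i, g i}) [0..<k]"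
  by (rule map_cong) auto

lemma runs_mono: "runs W c m k Q \<Longrightarrow> k \<le> k' \<Longrightarrow> (\<And>m. Q m \<Longrightarrow> R m) \<Longrightarrow> runs W c m k' R"
  unfolding runs_def by (meson le_trans)

context ram_input
begin

lemma sweep_runs:
  assumes bfs: "bfs_mem r m" "reg m ''i'' = reg m ''q''" and r: "card (nbrs T r) \<le> 1"
  shows "runs W (Seq (While sweep_test sweep_step) sweep_end) m
    (((cost sweep_test + 1 + steps sweep_step) * n + cost sweep_test + 1) + steps sweep_end)
    (\<lambda>m. gp_returns T (output_pairs m))"
proof -
  define os where "os = ord_list m"
  define par where "par = arr m ''par''"
  have len: "length os = reg m ''q''" by (simp add: os_def ord_list_def)
  have inv: "bfs_inv r os (length os) (reg m ''j'') par"
    and mem: "arr m ''start'' = start_arr" "reg m ''r'' = r" "reg m ''k'' = 0"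
      "arr m ''a'' = (\<lambda>_. 0)" "arr m ''b'' = (\<lambda>_. 0)"
    using bfs unfolding bfs_mem_def len by (simp_all add: os_def par_def)
  define pf where "pf = (\<lambda>v. par v - 1)"
  obtain ix where tree: "rooted_tree {..<n} r pf ix T" and ix: "\<And>k. k < n \<Longrightarrow> ix (os ! k) = k"
    using bfs_rooted_tree(1)[OF inv r] unfolding pf_def by blast
  have os_n: "length os = n" using bfs_rooted_tree(2)[OF inv r] .
  interpret R: nat_rooted_tree "{..<n}" r pf ix T
    by (rule nat_rooted_tree.intro[OF tree])
  have os: "set os = {..<n}" "distinct os" "os ! 0 = r"
    using bfs_complete[OF inv] inv unfolding bfs_inv_def by blast+
  have os_less: "os ! k < n" if "k < n" for k using os(1) nth_mem[of k os] os_n that by auto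
  have par_le: "par v \<le> n" if "v < n" for v using R.par_V[of v] that by (simp add: pf_def)
  have ord: "arr m ''ord'' k = os ! k" if "k < n" for k
    using that os_n len by (simp add: os_def ord_list_def)
  \<comment> \<open>The processed vertices are the queue from position \<open>i\<close> on. An
    iteration lowers \<open>i\<close> by one and outputs at most one pair, which preserves the bound
    on the sum of \<open>k\<close> and \<open>i\<close>; at the end it leaves room for the pair of
    the root.\<close>
  define I where "I m' \<longleftrightarrow> arr m' ''start'' = start_arr \<and> reg m' ''r'' = r \<and> (\<forall>k<n. arr m' ''ord'' k = os ! k) \<and>
    arr m' ''par'' = par \<and> 1 \<le> reg m' ''i'' \<and> reg m' ''i'' \<le> n \<and> reg m' ''k'' + reg m' ''i'' \<le> n \<and>
    R.swept (set (drop (reg m' ''i'') os)) (output_pairs m') (arr m' ''a'') (arr m' ''b'')" for m'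
  have r_n: "r < n" using R.r_V by simp
  have a_le: "x \<le> n" if "x \<noteq> 0 \<Longrightarrow> x - 1 \<in> {..<n}" for x using that by (cases x) auto
  have loop: "runs W (While sweep_test sweep_step) m
    ((cost sweep_test + 1 + steps sweep_step) * reg m ''i'' + cost sweep_test + 1) (\<lambda>m'. I m' \<and> val m' sweep_test = 0)"
  proof (rule runs_While[where I = I and \<phi> = "\<lambda>m. reg m ''i''"])
    have "reg m ''i'' = n" using bfs(2) len os_n by simp
    then show "I m"
      using mem ord n_pos R.swept_start os_n by (simp add: I_def par_def output_pairs_def)
  next
    fix m assume "I m"
    then show "fits W m sweep_test" using W by (simp add: I_def sweep_test_def)
  next
    fix m assume m: "I m" "val m sweep_test \<noteq> 0"
    let ?i = "reg m ''i''" and ?k = "reg m ''k''" and ?a = "arr m ''a''" and ?b = "arr m ''b''"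
    have M: "arr m ''start'' = start_arr" "reg m ''r'' = r" "arr m ''par'' = par"
      "?i \<le> n" "?k + ?i \<le> n" and ord: "\<And>k. k < n \<Longrightarrow> arr m ''ord'' k = os ! k"
      and sw: "R.swept (set (drop ?i os)) (output_pairs m) ?a ?b"
      using m(1) by (simp_all add: I_def)
    \<comment> \<open>Position 0 holds the root, which is left to \<open>sweep_end\<close>; hence
      the loop stops at 1 and not at 0.\<close>
    have i: "1 < ?i" using m(2) by (simp add: sweep_test_def)
    define i' where "i' = ?i - 1"
    have i': "?i = Suc i'" "0 < i'" "i' < n" using i M(4) by (auto simp: i'_def)
    define v where "v = os ! i'"
    let ?D = "set (drop ?i os)" and ?p = "pf v"
    have v_n: "v < n" using os_less i'(3) by (simp add: v_def)
    have drop: "drop i' os = v # drop ?i os"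
      using Cons_nth_drop_Suc[of i' os] i' os_n by (simp add: v_def)
    have D': "set (drop i' os) = insert v ?D" by (simp add: drop)
    have "distinct (drop i' os)" using os(2) by simp
    then have vD: "v \<in> {..<n} - ?D" using v_n by (simp add: drop)
    have vr: "v \<noteq> r" using os i' os_n nth_eq_iff_index_eq[of os i' 0] by (auto simp: v_def)
    \<comment> \<open>Kids stand behind \<open>v\<close> in the queue, so they are already
      processed.\<close>
    have kids: "R.kids v \<subseteq> ?D"
    proof
      fix c assume c: "c \<in> R.kids v"
      then have cn: "c < n" "c \<noteq> r" "pf c = v" by (auto simp: R.kids_def)
      then obtain k where k: "k < n" "c = os ! k" using os(1) os_n by (metis in_set_conv_nth lessThan_iff)
      have "ix v < ix c" using R.par_ix[of c] cn by simp
      then have "?i \<le> k" using ix[OF k(1)] ix[OF i'(3)] k(2) i'(1) by (simp add: v_def)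
      then have "os ! k = drop ?i os ! (k - ?i)" "k - ?i < length (drop ?i os)" using k(1) os_n by simp_all
      then show "c \<in> ?D" using k(2) nth_mem by metis
    qed
    have pf_v: "par v - Suc 0 = pf v" by (simp add: pf_def)
    have bounds: "?a v \<le> n" "?b v \<le> n" "par v \<le> n" "?p < n" "os ! i' = v" "?k < n"
      using a_le R.swept_bound[OF sw vD] par_le[OF v_n] R.par_V[of v] v_n M(5) i by (auto simp: v_def)
    \<comment> \<open>The parent stands before \<open>v\<close> in the queue, so it is unprocessed
      and its cells are still meaningful.\<close>
    have "?p \<notin> ?D" 
    proof
      assume "?p \<in> ?D"
      then obtain k where k: "k < length (drop ?i os)" "?p = drop ?i os ! k" by (metis in_set_conv_nth)
      then have "?p = os ! (?i + k)" "?i + k < n" using os_n by simp_all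
      then have "ix ?p = ?i + k" using ix by simp
      moreover have "ix ?p < ix v" using R.par_ix[of v] v_n vr by simp
      ultimately show False using ix[OF i'(3)] i'(1) by (simp add: v_def)
    qed
    then have pD: "?p \<in> {..<n} - ?D" using bounds by simp
    have ap: "?a ?p \<le> n" using a_le R.swept_bound(1)[OF sw pD] by blast
    have deg: "start_arr (Suc v) - start_arr v - 1 = 0 \<longleftrightarrow> R.kids v = {}"
      using R.degree_kids[of v] degree_arr[OF v_n] v_n vr by simp
    have st_W: "start_arr (Suc v) \<le> W" "start_arr v \<le> W"
      using start_arr_le[of "Suc v"] start_arr_le[of v] W by simp_all
    have n_W: "x \<le> n \<Longrightarrow> x \<le> W" for x using W by simp
    show "wp W sweep_step (\<lambda>m'. I m' \<and> reg m' ''i'' < reg m ''i'') m"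
    proof (cases "?b v = 0")
      case False
      have "R.swept (insert v ?D) (output_pairs m @ [{?a v - 1, ?b v - 1}]) ?a ?b"
        using R.swept_branch[OF sw vD vr kids False] .
      then show ?thesis
        using False M ord i' bounds pf_v st_W n_W W v_n D' ap
        by (simp add: sweep_step_def emit_def I_def output_pairs_def map_pairs_upd)
    next
      case True
      note pass = R.swept_pass[OF sw vD vr kids True]
      define c where "c = (if R.kids v = {} then Suc v else ?a v)"
      have c_n: "c \<le> n" using a_le pass(4) unfolding c_def by blast
      note pass = pass(1-3)[folded c_def]
      note facts = True M ord i' bounds pf_v st_W n_W W v_n D' ap c_n deg
      show ?thesis
      proof (cases "R.kids v = {}")
        case leaf: True
        then have c: "c = Suc v" by (simp add: c_def)
        show ?thesis using facts pass(2,3)[unfolded c] leaf c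
          by (cases "?a ?p = 0") (simp_all add: sweep_step_def I_def output_pairs_def degree_of_def)
      next
        case inner: False
        then have c: "c = ?a v" by (simp add: c_def)
        show ?thesis using facts pass[unfolded c] inner c
          by (cases "?a v = 0"; cases "?a ?p = 0")
            (simp_all add: sweep_step_def I_def output_pairs_def degree_of_def)
      qed
    qed
  qed
  have i_n: "reg m ''i'' = n" using bfs(2) len os_n by simp
  show ?thesis
  proof (rule runs_Seq)
    show "runs W (While sweep_test sweep_step) m
      ((cost sweep_test + 1 + steps sweep_step) * n + cost sweep_test + 1) (\<lambda>m'. I m' \<and> val m' sweep_test = 0)"
      using loop i_n by simp
  next
    fix m assume m: "I m \<and> val m sweep_test = 0"
    have M: "reg m ''r'' = r" "reg m ''i'' = 1" "reg m ''k'' < n"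
      and sw: "R.swept (set (drop (reg m ''i'') os)) (output_pairs m) (arr m ''a'') (arr m ''b'')"
      using m by (auto simp: I_def sweep_test_def)
    obtain os' where os': "os = r # os'" using os(3) os_n n_pos by (cases os) auto
    then have "set (drop 1 os) = {..<n} - {r}" using os(1,2) by auto
    then have sw: "R.swept ({..<n} - {r}) (output_pairs m) (arr m ''a'') (arr m ''b'')" using sw M(2) by simp
    have "arr m ''a'' r \<le> n"
      using a_le[of "arr m ''a'' r"] R.swept_bound(1)[OF sw, of r] r_n by simp
    then have "wp W sweep_end (\<lambda>m. gp_returns T (output_pairs m)) m"
      using M W r_n R.swept_finish[OF sw]
      by (simp add: sweep_end_def emit_def output_pairs_def map_pairs_upd)
    then show "runs W sweep_end m (steps sweep_end) (\<lambda>m. gp_returns T (output_pairs m))" by (rule runs_wp)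
  qed
qed

lemma program_runs: "runs W gpack_program (input_mem adj) (1000 * n) (\<lambda>m. gp_returns T (output_pairs m))"
proof -
  let ?L = "(cost leaf_test + 1 + steps leaf_step) * n + cost leaf_test + 1"
    and ?B = "(cost bfs_test + 1 + steps bfs_step) * (3 * n) + cost bfs_test + 1"
    and ?S = "(cost sweep_test + 1 + steps sweep_step) * n + cost sweep_test + 1 + steps sweep_end"
  have "runs W gpack_program (input_mem adj) (?L + (steps bfs_init + (?B + ?S))) (\<lambda>m. gp_returns T (output_pairs m))"
    unfolding gpack_program_def
  proof (rule runs_Seq[OF leaf_loop], elim conjE)
    fix m assume m: "leaf_inv m" "reg m ''r'' < n" "card (nbrs T (reg m ''r'')) \<le> 1"
    show "runs W (Seq bfs_init (Seq (While bfs_test bfs_step) (Seq (While sweep_test sweep_step) sweep_end))) m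
      (steps bfs_init + (?B + ?S)) (\<lambda>m. gp_returns T (output_pairs m))"
    proof (rule runs_Seq[OF runs_wp[OF bfs_start[OF m(1,2)]]], elim conjE)
      fix m' assume m': "bfs_mem (reg m ''r'') m'" "slots_left (ord_list m') (reg m' ''i'') (reg m' ''j'') \<le> 3 * n"
      have "runs W (While bfs_test bfs_step) m' ?B (\<lambda>m'. bfs_mem (reg m ''r'') m' \<and> reg m' ''i'' = reg m' ''q'')"
        by (rule runs_mono[OF bfs_loop[OF m'(1)]])
          (rule add_le_mono1, rule add_le_mono1, rule mult_le_mono2, rule m'(2))
      then show "runs W (Seq (While bfs_test bfs_step) (Seq (While sweep_test sweep_step) sweep_end)) m'
        (?B + ?S) (\<lambda>m. gp_returns T (output_pairs m))"
        by (rule runs_Seq) (use sweep_runs[OF _ _ m(3)] in simp)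
    qed
  qed
  then show ?thesis
    \<comment> \<open>The factor 1000 generously covers the costs of the three loops; since
      \<open>n\<close> is positive, it also absorbs the additive constants.\<close>
    by (rule runs_mono)
      (use n_pos in \<open>simp_all add: leaf_test_def leaf_step_def bfs_init_def bfs_test_def bfs_step_def
        sweep_test_def sweep_step_def sweep_end_def emit_def degree_of_def\<close>)
qed

end

theorem theorem3p5:
  shows "(\<forall>T :: 'a pair_pre_digraph. utree T \<longrightarrow>
            gp_terminates T \<and> gp_never_stuck T \<and>
            (\<forall>\<Psi>. gp_returns T \<Psi> \<longrightarrow>
              (\<exists>S. geodesic_packing T S \<and> card S = gpack T \<and>
                   distinct \<Psi> \<and> set \<Psi> = (\<lambda>p. {hd p, last p}) ` S)))
       \<and> (\<exists>P c. \<forall>(T :: nat pair_pre_digraph) adj. utree T \<and> adjacency_lists T adj \<longrightarrow>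
            (\<exists>t m. exec (c * card (pverts T)) P (input_mem adj) t m \<and>
                   t \<le> c * card (pverts T) \<and>
                   gp_returns T (output_pairs m)))"
proof (intro conjI allI impI)
  fix T :: "'a pair_pre_digraph" assume T: "utree T"
  show "gp_terminates T" "gp_never_stuck T"
    using gp_terminates_utree[OF T] gp_never_stuck_utree[OF T] .
  note tree = tree_or_emptyD(1,2)[OF utree_tree_or_empty(1)[OF T]]
  fix \<Psi> assume "gp_returns T \<Psi>"
  then show "\<exists>S. geodesic_packing T S \<and> card S = gpack T \<and> distinct \<Psi> \<and> set \<Psi> = (\<lambda>p. {hd p, last p}) ` S"
    using optimal_ends_geodesic_packing[OF tree gp_returns_optimal[OF T]] by blast
next
  have "\<exists>t m. exec (1000 * card (pverts T)) gpack_program (input_mem adj) t m \<and>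
      t \<le> 1000 * card (pverts T) \<and> gp_returns T (output_pairs m)"
    if T: "utree T \<and> adjacency_lists T adj" for T :: "nat pair_pre_digraph" and adj
  proof -
    \<comment> \<open>One constant has to serve both as time bound and as word bound; 1000 exceeds
      the factor 5 that the locale asks for.\<close>
    interpret ram_input T adj "1000 * length adj" "length adj"
      using T by unfold_locales auto
    have "card (pverts T) = length adj" using verts by simp
    then show ?thesis using program_runs unfolding runs_def by metis
  qed
  then show "\<exists>P c. \<forall>(T :: nat pair_pre_digraph) adj. utree T \<and> adjacency_lists T adj \<longrightarrow>
            (\<exists>t m. exec (c * card (pverts T)) P (input_mem adj) t m \<and>
                   t \<le> c * card (pverts T) \<and> gp_returns T (output_pairs m))" by blast
qed

end
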